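(* Let $\Omega\subset\mathbb{R}^d$ be a bounded domain with Lipschitz boundary, let $J$ be a functional on $L^q(\Omega)$ such that $\|u\|_{BV}\le C\,J(u)$ for some constant $C>0$ and all $u$, and let $T$ and $T_n$ ($n=1,2,\dots$) be functionals on $L^q(\Omega)$. Assume $1\le q<\frac{d}{d-1}$ and that $T$ and each $T_n$ are CBV-coercive (with respect to $J$), lower semi-continuous on $L^q(\Omega)$, and have a unique minimizer over $L^q(\Omega)$. Assume in addition: (1) (Uniform CBV-coercivity) for any sequence $v_n\in L^q(\Omega)$, $\lim_{n\to\infty}T_n(v_n)=\infty$ whenever $\lim_{n\to\infty}J(v_n)=\infty$; (2) (Consistency) $T_n\to T$ uniformly on $J$-bounded sets, i.e. given $B>0$ and $\epsilon>0$ there exists $N$ such that $|T_n(u)-T(u)|<\epsilon$ whenever $n\ge N$ and $J(u)\le B$. Then the problem $\min_{u\in L^q(\Omega)}T(u)$ is stable with respect to the perturbed problems $\min_{u\in L^q(\Omega)}T_n(u)$: if $\bar u$ minimizes $T$ and $u_n$ minimizes $T_n$, then $$\|u_n-\bar u\|_{L^q(\Omega)}\to 0 .$$ If instead $q=\frac{d}{d-1}$, $d\ge 2$, and the lower semi-continuity assumption on $T$ and each $T_n$ is replaced by weak lower semi-continuity (all other assumptions being kept), then the convergence is weak: $u_n-\bar u\rightharpoonup 0$ in $L^q(\Omega)$.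
   Context: The functionals $T$, $T_n$ and $J$ may take the value $+\infty$. A functional $T$ is called CBV-coercive (with respect to $J$) if $T(u)\to+\infty$ whenever $J(u)\to+\infty$, where $J$ is a functional satisfying $\|u\|_{BV}\le C\,J(u)$. The BV norm is $\|u\|_{BV}:=\|u\|_{L^1(\Omega)}+\|u\|_{\dot{BV}}$, where $\|u\|_{\dot{BV}}:=\sup_{\sigma\in V}\int_\Omega(-u\,\mathrm{div}\,\sigma)\,dx$ and $V:=\{\sigma\in C_c^1(\Omega;\mathbb{R}^d):|\sigma(x)|\le 1\text{ for all }x\in\Omega\}$ (with value $+\infty$ if $u$ is not of bounded variation). *)

theory Defs
  imports "HOL-Analysis.Analysis"
begin

text \<open>
  Elements of \<open>L\<^sup>p(S)\<close> are represented by functions on the whole space that are measurable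
  and \<open>p\<close>-integrable on \<open>S\<close>; their values outside \<open>S\<close> are irrelevant. Two representatives denote
  the same element iff they agree almost everywhere on \<open>S\<close>. All notions below are meant
  for finite \<open>p \<ge> 1\<close>.
\<close>

definition Lp_space :: "'a::euclidean_space set \<Rightarrow> real \<Rightarrow> ('a \<Rightarrow> real) set" where
  "Lp_space S p = {u. u \<in> borel_measurable (lebesgue_on S) \<and>
                      integrable (lebesgue_on S) (\<lambda>x. \<bar>u x\<bar> powr p)}"

definition Lp_norm :: "'a::euclidean_space set \<Rightarrow> real \<Rightarrow> ('a \<Rightarrow> real) \<Rightarrow> real" where
  "Lp_norm S p u = (LINT x|lebesgue_on S. \<bar>u x\<bar> powr p) powr (1 / p)"

definition Lp_eq :: "'a::euclidean_space set \<Rightarrow> ('a \<Rightarrow> real) \<Rightarrow> ('a \<Rightarrow> real) \<Rightarrow> bool" where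
  "Lp_eq S u v \<longleftrightarrow> (AE x in lebesgue_on S. u x = v x)"

text \<open>The topological dual of \<open>L\<^sup>p(S)\<close>; boundedness forces
  invariance under almost everywhere equality.\<close>

definition Lp_dual :: "'a::euclidean_space set \<Rightarrow> real \<Rightarrow> (('a \<Rightarrow> real) \<Rightarrow> real) set" where
  "Lp_dual S p = {\<phi>.
     (\<forall>u\<in>Lp_space S p. \<forall>v\<in>Lp_space S p. \<phi> (\<lambda>x. u x + v x) = \<phi> u + \<phi> v) \<and>
     (\<forall>c. \<forall>u\<in>Lp_space S p. \<phi> (\<lambda>x. c * u x) = c * \<phi> u) \<and>
     (\<exists>K. \<forall>u\<in>Lp_space S p. \<bar>\<phi> u\<bar> \<le> K * Lp_norm S p u)}"

definition Lp_tendsto ::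
    "'a::euclidean_space set \<Rightarrow> real \<Rightarrow> (nat \<Rightarrow> 'a \<Rightarrow> real) \<Rightarrow> ('a \<Rightarrow> real) \<Rightarrow> bool" where
  "Lp_tendsto S p v u \<longleftrightarrow> u \<in> Lp_space S p \<and> (\<forall>n. v n \<in> Lp_space S p) \<and>
     (\<lambda>n. Lp_norm S p (\<lambda>x. v n x - u x)) \<longlonglongrightarrow> 0"

definition Lp_weakly_tendsto ::
    "'a::euclidean_space set \<Rightarrow> real \<Rightarrow> (nat \<Rightarrow> 'a \<Rightarrow> real) \<Rightarrow> ('a \<Rightarrow> real) \<Rightarrow> bool" where
  "Lp_weakly_tendsto S p v u \<longleftrightarrow> u \<in> Lp_space S p \<and> (\<forall>n. v n \<in> Lp_space S p) \<and>
     (\<forall>\<phi>\<in>Lp_dual S p. (\<lambda>n. \<phi> (v n)) \<longlonglongrightarrow> \<phi> u)"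

text \<open>Functionals on \<open>L\<^sup>p(S)\<close> with values in \<open>(-\<infinity>, \<infinity>]\<close>, well defined on almost-everywhere classes.\<close>

definition Lp_functional ::
    "'a::euclidean_space set \<Rightarrow> real \<Rightarrow> (('a \<Rightarrow> real) \<Rightarrow> ereal) \<Rightarrow> bool" where
  "Lp_functional S p F \<longleftrightarrow> (\<forall>u\<in>Lp_space S p. F u \<noteq> -\<infinity>) \<and>
     (\<forall>u\<in>Lp_space S p. \<forall>v\<in>Lp_space S p. Lp_eq S u v \<longrightarrow> F u = F v)"

definition Lp_lsc ::
    "'a::euclidean_space set \<Rightarrow> real \<Rightarrow> (('a \<Rightarrow> real) \<Rightarrow> ereal) \<Rightarrow> bool" where
  "Lp_lsc S p F \<longleftrightarrow> (\<forall>u v. Lp_tendsto S p v u \<longrightarrow> F u \<le> liminf (\<lambda>n. F (v n)))"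

definition Lp_weakly_lsc ::
    "'a::euclidean_space set \<Rightarrow> real \<Rightarrow> (('a \<Rightarrow> real) \<Rightarrow> ereal) \<Rightarrow> bool" where
  "Lp_weakly_lsc S p F \<longleftrightarrow> (\<forall>u v. Lp_weakly_tendsto S p v u \<longrightarrow> F u \<le> liminf (\<lambda>n. F (v n)))"

definition Lp_minimizer ::
    "'a::euclidean_space set \<Rightarrow> real \<Rightarrow> (('a \<Rightarrow> real) \<Rightarrow> ereal) \<Rightarrow> ('a \<Rightarrow> real) \<Rightarrow> bool" where
  "Lp_minimizer S p F = is_arg_min F (\<lambda>u. u \<in> Lp_space S p)"

definition Lp_unique_minimizer ::
    "'a::euclidean_space set \<Rightarrow> real \<Rightarrow> (('a \<Rightarrow> real) \<Rightarrow> ereal) \<Rightarrow> bool" where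
  "Lp_unique_minimizer S p F \<longleftrightarrow>
     (\<exists>u. Lp_minimizer S p F u \<and> (\<forall>v. Lp_minimizer S p F v \<longrightarrow> Lp_eq S v u))"

text \<open>The limits are taken in the extended reals, so \<open>J (v n) \<longlonglongrightarrow> \<infinity>\<close> includes
  sequences on which \<open>J\<close> attains \<open>\<infinity>\<close>; in particular \<open>J u = \<infinity>\<close> implies \<open>F u = \<infinity>\<close>.\<close>

definition CBV_coercive ::
    "'a::euclidean_space set \<Rightarrow> real \<Rightarrow> (('a \<Rightarrow> real) \<Rightarrow> ereal) \<Rightarrow> (('a \<Rightarrow> real) \<Rightarrow> ereal) \<Rightarrow> bool" where
  "CBV_coercive S p J F \<longleftrightarrow>
     (\<forall>v. (\<forall>n. v n \<in> Lp_space S p) \<longrightarrow> (\<lambda>n. J (v n)) \<longlonglongrightarrow> \<infinity> \<longrightarrow> (\<lambda>n. F (v n)) \<longlonglongrightarrow> \<infinity>)"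

definition uniformly_CBV_coercive ::
    "'a::euclidean_space set \<Rightarrow> real \<Rightarrow> (('a \<Rightarrow> real) \<Rightarrow> ereal) \<Rightarrow>
     (nat \<Rightarrow> ('a \<Rightarrow> real) \<Rightarrow> ereal) \<Rightarrow> bool" where
  "uniformly_CBV_coercive S p J F \<longleftrightarrow>
     (\<forall>v. (\<forall>n. v n \<in> Lp_space S p) \<longrightarrow> (\<lambda>n. J (v n)) \<longlonglongrightarrow> \<infinity> \<longrightarrow> (\<lambda>n. F n (v n)) \<longlonglongrightarrow> \<infinity>)"

text \<open>Since \<open>\<infinity> - \<infinity> = \<infinity>\<close> in \<^typ>\<open>ereal\<close>, points where both functionals are infinite,
  which count as perfect agreement, are admitted separately.\<close>

definition uniformly_consistent ::
    "'a::euclidean_space set \<Rightarrow> real \<Rightarrow> (('a \<Rightarrow> real) \<Rightarrow> ereal) \<Rightarrow>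
     (nat \<Rightarrow> ('a \<Rightarrow> real) \<Rightarrow> ereal) \<Rightarrow> (('a \<Rightarrow> real) \<Rightarrow> ereal) \<Rightarrow> bool" where
  "uniformly_consistent S p J F G \<longleftrightarrow>
     (\<forall>B>0. \<forall>\<epsilon>>0. \<exists>N. \<forall>n\<ge>N. \<forall>u\<in>Lp_space S p. J u \<le> ereal B \<longrightarrow>
        \<bar>F n u - G u\<bar> < ereal \<epsilon> \<or> F n u = \<infinity> \<and> G u = \<infinity>)"

definition divergence :: "('a::euclidean_space \<Rightarrow> 'a) \<Rightarrow> 'a \<Rightarrow> real" where
  "divergence \<sigma> x = (\<Sum>b\<in>Basis. frechet_derivative \<sigma> (at x) b \<bullet> b)"

text \<open>Compactly supported \<open>C\<^sup>1\<close> vector fields on \<open>S\<close>, extended by zero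
  to the whole space, with pointwise Euclidean norm at most 1.\<close>

definition BV_test_fields :: "'a::euclidean_space set \<Rightarrow> ('a \<Rightarrow> 'a) set" where
  "BV_test_fields S = {\<sigma>.
     (\<forall>x\<in>S. \<sigma> differentiable (at x)) \<and>
     (\<forall>b\<in>Basis. continuous_on S (\<lambda>x. frechet_derivative \<sigma> (at x) b)) \<and>
     compact (closure {x. \<sigma> x \<noteq> 0}) \<and> closure {x. \<sigma> x \<noteq> 0} \<subseteq> S \<and>
     (\<forall>x\<in>S. norm (\<sigma> x) \<le> 1)}"

definition BV_seminorm :: "'a::euclidean_space set \<Rightarrow> ('a \<Rightarrow> real) \<Rightarrow> ereal" where
  "BV_seminorm S u =
     (SUP \<sigma>\<in>BV_test_fields S. ereal (LINT x|lebesgue_on S. - u x * divergence \<sigma> x))"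

text \<open>Only meaningful for \<open>u \<in> L\<^sup>1(S)\<close>.\<close>

definition BV_norm :: "'a::euclidean_space set \<Rightarrow> ('a \<Rightarrow> real) \<Rightarrow> ereal" where
  "BV_norm S u = ereal (Lp_norm S 1 u) + BV_seminorm S u"

text \<open>Near each boundary point \<open>S\<close> is the strict epigraph of a Lipschitz function in a
  rotated coordinate system. The unit vector \<open>e\<close> is the last axis of that system;
  \<open>x - (x \<bullet> e) *\<^sub>R e\<close> represents the first \<open>d - 1\<close> coordinates of \<open>x\<close>.\<close>

definition lipschitz_boundary :: "'a::euclidean_space set \<Rightarrow> bool" where
  "lipschitz_boundary S \<longleftrightarrow>
     (\<forall>z\<in>frontier S. \<exists>r>0. \<exists>e. \<exists>\<gamma> :: 'a \<Rightarrow> real. \<exists>L.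
        norm e = 1 \<and> L-lipschitz_on {y. y \<bullet> e = 0} \<gamma> \<and>
        S \<inter> ball z r = {x \<in> ball z r. \<gamma> (x - (x \<bullet> e) *\<^sub>R e) < x \<bullet> e})"

end

theory Submission
  imports Defs "HOL-Complex_Analysis.Great_Picard"
begin

text \<open>
  The stability statement is a compactness argument. As \<open>T\<^sub>n \<rightarrow> T\<close> at \<open>ubar\<close>, the minimal values
  \<open>T\<^sub>n (u\<^sub>n) \<le> T\<^sub>n (ubar)\<close> stay bounded, so uniform coercivity bounds \<open>J (u\<^sub>n)\<close> and hence the BV norms of
  the \<open>u\<^sub>n\<close> (\<open>bounded_along_minimizers\<close>). On a \<open>J\<close>-bounded set \<open>T\<^sub>n\<close> is uniformly close to \<open>T\<close>, so \<open>(u\<^sub>n)\<close>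
  is a minimizing sequence of \<open>T\<close> (\<open>perturbed_minimizers_minimize\<close>). Every subsequence has a further one
  that converges in \<open>L\<^sup>1\<close> (\<open>BV_compact_L1\<close>) and is bounded in \<open>L\<^sup>r\<close> with \<open>r = d / (d - 1)\<close>,
  or with any finite \<open>r\<close> if \<open>d = 1\<close> (\<open>BV_embeds_Lr\<close>). Below the critical exponent this implies strong convergence in \<open>L\<^sup>q\<close>
  (\<open>Lq_convergence_by_interpolation\<close>), at the critical exponent weak convergence
  (\<open>weakly_null_if_bounded_and_L1_null\<close>). In both cases lower semicontinuity makes the limit a minimizer
  of \<open>T\<close>, that is, \<open>ubar\<close>; since the subsequence was arbitrary, the whole sequence converges.

  The two facts about BV rest on one estimate: \<open>\<integral>\<^sub>U \<bar>f (x + h) - f x\<bar> dx \<le> \<bar>h\<bar> \<bar>Df\<bar>(\<Omega>)\<close> whenever the segments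
  from \<open>U\<close> in direction \<open>h\<close> remain in \<open>\<Omega>\<close> (\<open>translation_estimate\<close>). A Lipschitz boundary provides, near each
  point of the closure, a full cone of such directions (\<open>exists_cone_at\<close>).

  For the embedding let \<open>m\<^sub>k\<close> be the measure of \<open>{\<bar>f\<bar> \<ge> 2\<^sup>k}\<close>. From a point with \<open>\<bar>f\<bar> \<ge> 2\<^bsup>k+1\<^esup>\<close> one looks into
  a ball of the cone of radius about \<open>m\<^sub>k\<^bsup>1/d\<^esup>\<close>; in at least half of it \<open>\<bar>f\<bar> < 2\<^sup>k\<close>, so the part of \<open>\<bar>f\<bar>\<close>
  between \<open>2\<^sup>k\<close> and \<open>2\<^bsup>k+1\<^esup>\<close> jumps by \<open>2\<^sup>k\<close>. Averaging gives \<open>2\<^sup>k m\<^bsub>k+1\<^esub> \<le> C m\<^sub>k\<^bsup>1/d\<^esup> W\<^sub>k\<close>, where \<open>W\<^sub>k\<close> is the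
  variation of this part and \<open>\<Sum> W\<^sub>k\<close> is controlled by the variation of \<open>f\<close> (\<open>level_estimate\<close>). Such a
  recursion forces \<open>\<Sum> 2\<^bsup>kr\<^esup> m\<^sub>k < \<infinity>\<close> (\<open>level_sum_bound\<close>), which is the embedding with its critical exponent.

  For the compactness, averages against tent-shaped kernels supported in the cone are uniformly close to
  the functions in \<open>L\<^sup>1\<close> and equi-Lipschitz, so a diagonal sequence of them converges pointwise.
\<close>

section \<open>Cut-off functions and the \<open>L\<^sup>1\<close> norm by duality\<close>

text \<open>The derivative is carried along explicitly, because the divergence of a test field is formed from it.\<close>

definition C1_with :: "('a::euclidean_space \<Rightarrow> real) \<Rightarrow> ('a \<Rightarrow> 'a \<Rightarrow> real) \<Rightarrow> bool" where
  "C1_with f f' \<longleftrightarrow> (\<forall>x. (f has_derivative f' x) (at x)) \<and> (\<forall>v. continuous_on UNIV (\<lambda>x. f' x v))"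

lemma C1_with_imp_continuous:
  assumes "C1_with f f'" shows "continuous_on S f"
proof -
  have "continuous_on UNIV f"
    using assms by (auto simp: C1_with_def continuous_on_eq_continuous_at intro: has_derivative_continuous)
  thus ?thesis using continuous_on_subset by blast
qed

lemma C1_with_const: "C1_with (\<lambda>x. c) (\<lambda>x v. 0)"
  by (auto simp: C1_with_def)

lemma C1_with_diff:
  "C1_with f f' \<Longrightarrow> C1_with g g' \<Longrightarrow> C1_with (\<lambda>x. f x - g x) (\<lambda>x v. f' x v - g' x v)"
  unfolding C1_with_def by (auto intro!: derivative_intros continuous_intros)

lemma C1_with_sum:
  "(\<And>i. i \<in> I \<Longrightarrow> C1_with (f i) (f' i)) \<Longrightarrow>
   C1_with (\<lambda>x. \<Sum>i\<in>I. f i x) (\<lambda>x v. \<Sum>i\<in>I. f' i x v)"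
  unfolding C1_with_def by (auto intro!: derivative_intros continuous_intros)

text \<open>The building block of the cut-off functions: continuously differentiable, zero on the left half line,
  and at least \<open>1\<close> on \<open>[1, \<infinity>)\<close>.\<close>

definition pos_part_sq :: "real \<Rightarrow> real" where "pos_part_sq t = (max 0 t)\<^sup>2"

lemma pos_part_sq_simps [simp]: "t \<le> 0 \<Longrightarrow> pos_part_sq t = 0" "0 \<le> t \<Longrightarrow> pos_part_sq t = t\<^sup>2"
  by (auto simp: pos_part_sq_def max_def)

lemma pos_part_sq_nonneg [simp]: "0 \<le> pos_part_sq t"
  by (simp add: pos_part_sq_def)

lemma pos_part_sq_ge_1: "1 \<le> t \<Longrightarrow> 1 \<le> pos_part_sq t"
  by (simp add: pos_part_sq_def max_def)

lemma pos_part_sq_le_1: "t \<le> 1 \<Longrightarrow> pos_part_sq t \<le> 1"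
  by (auto simp: pos_part_sq_def max_def power_le_one)

lemma DERIV_pos_part_sq: "(pos_part_sq has_real_derivative 2 * max 0 t) (at t)"
proof -
  consider "t < 0" | "t > 0" | "t = 0" by linarith
  thus ?thesis
  proof cases
    case 1
    have "(pos_part_sq has_real_derivative 0) (at t)"
      by (rule has_field_derivative_transform_within_open[where f="\<lambda>x. 0" and S="{..<0}"])
         (use 1 in auto)
    thus ?thesis using 1 by simp
  next
    case 2
    have "((\<lambda>x. x\<^sup>2) has_real_derivative 2 * t) (at t)"
      by (auto intro!: derivative_eq_intros)
    then have "(pos_part_sq has_real_derivative 2 * t) (at t)"
      by (rule has_field_derivative_transform_within_open[where S="{0<..}"])
         (use 2 in auto)
    thus ?thesis using 2 by simp
  next
    case 3
    have "(\<lambda>h. pos_part_sq h / h) \<midarrow>0\<rightarrow> 0"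
    proof (rule Lim_null_comparison)
      show "\<forall>\<^sub>F h in at 0. norm (pos_part_sq h / h) \<le> \<bar>h\<bar>"
        by (intro always_eventually allI) (auto simp: pos_part_sq_def max_def power2_eq_square)
      show "((\<lambda>h::real. \<bar>h\<bar>) \<longlongrightarrow> 0) (at 0)" by (rule tendsto_eq_intros | simp)+
    qed
    thus ?thesis using 3 by (simp add: DERIV_def)
  qed
qed

lemma C1_with_pos_part_sq:
  assumes "C1_with f f'"
  shows "C1_with (\<lambda>x. pos_part_sq (f x)) (\<lambda>x v. f' x v * (2 * max 0 (f x)))"
  unfolding C1_with_def
proof safe
  fix x
  show "((\<lambda>x. pos_part_sq (f x)) has_derivative (\<lambda>v. f' x v * (2 * max 0 (f x)))) (at x)"
    using DERIV_compose_FDERIV[OF DERIV_pos_part_sq, of f "f' x" x UNIV] assms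
    by (simp add: C1_with_def)
next
  fix v
  show "continuous_on UNIV (\<lambda>x. f' x v * (2 * max 0 (f x)))"
    using assms C1_with_imp_continuous[OF assms]
    by (auto intro!: continuous_intros simp: C1_with_def)
qed

lemma C1_with_paraboloid:
  "C1_with (\<lambda>x::'a::euclidean_space. (b - (x - a) \<bullet> (x - a)) / c) (\<lambda>x v. - (2 * ((x - a) \<bullet> v)) / c)"
  unfolding C1_with_def divide_inverse
proof safe
  fix x v :: 'a
  have "((\<lambda>x. (x - a) \<bullet> (x - a)) has_derivative (\<lambda>v. (x - a) \<bullet> v + v \<bullet> (x - a))) (at x)"
    by (rule has_derivative_inner) (auto intro!: derivative_eq_intros)
  then have "((\<lambda>x. b - (x - a) \<bullet> (x - a)) has_derivative (\<lambda>v. 0 - ((x - a) \<bullet> v + v \<bullet> (x - a)))) (at x)"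
    by (intro has_derivative_diff has_derivative_const)
  then have "((\<lambda>x. (b - (x - a) \<bullet> (x - a)) * inverse c) has_derivative
      (\<lambda>v. (0 - ((x - a) \<bullet> v + v \<bullet> (x - a))) * inverse c)) (at x)"
    by (rule has_derivative_mult_left)
  then show "((\<lambda>x. (b - (x - a) \<bullet> (x - a)) * inverse c) has_derivative
      (\<lambda>v. - (2 * ((x - a) \<bullet> v)) * inverse c)) (at x)"
    by (simp add: inner_commute)
  show "continuous_on UNIV (\<lambda>x. - (2 * ((x - a) \<bullet> v)) * inverse c)"
    by (intro continuous_intros)
qed

text \<open>A sum \<open>\<beta>\<close> of bumps on a finite cover of \<open>K\<close> is at least \<open>1\<close> on \<open>K\<close> and vanishes off a compact subset of \<open>W\<close>;
  applying \<open>s \<mapsto> 1 - pos_part_sq (1 - s)\<close>, which fixes \<open>0\<close> and maps \<open>[1, \<infinity>)\<close> to \<open>1\<close>, truncates it smoothly.\<close>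

lemma C1_Urysohn:
  fixes K W :: "'a::euclidean_space set"
  assumes "compact K" "open W" "K \<subseteq> W"
  shows "\<exists>\<phi> \<phi>' L. C1_with \<phi> \<phi>' \<and> (\<forall>x. 0 \<le> \<phi> x \<and> \<phi> x \<le> 1) \<and> (\<forall>x\<in>K. \<phi> x = 1) \<and>
    compact L \<and> L \<subseteq> W \<and> (\<forall>x. x \<notin> L \<longrightarrow> \<phi> x = 0)"
proof -
  have "\<forall>a\<in>K. \<exists>r>0. cball a (2*r) \<subseteq> W"
  proof
    fix a assume "a \<in> K"
    then obtain e where "e > 0" "cball a e \<subseteq> W"
      using assms open_contains_cball by blast
    thus "\<exists>r>0. cball a (2*r) \<subseteq> W" by (intro exI[of _ "e/2"]) auto
  qed
  then obtain r where r: "\<And>a. a \<in> K \<Longrightarrow> r a > 0" "\<And>a. a \<in> K \<Longrightarrow> cball a (2 * r a) \<subseteq> W"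
    by metis
  obtain D where D: "D \<subseteq> K" "finite D" "K \<subseteq> (\<Union>a\<in>D. ball a (r a))"
  proof (rule compactE_image[OF assms(1), of K "\<lambda>a. ball a (r a)"])
    show "K \<subseteq> (\<Union>a\<in>K. ball a (r a))" using r(1) by auto
  qed auto
  define \<beta> where "\<beta> x = (\<Sum>a\<in>D. pos_part_sq (((2 * r a)\<^sup>2 - (x - a) \<bullet> (x - a)) / (3 * (r a)\<^sup>2)))" for x
  define L where "L = (\<Union>a\<in>D. cball a (2 * r a))"
  have "\<exists>\<beta>'. C1_with \<beta> \<beta>'"
    unfolding \<beta>_def by (rule exI, rule C1_with_sum, rule C1_with_pos_part_sq, rule C1_with_paraboloid)
  then obtain \<beta>' where \<beta>': "C1_with \<beta> \<beta>'" by blast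
  have \<beta>0: "0 \<le> \<beta> x" for x by (auto simp: \<beta>_def intro!: sum_nonneg)
  have \<beta>1: "1 \<le> \<beta> x" if x: "x \<in> K" for x
  proof -
    obtain a where a: "a \<in> D" "dist a x < r a" using D x by auto
    have "(x - a) \<bullet> (x - a) \<le> (r a)\<^sup>2"
      using a by (simp add: dot_square_norm dist_norm norm_minus_commute power_mono)
    then have "1 \<le> ((2 * r a)\<^sup>2 - (x - a) \<bullet> (x - a)) / (3 * (r a)\<^sup>2)"
      using r(1)[of a] a D by (subst le_divide_eq_1_pos) (auto simp: power_mult_distrib)
    then have "1 \<le> pos_part_sq (((2 * r a)\<^sup>2 - (x - a) \<bullet> (x - a)) / (3 * (r a)\<^sup>2))"
      by (rule pos_part_sq_ge_1)
    also have "\<dots> \<le> \<beta> x" unfolding \<beta>_def using a D by (intro member_le_sum) auto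
    finally show ?thesis .
  qed
  have \<beta>L: "\<beta> x = 0" if x: "x \<notin> L" for x
    unfolding \<beta>_def
  proof (intro sum.neutral ballI)
    fix a assume a: "a \<in> D"
    have "2 * r a < norm (x - a)" using x a by (auto simp: L_def dist_norm norm_minus_commute)
    then have "(2 * r a)\<^sup>2 \<le> (x - a) \<bullet> (x - a)"
      unfolding dot_square_norm using r(1)[of a] a D by (intro power_mono) auto
    then show "pos_part_sq (((2 * r a)\<^sup>2 - (x - a) \<bullet> (x - a)) / (3 * (r a)\<^sup>2)) = 0"
      by (intro pos_part_sq_simps divide_nonpos_nonneg) auto
  qed
  have "\<exists>\<phi>'. C1_with (\<lambda>x. 1 - pos_part_sq (1 - \<beta> x)) \<phi>'"
    by (rule exI, rule C1_with_diff, rule C1_with_const, rule C1_with_pos_part_sq, rule C1_with_diff,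
        rule C1_with_const, rule \<beta>')
  then obtain \<phi>' where "C1_with (\<lambda>x. 1 - pos_part_sq (1 - \<beta> x)) \<phi>'" by blast
  moreover have "compact L" unfolding L_def using D by (intro compact_UN) auto
  moreover have "L \<subseteq> W" unfolding L_def using r D by auto
  moreover have "0 \<le> 1 - pos_part_sq (1 - \<beta> x)" for x using pos_part_sq_le_1[of "1 - \<beta> x"] \<beta>0[of x] by linarith
  moreover have "1 - pos_part_sq (1 - \<beta> x) \<le> 1" for x by simp
  moreover have "1 - pos_part_sq (1 - \<beta> x) = 1" if "x \<in> K" for x using \<beta>1[OF that] by simp
  moreover have "1 - pos_part_sq (1 - \<beta> x) = 0" if "x \<notin> L" for x using \<beta>L[OF that] by simp
  ultimately show ?thesis
    by (intro exI[of _ "\<lambda>x. 1 - pos_part_sq (1 - \<beta> x)"] exI[of _ \<phi>'] exI[of _ L] conjI allI ballI impI)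
qed

text \<open>Inner regularity of the finite measure \<open>\<bar>g\<bar> dx\<close> provides compact sets \<open>K\<close>, \<open>K'\<close> that nearly exhaust
  \<open>{g > 0}\<close> and \<open>{g < 0}\<close> in \<open>U\<close>. The difference of cut-offs for the two is an admissible test function
  that equals the sign of \<open>g\<close> on \<open>K \<union> K'\<close>.\<close>

lemma integral_abs_le_if_tested:
  fixes g :: "'a::euclidean_space \<Rightarrow> real"
  assumes g: "integrable lborel g" and U: "open U"
    and test: "\<And>\<phi> \<phi>' L. C1_with \<phi> \<phi>' \<Longrightarrow> (\<And>x. \<bar>\<phi> x\<bar> \<le> 1) \<Longrightarrow> compact L \<Longrightarrow> L \<subseteq> U \<Longrightarrow>
                 (\<And>x. x \<notin> L \<Longrightarrow> \<phi> x = 0) \<Longrightarrow> (LINT x|lborel. g x * \<phi> x) \<le> V"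
  shows "(LINT x|lborel. indicator U x * \<bar>g x\<bar>) \<le> V"
proof (rule field_le_epsilon)
  fix \<epsilon> :: real assume \<epsilon>: "\<epsilon> > 0"
  have gm [measurable]: "g \<in> borel_measurable borel" using g by auto
  have Um [measurable]: "U \<in> sets borel" using U by simp
  define \<nu> where "\<nu> = density lborel (\<lambda>x. ennreal \<bar>g x\<bar>)"
  have \<nu>s: "sets \<nu> = sets borel" and \<nu>sp: "space \<nu> = UNIV" by (auto simp: \<nu>_def)
  have g': "integrable lborel (\<lambda>x. indicator A x * \<bar>g x\<bar>)" if "A \<in> sets borel" for A :: "'a set"
    using that g integrable_mult_indicator[of A lborel "\<lambda>x. \<bar>g x\<bar>"] by auto
  have \<nu>: "emeasure \<nu> A = ennreal (LINT x|lborel. indicator A x * \<bar>g x\<bar>)" if "A \<in> sets borel" for A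
  proof -
    have "emeasure \<nu> A = (\<integral>\<^sup>+x. ennreal \<bar>g x\<bar> * indicator A x \<partial>lborel)"
      unfolding \<nu>_def using that by (subst emeasure_density) auto
    also have "\<dots> = (\<integral>\<^sup>+x. ennreal (indicator A x * \<bar>g x\<bar>) \<partial>lborel)"
      by (intro nn_integral_cong) (auto simp: indicator_def)
    also have "\<dots> = ennreal (LINT x|lborel. indicator A x * \<bar>g x\<bar>)"
      using g'[OF that] by (intro nn_integral_eq_integral) auto
    finally show ?thesis .
  qed
  have inner: "\<exists>K. compact K \<and> K \<subseteq> A \<and>
      (LINT x|lborel. indicator A x * \<bar>g x\<bar>) \<le> (LINT x|lborel. indicator K x * \<bar>g x\<bar>) + \<epsilon> / 4"
    if A: "A \<in> sets borel" for A
  proof (cases "emeasure \<nu> A = 0")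
    case True
    then show ?thesis using A \<epsilon> \<nu>[OF A] by (intro exI[of _ "{}"]) (auto simp: ennreal_eq_0_iff)
  next
    case False
    have reg: "emeasure \<nu> A = (SUP K\<in>{K. K \<subseteq> A \<and> compact K}. emeasure \<nu> K)"
      by (rule inner_regular) (auto simp: \<nu>s A \<nu>sp \<nu>)
    have "emeasure \<nu> A - ennreal (\<epsilon> / 4) < emeasure \<nu> A"
      using False \<epsilon> \<nu>[OF A] by (intro ennreal_between) (auto simp: zero_less_iff_neq_zero)
    then have "emeasure \<nu> A - ennreal (\<epsilon> / 4) < (SUP K\<in>{K. K \<subseteq> A \<and> compact K}. emeasure \<nu> K)"
      using reg by metis
    then obtain K where K: "K \<subseteq> A" "compact K" "emeasure \<nu> A - ennreal (\<epsilon> / 4) < emeasure \<nu> K"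
      unfolding less_SUP_iff by auto
    have Kb: "K \<in> sets borel" using K by (auto intro: borel_compact)
    have pos: "0 \<le> (LINT x|lborel. indicator K x * \<bar>g x\<bar>)" by (intro integral_nonneg_AE) auto
    have "ennreal ((LINT x|lborel. indicator A x * \<bar>g x\<bar>) - \<epsilon> / 4) \<le> ennreal (LINT x|lborel. indicator K x * \<bar>g x\<bar>)"
      using less_imp_le[OF K(3)] \<epsilon> unfolding \<nu>[OF A] \<nu>[OF Kb] by (subst ennreal_minus[symmetric]) auto
    then have "(LINT x|lborel. indicator A x * \<bar>g x\<bar>) - \<epsilon> / 4 \<le> (LINT x|lborel. indicator K x * \<bar>g x\<bar>)"
      using pos by (subst (asm) ennreal_le_iff) auto
    then show ?thesis using K by (intro exI[of _ K]) auto
  qed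
  define P where "P = U \<inter> {x. g x > 0}"
  define N where "N = U \<inter> {x. g x < 0}"
  have [measurable]: "P \<in> sets borel" "N \<in> sets borel" unfolding P_def N_def by measurable
  obtain K where K: "compact K" "K \<subseteq> P"
    "(LINT x|lborel. indicator P x * \<bar>g x\<bar>) \<le> (LINT x|lborel. indicator K x * \<bar>g x\<bar>) + \<epsilon> / 4"
    using inner[of P] by auto
  obtain K' where K': "compact K'" "K' \<subseteq> N"
    "(LINT x|lborel. indicator N x * \<bar>g x\<bar>) \<le> (LINT x|lborel. indicator K' x * \<bar>g x\<bar>) + \<epsilon> / 4"
    using inner[of N] by auto
  have [measurable]: "K \<in> sets borel" "K' \<in> sets borel" using K K' by (auto intro: borel_compact)
  have disj: "x \<notin> K'" if "x \<in> K" for x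
    using that K K' unfolding P_def N_def by fastforce
  have W: "open (U - K')" "K \<subseteq> U - K'" "open (U - K)" "K' \<subseteq> U - K"
    using U K K' disj by (auto simp: P_def N_def intro: open_Diff compact_imp_closed)
  obtain \<phi> \<phi>' L where
    \<phi>: "C1_with \<phi> \<phi>'" "\<And>x. 0 \<le> \<phi> x" "\<And>x. \<phi> x \<le> 1" "\<And>x. x \<in> K \<Longrightarrow> \<phi> x = 1"
    "compact L" "L \<subseteq> U - K'" "\<And>x. x \<notin> L \<Longrightarrow> \<phi> x = 0"
    using C1_Urysohn[OF K(1) W(1,2)] by blast
  obtain \<psi> \<psi>' L' where
    \<psi>: "C1_with \<psi> \<psi>'" "\<And>x. 0 \<le> \<psi> x" "\<And>x. \<psi> x \<le> 1" "\<And>x. x \<in> K' \<Longrightarrow> \<psi> x = 1"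
    "compact L'" "L' \<subseteq> U - K" "\<And>x. x \<notin> L' \<Longrightarrow> \<psi> x = 0"
    using C1_Urysohn[OF K'(1) W(3,4)] by blast
  have le1: "\<bar>\<phi> x - \<psi> x\<bar> \<le> 1" for x using \<phi>(2,3)[of x] \<psi>(2,3)[of x] by linarith
  have [measurable]: "\<phi> \<in> borel_measurable borel" "\<psi> \<in> borel_measurable borel"
    by (rule borel_measurable_continuous_onI C1_with_imp_continuous \<phi>(1) \<psi>(1))+
  have int: "integrable lborel (\<lambda>x. g x * (\<phi> x - \<psi> x))"
    by (rule Bochner_Integration.integrable_bound[OF g])
       (use le1 in \<open>auto simp: abs_mult mult_left_le\<close>)
  \<comment> \<open>On \<open>{g > 0} - K\<close> and \<open>{g < 0} - K'\<close> the test function is only known to be bounded by \<open>1\<close>, which loses twice \<open>\<bar>g\<bar>\<close> there.\<close>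
  let ?R = "\<lambda>x. indicator U x * \<bar>g x\<bar> - 2 * (indicator P x * \<bar>g x\<bar> - indicator K x * \<bar>g x\<bar>)
                  - 2 * (indicator N x * \<bar>g x\<bar> - indicator K' x * \<bar>g x\<bar>)"
  have "(LINT x|lborel. indicator U x * \<bar>g x\<bar>) - \<epsilon> \<le> (LINT x|lborel. ?R x)"
    using K(3) K'(3) by (simp add: g' Bochner_Integration.integral_diff Bochner_Integration.integrable_diff)
  also have "\<dots> \<le> (LINT x|lborel. g x * (\<phi> x - \<psi> x))"
  proof (rule integral_mono)
    show "integrable lborel ?R"
      by (intro Bochner_Integration.integrable_diff integrable_mult_right g') auto
    fix x
    have b: "\<bar>g x * (\<phi> x - \<psi> x)\<bar> \<le> \<bar>g x\<bar>" using le1[of x] by (simp add: abs_mult mult_left_le)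
    consider "x \<in> K" | "x \<in> K'" | "x \<notin> K" "x \<notin> K'" "x \<in> P" | "x \<notin> K" "x \<notin> K'" "x \<in> N"
      | "x \<notin> K" "x \<notin> K'" "x \<notin> P" "x \<notin> N" by blast
    then show "?R x \<le> g x * (\<phi> x - \<psi> x)"
    proof cases
      case 1
      then have "x \<in> P" "x \<notin> K'" "x \<notin> L'" using K(2) \<psi>(6) disj by auto
      moreover from this have "x \<notin> N" "x \<in> U" "g x > 0" by (auto simp: P_def N_def)
      ultimately show ?thesis using \<phi>(4)[of x] \<psi>(7)[of x] 1 by simp
    next
      case 2
      then have "x \<in> N" "x \<notin> K" "x \<notin> L" using K'(2) \<phi>(6) disj by auto
      moreover from this have "x \<notin> P" "x \<in> U" "g x < 0" by (auto simp: P_def N_def)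
      ultimately show ?thesis using \<psi>(4)[of x] \<phi>(7)[of x] 2 by simp
    next
      case 3
      then have "x \<notin> N" "x \<in> U" by (auto simp: P_def N_def)
      then show ?thesis using 3 b by simp
    next
      case 4
      then have "x \<notin> P" "x \<in> U" by (auto simp: P_def N_def)
      then show ?thesis using 4 b by simp
    next
      case 5
      have "x \<notin> U \<or> g x = 0" using 5 by (auto simp: P_def N_def)
      moreover have "\<phi> x = 0" "\<psi> x = 0" if "x \<notin> U" using that \<phi>(6,7) \<psi>(6,7) by auto
      ultimately show ?thesis using 5 by auto
    qed
  qed (rule int)
  also have "\<dots> \<le> V"
  proof (rule test)
    show "C1_with (\<lambda>x. \<phi> x - \<psi> x) (\<lambda>x v. \<phi>' x v - \<psi>' x v)" by (rule C1_with_diff \<phi>(1) \<psi>(1))+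
    show "compact (L \<union> L')" using \<phi>(5) \<psi>(5) by (rule compact_Un)
    show "L \<union> L' \<subseteq> U" using \<phi>(6) \<psi>(6) by blast
  qed (use le1 \<phi>(7) \<psi>(7) in simp_all)
  finally show "(LINT x|lborel. indicator U x * \<bar>g x\<bar>) \<le> V + \<epsilon>" by simp
qed

section \<open>The translation estimate\<close>

text \<open>For Borel functions on the whole space that vanish outside \<open>\<Omega>\<close>, this says that the BV seminorm on \<open>\<Omega>\<close> is at most \<open>V\<close>.\<close>

definition variation_le :: "'a::euclidean_space set \<Rightarrow> ('a \<Rightarrow> real) \<Rightarrow> real \<Rightarrow> bool" where
  "variation_le \<Omega> f V \<longleftrightarrow> (\<forall>\<sigma>\<in>BV_test_fields \<Omega>. (LINT x|lborel. - f x * divergence \<sigma> x) \<le> V)"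

lemma C1_with_shift:
  assumes "C1_with \<phi> \<phi>'" shows "C1_with (\<lambda>y. \<phi> (y - a)) (\<lambda>y v. \<phi>' (y - a) v)"
  unfolding C1_with_def
proof safe
  fix x v
  have "((\<lambda>y. y - a) has_derivative (\<lambda>v. v - 0)) (at x)" by (intro derivative_intros)
  moreover have "(\<phi> has_derivative \<phi>' (x - a)) (at (x - a))" using assms by (simp add: C1_with_def)
  ultimately have "((\<phi> \<circ> (\<lambda>y. y - a)) has_derivative (\<phi>' (x - a) \<circ> (\<lambda>v. v - 0))) (at x)"
    by (rule diff_chain_at)
  then show "((\<lambda>y. \<phi> (y - a)) has_derivative \<phi>' (x - a)) (at x)" by (simp add: o_def)
  have "continuous_on UNIV (\<lambda>x. \<phi>' x v)" using assms by (simp add: C1_with_def)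
  then show "continuous_on UNIV (\<lambda>y. \<phi>' (y - a) v)"
    by (rule continuous_on_compose2) (auto intro: continuous_intros)
qed

lemma C1_with_deriv_eq_0:
  assumes "C1_with \<phi> \<phi>'" "closed L" "\<And>x. x \<notin> L \<Longrightarrow> \<phi> x = 0" "x \<notin> L"
  shows "\<phi>' x v = 0"
proof -
  have 1: "((\<lambda>x. 0) has_derivative \<phi>' x) (at x)"
    by (rule has_derivative_transform_within_open[where f=\<phi> and s="- L"])
       (use assms in \<open>auto simp: C1_with_def\<close>)
  have "((\<lambda>x. 0::real) has_derivative (\<lambda>v. 0)) (at x)" by simp
  from has_derivative_unique[OF 1 this] show ?thesis by simp
qed

text \<open>Fields with a constant direction suffice as test fields: their divergence is a directional derivative.\<close>

lemma directional_test_field: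
  fixes \<Omega> :: "'a::euclidean_space set"
  assumes \<phi>: "C1_with \<phi> \<phi>'" and le: "\<And>x. \<bar>\<phi> x\<bar> \<le> 1" and L: "compact L" "L \<subseteq> \<Omega>" "\<And>x. x \<notin> L \<Longrightarrow> \<phi> x = 0"
    and e: "norm e = 1"
  shows "(\<lambda>x. \<phi> x *\<^sub>R e) \<in> BV_test_fields \<Omega>" "divergence (\<lambda>x. \<phi> x *\<^sub>R e) x = \<phi>' x e"
proof -
  have D: "((\<lambda>x. \<phi> x *\<^sub>R e) has_derivative (\<lambda>v. \<phi>' x v *\<^sub>R e)) (at x)" for x
    using \<phi> unfolding C1_with_def by (intro has_derivative_scaleR_left) auto
  have fd: "frechet_derivative (\<lambda>x. \<phi> x *\<^sub>R e) (at x) = (\<lambda>v. \<phi>' x v *\<^sub>R e)" for x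
    using frechet_derivative_at[OF D] by simp
  have "closure {x. \<phi> x *\<^sub>R e \<noteq> 0} \<subseteq> L"
    by (rule closure_minimal) (use L compact_imp_closed in auto)
  moreover from this have "compact (closure {x. \<phi> x *\<^sub>R e \<noteq> 0})"
    using L(1) by (metis closed_closure closed_Int_compact inf.absorb_iff1)
  moreover have "continuous_on S (\<lambda>x. \<phi>' x v *\<^sub>R e)" for S v
  proof -
    have "continuous_on S (\<lambda>x. \<phi>' x v)"
      using \<phi> continuous_on_subset unfolding C1_with_def by blast
    then show ?thesis by (intro continuous_intros)
  qed
  moreover have "(\<lambda>x. \<phi> x *\<^sub>R e) differentiable (at x)" for x
    using D differentiable_def by blast
  ultimately show "(\<lambda>x. \<phi> x *\<^sub>R e) \<in> BV_test_fields \<Omega>"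
    using L le e unfolding BV_test_fields_def mem_Collect_eq fd by (intro conjI ballI) auto
  have lin: "linear (\<phi>' x)" using \<phi> unfolding C1_with_def using has_derivative_linear by blast
  have "divergence (\<lambda>x. \<phi> x *\<^sub>R e) x = (\<Sum>b\<in>Basis. (e \<bullet> b) * \<phi>' x b)"
    unfolding divergence_def fd by (simp add: mult.commute)
  also have "\<dots> = \<phi>' x (\<Sum>b\<in>Basis. (e \<bullet> b) *\<^sub>R b)"
    using lin by (simp add: linear_sum linear_cmul)
  finally show "divergence (\<lambda>x. \<phi> x *\<^sub>R e) x = \<phi>' x e" by (simp add: euclidean_representation)
qed

lemma lborel_integral_shift:
  fixes f :: "'a::euclidean_space \<Rightarrow> real"
  assumes "f \<in> borel_measurable borel"
  shows "(LINT x|lborel. f (x + h)) = (LINT x|lborel. f x)"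
proof -
  have "(LINT x|lborel. f x) = (LINT x|distr lborel borel ((+) h). f x)"
    by (simp add: lborel_distr_plus)
  also have "\<dots> = (LINT x|lborel. f (h + x))" by (intro integral_distr) (use assms in auto)
  finally show ?thesis by (simp add: add.commute)
qed

lemma lborel_integrable_shift:
  fixes f :: "'a::euclidean_space \<Rightarrow> real"
  assumes "integrable lborel f"
  shows "integrable lborel (\<lambda>x. f (x + h))"
proof -
  have "integrable (distr lborel borel ((+) h)) f"
    using assms by (simp add: lborel_distr_plus)
  then have "integrable lborel (\<lambda>x. f (h + x))" by (subst (asm) integrable_distr_eq) (use assms in auto)
  then show ?thesis by (simp add: add.commute)
qed

lemma nn_integral_lborel_shift:
  fixes f :: "'a::euclidean_space \<Rightarrow> ennreal"
  assumes "f \<in> borel_measurable borel"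
  shows "(\<integral>\<^sup>+x. f (x + h) \<partial>lborel) = (\<integral>\<^sup>+x. f x \<partial>lborel)"
proof -
  have "(\<integral>\<^sup>+x. f x \<partial>lborel) = (\<integral>\<^sup>+x. f x \<partial>distr lborel borel ((+) h))"
    by (simp add: lborel_distr_plus)
  also have "\<dots> = (\<integral>\<^sup>+x. f (h + x) \<partial>lborel)" by (intro nn_integral_distr) (use assms in auto)
  finally show ?thesis by (simp add: add.commute)
qed

lemma DERIV_integral_translate:
  fixes f :: "'a::euclidean_space \<Rightarrow> real"
  assumes f: "integrable lborel f" and \<phi>: "C1_with \<phi> \<phi>'"
    and L: "compact L" "\<And>x. x \<notin> L \<Longrightarrow> \<phi> x = 0"
  shows "((\<lambda>t. LINT y|lborel. f y * \<phi> (y - t *\<^sub>R h)) has_real_derivative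
           (LINT y|lborel. - f y * \<phi>' (y - t *\<^sub>R h) h)) (at t)"
proof -
  have \<phi>c: "continuous_on UNIV \<phi>" by (rule C1_with_imp_continuous[OF \<phi>])
  have \<phi>'c: "continuous_on UNIV (\<lambda>x. \<phi>' x h)" using \<phi> by (simp add: C1_with_def)
  have [measurable]: "\<phi> \<in> borel_measurable borel" "(\<lambda>x. \<phi>' x h) \<in> borel_measurable borel"
    using \<phi>c \<phi>'c by (auto intro: borel_measurable_continuous_onI)
  have [measurable]: "f \<in> borel_measurable borel" using f by auto
  have \<phi>'0: "\<phi>' x h = 0" if "x \<notin> L" for x
    by (rule C1_with_deriv_eq_0[OF \<phi> _ L(2) that]) (use L(1) compact_imp_closed in auto)
  have "compact ((\<lambda>x. \<phi>' x h) ` L)" "compact (\<phi> ` L)"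
    using L(1) \<phi>'c \<phi>c by (auto intro!: compact_continuous_image intro: continuous_on_subset)
  then obtain P Q where P: "\<And>x. x \<in> L \<Longrightarrow> \<bar>\<phi>' x h\<bar> \<le> P" and Q: "\<And>x. x \<in> L \<Longrightarrow> \<bar>\<phi> x\<bar> \<le> Q"
    using compact_imp_bounded bounded_iff by (metis imageI real_norm_def)
  have P': "\<bar>\<phi>' x h\<bar> \<le> \<bar>P\<bar>" for x using P[of x] \<phi>'0[of x] by (cases "x \<in> L") auto
  have Q': "\<bar>\<phi> x\<bar> \<le> \<bar>Q\<bar>" for x using Q[of x] L(2)[of x] by (cases "x \<in> L") auto
  have D: "((\<lambda>s. \<phi> (y - s *\<^sub>R h)) has_real_derivative - \<phi>' (y - s *\<^sub>R h) h) (at s)" for y s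
  proof -
    have lin: "linear (\<phi>' (y - s *\<^sub>R h))" using \<phi> unfolding C1_with_def using has_derivative_linear by blast
    have "((\<phi> \<circ> (\<lambda>s. y - s *\<^sub>R h)) has_derivative (\<phi>' (y - s *\<^sub>R h) \<circ> (\<lambda>v. 0 - v *\<^sub>R h))) (at s)"
    proof (rule diff_chain_at)
      show "((\<lambda>s. y - s *\<^sub>R h) has_derivative (\<lambda>v. 0 - v *\<^sub>R h)) (at s)"
        by (intro derivative_intros)
    qed (use \<phi> in \<open>auto simp: C1_with_def\<close>)
    moreover have "\<phi>' (y - s *\<^sub>R h) \<circ> (\<lambda>v. 0 - v *\<^sub>R h) = (*) (- \<phi>' (y - s *\<^sub>R h) h)"
      using linear_cmul[OF lin] linear_neg[OF lin] by (auto simp: o_def)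
    ultimately show ?thesis by (simp add: has_field_derivative_def o_def)
  qed
  have Lip: "\<bar>\<phi> (y - s *\<^sub>R h) - \<phi> (y - t *\<^sub>R h)\<bar> \<le> \<bar>P\<bar> * \<bar>s - t\<bar>" for y s t
    using field_differentiable_bound[of UNIV "\<lambda>s. \<phi> (y - s *\<^sub>R h)" "\<lambda>s. - \<phi>' (y - s *\<^sub>R h) h" "\<bar>P\<bar>" s t] D P'
    by (simp add: has_field_derivative_at_within)
  have int: "integrable lborel (\<lambda>y. f y * \<phi> (y - s *\<^sub>R h))" for s
  proof (rule Bochner_Integration.integrable_bound[of _ "\<lambda>y. \<bar>Q\<bar> * f y"])
    show "AE y in lborel. norm (f y * \<phi> (y - s *\<^sub>R h)) \<le> norm (\<bar>Q\<bar> * f y)"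
      using mult_left_mono[OF Q'] by (intro AE_I2) (simp add: abs_mult mult.commute[of "\<bar>Q\<bar>"])
  qed (use f in auto)
  let ?G = "\<lambda>t. LINT y|lborel. f y * \<phi> (y - t *\<^sub>R h)"
  have "((\<lambda>s. (?G s - ?G t) / (s - t)) \<longlongrightarrow> (LINT y|lborel. - f y * \<phi>' (y - t *\<^sub>R h) h)) (at t)"
    unfolding tendsto_at_iff_sequentially o_def
  proof safe
    fix X :: "nat \<Rightarrow> real" assume X: "\<forall>i. X i \<in> UNIV - {t}" "X \<longlonglongrightarrow> t"
    have eq: "(?G (X i) - ?G t) / (X i - t) =
        (LINT y|lborel. f y * ((\<phi> (y - X i *\<^sub>R h) - \<phi> (y - t *\<^sub>R h)) / (X i - t)))" for i
    proof -
      have "?G (X i) - ?G t = (LINT y|lborel. f y * \<phi> (y - X i *\<^sub>R h) - f y * \<phi> (y - t *\<^sub>R h))"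
        using int by simp
      also have "\<dots> / (X i - t) = (LINT y|lborel. (f y * \<phi> (y - X i *\<^sub>R h) - f y * \<phi> (y - t *\<^sub>R h)) / (X i - t))"
        by simp
      finally show ?thesis by (simp add: algebra_simps)
    qed
    show "(\<lambda>i. (?G (X i) - ?G t) / (X i - t)) \<longlonglongrightarrow> (LINT y|lborel. - f y * \<phi>' (y - t *\<^sub>R h) h)"
      unfolding eq
    proof (rule integral_dominated_convergence[where w="\<lambda>y. \<bar>P\<bar> * \<bar>f y\<bar>"])
      show "integrable lborel (\<lambda>y. \<bar>P\<bar> * \<bar>f y\<bar>)" using f by auto
      show "AE y in lborel. (\<lambda>i. f y * ((\<phi> (y - X i *\<^sub>R h) - \<phi> (y - t *\<^sub>R h)) / (X i - t)))
              \<longlonglongrightarrow> - f y * \<phi>' (y - t *\<^sub>R h) h"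
      proof (intro AE_I2)
        fix y
        have "((\<lambda>s. (\<phi> (y - s *\<^sub>R h) - \<phi> (y - t *\<^sub>R h)) / (s - t)) \<longlongrightarrow> - \<phi>' (y - t *\<^sub>R h) h) (at t)"
          using D[of y t] by (simp add: has_field_derivative_iff)
        then have "(\<lambda>i. (\<phi> (y - X i *\<^sub>R h) - \<phi> (y - t *\<^sub>R h)) / (X i - t)) \<longlonglongrightarrow> - \<phi>' (y - t *\<^sub>R h) h"
          unfolding tendsto_at_iff_sequentially o_def using X by blast
        then have "(\<lambda>i. f y * ((\<phi> (y - X i *\<^sub>R h) - \<phi> (y - t *\<^sub>R h)) / (X i - t)))
              \<longlonglongrightarrow> f y * (- \<phi>' (y - t *\<^sub>R h) h)" by (rule tendsto_mult_left)
        then show "(\<lambda>i. f y * ((\<phi> (y - X i *\<^sub>R h) - \<phi> (y - t *\<^sub>R h)) / (X i - t)))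
              \<longlonglongrightarrow> - f y * \<phi>' (y - t *\<^sub>R h) h" by simp
      qed
      fix i
      show "AE y in lborel. norm (f y * ((\<phi> (y - X i *\<^sub>R h) - \<phi> (y - t *\<^sub>R h)) / (X i - t))) \<le> \<bar>P\<bar> * \<bar>f y\<bar>"
      proof (intro AE_I2)
        fix y
        have "\<bar>X i - t\<bar> > 0" using X by auto
        then have "\<bar>(\<phi> (y - X i *\<^sub>R h) - \<phi> (y - t *\<^sub>R h)) / (X i - t)\<bar> \<le> \<bar>P\<bar>"
          using Lip[of y "X i" t] by (simp add: divide_simps abs_divide)
        then have "\<bar>f y\<bar> * \<bar>(\<phi> (y - X i *\<^sub>R h) - \<phi> (y - t *\<^sub>R h)) / (X i - t)\<bar> \<le> \<bar>f y\<bar> * \<bar>P\<bar>"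
          by (intro mult_left_mono) auto
        then show "norm (f y * ((\<phi> (y - X i *\<^sub>R h) - \<phi> (y - t *\<^sub>R h)) / (X i - t))) \<le> \<bar>P\<bar> * \<bar>f y\<bar>"
          by (simp add: abs_mult mult.commute)
      qed
    qed measurable
  qed
  then show ?thesis by (simp add: has_field_derivative_iff)
qed

text \<open>Tested against \<open>\<phi>\<close>, the difference \<open>f (x + h) - f x\<close> becomes \<open>G 1 - G 0\<close> for \<open>G t = \<integral> f y \<phi> (y - t h) dy\<close>.
  By the choice of \<open>U\<close> all translates of \<open>\<phi>\<close> are supported in \<open>\<Omega>\<close>, so \<open>G'\<close> is an integral of \<open>f\<close> against the
  divergence of a test field, scaled by \<open>\<bar>h\<bar>\<close>, and the mean value theorem applies.\<close>

lemma translation_estimate: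
  fixes f :: "'a::euclidean_space \<Rightarrow> real"
  assumes f: "integrable lborel f" and V: "variation_le \<Omega> f V" and U: "open U"
    and sub: "\<And>x t. x \<in> U \<Longrightarrow> 0 \<le> t \<Longrightarrow> t \<le> 1 \<Longrightarrow> x + t *\<^sub>R h \<in> \<Omega>"
  shows "(LINT x|lborel. indicator U x * \<bar>f (x + h) - f x\<bar>) \<le> norm h * V"
proof (cases "h = 0")
  case False
  define e where "e = h /\<^sub>R norm h"
  have e: "norm e = 1" using False by (simp add: e_def)
  have [measurable]: "f \<in> borel_measurable borel" using f by auto
  show ?thesis
  proof (rule integral_abs_le_if_tested)
    show "integrable lborel (\<lambda>x. f (x + h) - f x)" using lborel_integrable_shift[OF f] f by auto
    show "open U" by fact
    fix \<phi> \<phi>' L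
    assume \<phi>: "C1_with \<phi> \<phi>'" "\<And>x. \<bar>\<phi> x\<bar> \<le> 1" and L: "compact L" "L \<subseteq> U" "\<And>x. x \<notin> L \<Longrightarrow> \<phi> x = 0"
    have [measurable]: "\<phi> \<in> borel_measurable borel"
      by (rule borel_measurable_continuous_onI C1_with_imp_continuous \<phi>(1))+
    let ?G = "\<lambda>t. LINT y|lborel. f y * \<phi> (y - t *\<^sub>R h)"
    let ?G' = "\<lambda>t. LINT y|lborel. - f y * \<phi>' (y - t *\<^sub>R h) h"
    have G': "?G' t \<le> norm h * V" if t: "0 \<le> t" "t \<le> 1" for t
    proof -
      note \<phi>t = C1_with_shift[OF \<phi>(1), of "t *\<^sub>R h"]
      let ?L = "(\<lambda>x. x + t *\<^sub>R h) ` L"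
      have cL: "compact ?L" using L(1) by (intro compact_continuous_image continuous_intros)
      have sL: "?L \<subseteq> \<Omega>" using sub t L(2) by auto
      have zL: "\<phi> (x - t *\<^sub>R h) = 0" if "x \<notin> ?L" for x
      proof (rule L(3))
        show "x - t *\<^sub>R h \<notin> L" using that by (metis (no_types, lifting) diff_add_cancel image_eqI)
      qed
      note tf = directional_test_field[OF \<phi>t \<phi>(2) cL sL zL e]
      have lin: "linear (\<phi>' x)" for x using \<phi>(1) unfolding C1_with_def using has_derivative_linear by blast
      have "?G' t = (LINT y|lborel. norm h * (- f y * divergence (\<lambda>x. \<phi> (x - t *\<^sub>R h) *\<^sub>R e) y))"
      proof (intro Bochner_Integration.integral_cong refl)
        fix y
        have "\<phi>' (y - t *\<^sub>R h) (norm h *\<^sub>R e) = norm h * \<phi>' (y - t *\<^sub>R h) e"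
          using linear_cmul[OF lin] by simp
        moreover have "norm h *\<^sub>R e = h" using False by (simp add: e_def)
        ultimately show "- f y * \<phi>' (y - t *\<^sub>R h) h =
            norm h * (- f y * divergence (\<lambda>x. \<phi> (x - t *\<^sub>R h) *\<^sub>R e) y)" by (simp add: tf(2))
      qed
      also have "\<dots> = norm h * (LINT y|lborel. (- f y * divergence (\<lambda>x. \<phi> (x - t *\<^sub>R h) *\<^sub>R e) y))"
        by simp
      also have "\<dots> \<le> norm h * V" using V tf(1) unfolding variation_le_def by (intro mult_left_mono) auto
      finally show ?thesis .
    qed
    obtain z where z: "0 < z" "z < 1" "?G 1 - ?G 0 = (1 - 0) * ?G' z"
      using MVT2[of 0 1 ?G ?G'] DERIV_integral_translate[OF f \<phi>(1) L(1,3), of h] by auto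
    have b: "integrable lborel (\<lambda>x. k x * \<phi> (x - a))" if "integrable lborel k" for k a
      by (rule Bochner_Integration.integrable_bound[OF that])
         (use that \<phi>(2) in \<open>auto intro!: AE_I2 simp: abs_mult mult_left_le\<close>)
    have "(LINT x|lborel. (f (x + h) - f x) * \<phi> x) = (LINT x|lborel. f (x + h) * \<phi> x - f x * \<phi> x)"
      by (simp add: algebra_simps)
    also have "\<dots> = (LINT x|lborel. f (x + h) * \<phi> x) - (LINT x|lborel. f x * \<phi> x)"
      using b[OF f, of 0] b[OF lborel_integrable_shift[OF f, of h], of 0] by simp
    also have "(LINT x|lborel. f (x + h) * \<phi> x) = ?G 1"
      using lborel_integral_shift[of "\<lambda>y. f y * \<phi> (y - h)" h] by simp
    also have "(LINT x|lborel. f x * \<phi> x) = ?G 0" by simp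
    also have "?G 1 - ?G 0 \<le> norm h * V" using z G'[of z] by simp
    finally show "(LINT x|lborel. (f (x + h) - f x) * \<phi> x) \<le> norm h * V" .
  qed
qed simp

section \<open>Cones of admissible directions in Lipschitz domains\<close>

text \<open>The vectors \<open>s *\<^sub>R b\<close> with \<open>b \<in> cball e c\<close> and \<open>0 \<le> s \<le> \<rho>\<close> form a truncated cone with axis \<open>e\<close>. As \<open>norm b \<le> 2\<close>,
  the requirement \<open>4 * \<rho> \<le> R\<close> keeps such steps within \<open>ball z R\<close> when they start in \<open>ball z (R / 2)\<close>.\<close>

definition cone_at :: "'a::euclidean_space set \<Rightarrow> 'a \<Rightarrow> real \<Rightarrow> 'a \<Rightarrow> real \<Rightarrow> real \<Rightarrow> bool" where
  "cone_at \<Omega> z R e c \<rho> \<longleftrightarrow> norm e = 1 \<and> 0 < c \<and> c \<le> 1 \<and> 0 < \<rho> \<and> 4 * \<rho> \<le> R \<and>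
     (\<forall>x\<in>\<Omega> \<inter> ball z R. \<forall>s b. 0 \<le> s \<longrightarrow> s \<le> \<rho> \<longrightarrow> b \<in> cball e c \<longrightarrow> x + s *\<^sub>R b \<in> \<Omega>)"

lemma norm_le_2_if_cball_unit:
  assumes "b \<in> cball e c" "norm e = 1" "c \<le> (1::real)" shows "norm b \<le> 2"
  using assms norm_triangle_ineq2[of b e] by (auto simp: dist_norm norm_minus_commute)

text \<open>At a boundary point with graph function \<open>\<gamma>\<close> of Lipschitz constant \<open>L\<close>, a step \<open>s *\<^sub>R b\<close> gains at least \<open>s (1 - c)\<close>
  in height while \<open>\<gamma>\<close> grows by at most \<open>L s c\<close>. The opening \<open>c = 1 / (L + 1)\<close> makes these equal, so the step
  stays above the graph.\<close>

lemma exists_cone_at: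
  fixes \<Omega> :: "'a::euclidean_space set"
  assumes \<Omega>: "open \<Omega>" "lipschitz_boundary \<Omega>" and z: "z \<in> closure \<Omega>"
  shows "\<exists>R e c \<rho>. cone_at \<Omega> z R e c \<rho>"
proof (cases "z \<in> \<Omega>")
  case True
  then obtain r where r: "r > 0" "ball z r \<subseteq> \<Omega>" using \<Omega>(1) open_contains_ball by blast
  obtain e :: 'a where e: "norm e = 1" using vector_choose_size[of 1] by auto
  have "cone_at \<Omega> z (r/2) e 1 (r/8)"
    unfolding cone_at_def
  proof (intro conjI ballI allI impI)
    fix x s b assume x: "x \<in> \<Omega> \<inter> ball z (r/2)" and s: "0 \<le> s" "s \<le> r/8" and b: "b \<in> cball e 1"
    have "s * norm b \<le> (r/8) * 2" by (intro mult_mono) (use s r norm_le_2_if_cball_unit[OF b e] in auto)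
    moreover have "dist z (x + s *\<^sub>R b) \<le> dist z x + s * norm b"
      using dist_triangle[of z "x + s *\<^sub>R b" x] s by (simp add: dist_norm)
    ultimately have "x + s *\<^sub>R b \<in> ball z r" using x r(1) by simp
    then show "x + s *\<^sub>R b \<in> \<Omega>" using r(2) by auto
  qed (use e r in auto)
  then show ?thesis by blast
next
  case False
  then have "z \<in> frontier \<Omega>" using z \<Omega>(1) by (simp add: frontier_def interior_open)
  then obtain r e L and \<gamma> :: "'a \<Rightarrow> real" where r: "r > 0" and e: "norm e = 1"
    and L: "L-lipschitz_on {y. y \<bullet> e = 0} \<gamma>"
    and eq: "\<Omega> \<inter> ball z r = {x \<in> ball z r. \<gamma> (x - (x \<bullet> e) *\<^sub>R e) < x \<bullet> e}"
    using \<Omega>(2) unfolding lipschitz_boundary_def by blast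
  have mem: "x \<in> \<Omega> \<longleftrightarrow> \<gamma> (x - (x \<bullet> e) *\<^sub>R e) < x \<bullet> e" if "x \<in> ball z r" for x
    using eq that by blast
  have L0: "L \<ge> 0" using L by (rule lipschitz_on_nonneg)
  define c where "c = 1 / (L + 1)"
  have c: "0 < c" "c \<le> 1" "c * (L + 1) = 1" using L0 by (auto simp: c_def)
  have ee: "e \<bullet> e = 1" using e by (simp add: dot_square_norm)
  have "cone_at \<Omega> z (r/2) e c (r/8)"
    unfolding cone_at_def
  proof (intro conjI ballI allI impI)
    fix x s b assume x: "x \<in> \<Omega> \<inter> ball z (r/2)" and s: "0 \<le> s" "s \<le> r/8" and b: "b \<in> cball e c"
    have "s * norm b \<le> (r/8) * 2" by (intro mult_mono) (use s r norm_le_2_if_cball_unit[OF b e c(2)] in auto)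
    moreover have "dist z (x + s *\<^sub>R b) \<le> dist z x + s * norm b"
      using dist_triangle[of z "x + s *\<^sub>R b" x] s by (simp add: dist_norm)
    ultimately have bl: "x + s *\<^sub>R b \<in> ball z r" using x r(1) by simp
    define \<pi> where "\<pi> y = y - (y \<bullet> e) *\<^sub>R e" for y
    have \<pi>0: "\<pi> y \<bullet> e = 0" for y by (simp add: \<pi>_def inner_diff_left ee)
    have be: "norm (b - e) \<le> c" using b by (simp add: dist_norm norm_minus_commute)
    have "norm (\<pi> b) \<le> norm (b - e)"
    proof -
      define v where "v = b - e"
      have "\<pi> b = v - (v \<bullet> e) *\<^sub>R e" by (simp add: \<pi>_def v_def inner_diff_left ee scaleR_diff_left)
      moreover have "(v - (v \<bullet> e) *\<^sub>R e) \<bullet> (v - (v \<bullet> e) *\<^sub>R e) = v \<bullet> v - (v \<bullet> e)\<^sup>2"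
        by (simp add: inner_diff_left inner_diff_right ee power2_eq_square inner_commute[of e v])
      ultimately have "\<pi> b \<bullet> \<pi> b \<le> v \<bullet> v" by simp
      then show ?thesis by (simp add: norm_le v_def)
    qed
    then have "norm (\<pi> b) \<le> c" using be by linarith
    moreover have "\<pi> (x + s *\<^sub>R b) - \<pi> x = s *\<^sub>R \<pi> b" by (simp add: \<pi>_def inner_add_left scaleR_add_left scaleR_diff_right)
    moreover have "\<bar>\<gamma> (\<pi> (x + s *\<^sub>R b)) - \<gamma> (\<pi> x)\<bar> \<le> L * norm (\<pi> (x + s *\<^sub>R b) - \<pi> x)"
      using lipschitz_onD[OF L, of "\<pi> (x + s *\<^sub>R b)" "\<pi> x"] \<pi>0 by (simp add: dist_norm)
    ultimately have 1: "\<gamma> (\<pi> (x + s *\<^sub>R b)) - \<gamma> (\<pi> x) \<le> L * (s * c)"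
      using mult_left_mono[of "s * norm (\<pi> b)" "s * c" L] mult_left_mono[of "norm (\<pi> b)" c s] s L0 by simp
    have "\<bar>(b - e) \<bullet> e\<bar> \<le> norm (b - e) * norm e" by (rule Cauchy_Schwarz_ineq2)
    then have "b \<bullet> e \<ge> 1 - c" using be e ee by (simp add: inner_diff_left)
    then have "s * (b \<bullet> e) \<ge> s * (1 - c)" using s by (intro mult_left_mono) auto
    moreover have "s * (1 - c) = L * (s * c)"
    proof -
      have "1 - c = L * c" using c(3) by (simp add: algebra_simps)
      then show ?thesis by simp
    qed
    ultimately have "L * (s * c) \<le> s * (b \<bullet> e)" by simp
    moreover have "\<gamma> (\<pi> x) < x \<bullet> e" using mem[of x] x r unfolding \<pi>_def by simp
    ultimately have "\<gamma> (\<pi> (x + s *\<^sub>R b)) < (x + s *\<^sub>R b) \<bullet> e" using 1 by (simp add: inner_add_left)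
    then show "x + s *\<^sub>R b \<in> \<Omega>" using mem[OF bl] unfolding \<pi>_def by simp
  qed (use c e r in auto)
  then show ?thesis by blast
qed

section \<open>Translation differences and the layers of a function\<close>

definition transl_diff :: "'a::euclidean_space set \<Rightarrow> 'a \<Rightarrow> ('a \<Rightarrow> real) \<Rightarrow> ennreal" where
  "transl_diff U h f = (\<integral>\<^sup>+x. ennreal (indicator U x * \<bar>f (x + h) - f x\<bar>) \<partial>lborel)"

lemma transl_diff_cone:
  fixes f :: "'a::euclidean_space \<Rightarrow> real"
  assumes \<Omega>: "open \<Omega>" and cone: "cone_at \<Omega> z R e c \<rho>" and f: "integrable lborel f" "variation_le \<Omega> f V"
    and V: "0 \<le> V" and s: "0 \<le> s" "s \<le> \<rho>" and b: "b \<in> cball e c"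
  shows "transl_diff (\<Omega> \<inter> ball z R) (s *\<^sub>R b) f \<le> ennreal (2 * s * V)"
proof -
  let ?U = "\<Omega> \<inter> ball z R"
  have [measurable]: "?U \<in> sets borel" "f \<in> borel_measurable borel" using \<Omega> f by auto
  have "(LINT x|lborel. indicator ?U x * \<bar>f (x + s *\<^sub>R b) - f x\<bar>) \<le> norm (s *\<^sub>R b) * V"
  proof (rule translation_estimate[OF f])
    fix x t assume "x \<in> ?U" "0 \<le> t" "t \<le> (1::real)"
    then show "x + t *\<^sub>R s *\<^sub>R b \<in> \<Omega>"
      using cone b s mult_mono[of t 1 s \<rho>] unfolding cone_at_def by auto
  qed (use \<Omega> in auto)
  also have "\<dots> \<le> 2 * s * V"
    using norm_le_2_if_cball_unit[OF b] cone V s mult_left_mono[of "norm b" 2 s]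
    by (intro mult_right_mono) (auto simp: cone_at_def)
  finally have le: "(LINT x|lborel. indicator ?U x * \<bar>f (x + s *\<^sub>R b) - f x\<bar>) \<le> 2 * s * V" .
  have "integrable lborel (\<lambda>x. \<bar>f (x + s *\<^sub>R b) - f x\<bar>)"
    using f(1) lborel_integrable_shift[OF f(1)] by (intro integrable_abs Bochner_Integration.integrable_diff)
  from integrable_mult_indicator[OF _ this, of ?U]
  have "integrable lborel (\<lambda>x. indicator ?U x * \<bar>f (x + s *\<^sub>R b) - f x\<bar>)" by simp
  then have "transl_diff ?U (s *\<^sub>R b) f = ennreal (LINT x|lborel. indicator ?U x * \<bar>f (x + s *\<^sub>R b) - f x\<bar>)"
    unfolding transl_diff_def by (intro nn_integral_eq_integral) auto
  then show ?thesis using le by (simp add: ennreal_leI)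
qed

text \<open>The difference for a long step is dominated by those for its subdivision into short steps. This brings
  steps of different lengths to a common length, at which the variations of the layers can be added up.\<close>

lemma transl_diff_subdivide:
  fixes f :: "'a::euclidean_space \<Rightarrow> real"
  assumes [measurable]: "f \<in> borel_measurable borel" "U \<in> sets borel" "U' \<in> sets borel"
    and "\<And>x j. x \<in> U \<Longrightarrow> j < N \<Longrightarrow> x + real j *\<^sub>R h \<in> U'"
  shows "transl_diff U (real N *\<^sub>R h) f \<le> of_nat N * transl_diff U' h f"
  using assms(4)
proof (induction N)
  case 0
  then show ?case by (simp add: transl_diff_def)
next
  case (Suc N)
  let ?a = "\<lambda>x. ennreal (indicator U' (x + real N *\<^sub>R h) * \<bar>f ((x + real N *\<^sub>R h) + h) - f (x + real N *\<^sub>R h)\<bar>)"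
  have "transl_diff U (real (Suc N) *\<^sub>R h) f \<le>
     (\<integral>\<^sup>+x. ?a x + ennreal (indicator U x * \<bar>f (x + real N *\<^sub>R h) - f x\<bar>) \<partial>lborel)"
    unfolding transl_diff_def
  proof (rule nn_integral_mono)
    fix x
    have eq: "x + real (Suc N) *\<^sub>R h = (x + real N *\<^sub>R h) + h" by (simp add: scaleR_add_left)
    have "indicator U x * \<bar>f (x + real (Suc N) *\<^sub>R h) - f x\<bar> \<le>
        indicator U' (x + real N *\<^sub>R h) * \<bar>f ((x + real N *\<^sub>R h) + h) - f (x + real N *\<^sub>R h)\<bar> +
        indicator U x * \<bar>f (x + real N *\<^sub>R h) - f x\<bar>"
      unfolding eq using Suc.prems[of x N] by (cases "x \<in> U") auto
    then show "ennreal (indicator U x * \<bar>f (x + real (Suc N) *\<^sub>R h) - f x\<bar>) \<le>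
        ?a x + ennreal (indicator U x * \<bar>f (x + real N *\<^sub>R h) - f x\<bar>)"
      by (subst ennreal_plus[symmetric]) (auto intro!: ennreal_leI simp del: ennreal_plus)
  qed
  also have "\<dots> = (\<integral>\<^sup>+x. ?a x \<partial>lborel) + transl_diff U (real N *\<^sub>R h) f"
    unfolding transl_diff_def by (intro nn_integral_add) auto
  also have "(\<integral>\<^sup>+x. ?a x \<partial>lborel) = transl_diff U' h f"
    unfolding transl_diff_def
    by (rule nn_integral_lborel_shift[where f="\<lambda>x. ennreal (indicator U' x * \<bar>f (x + h) - f x\<bar>)"]) auto
  also have "transl_diff U (real N *\<^sub>R h) f \<le> of_nat N * transl_diff U' h f"
    by (rule Suc.IH) (use Suc.prems in auto)
  finally show ?case by (simp add: distrib_right add_left_mono)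
qed

lemma emeasure_lborel_affine_preimage:
  fixes A :: "'a::euclidean_space set"
  assumes [measurable]: "A \<in> sets borel" and s: "0 < s"
  shows "emeasure lborel A = ennreal (s ^ DIM('a)) * emeasure lborel {b. x + s *\<^sub>R b \<in> A}"
proof -
  let ?M = "distr lborel borel (\<lambda>b. x + s *\<^sub>R b)"
  have "emeasure lborel A = emeasure (density ?M (\<lambda>_. ennreal (\<bar>s\<bar> ^ DIM('a)))) A"
    using lborel_affine[of s x] s by simp
  also have "\<dots> = ennreal (s ^ DIM('a)) * emeasure ?M A"
    using s by (subst emeasure_density) (auto simp: nn_integral_cmult)
  also have "emeasure ?M A = emeasure lborel {b. x + s *\<^sub>R b \<in> A}"
    by (subst emeasure_distr) (auto simp: vimage_def)
  finally show ?thesis .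
qed

text \<open>The part of \<open>\<bar>t\<bar>\<close> that lies between \<open>2\<^sup>k\<close> and \<open>2\<^bsup>k+1\<^esup>\<close>.\<close>

definition layer :: "nat \<Rightarrow> real \<Rightarrow> real" where
  "layer k t = min \<bar>t\<bar> (2 ^ Suc k) - min \<bar>t\<bar> (2 ^ k)"

text \<open>Each layer is a monotone function of \<open>\<bar>t\<bar>\<close> and the layers telescope, so splitting a function into layers
  does not increase the total variation.\<close>

lemma sum_layer_diff_le: "(\<Sum>k\<in>{a..<b}. \<bar>layer k s - layer k t\<bar>) \<le> \<bar>s - t\<bar>"
proof (cases "a \<le> b")
  case ab: True
  have tele: "(\<Sum>k\<in>{a..<b}. layer k r) = min \<bar>r\<bar> (2 ^ b) - min \<bar>r\<bar> (2 ^ a)" for r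
    unfolding layer_def using sum_Suc_diff'[OF ab, of "\<lambda>k. min \<bar>r\<bar> (2 ^ k)"] by simp
  have *: "(\<Sum>k\<in>{a..<b}. \<bar>layer k s - layer k t\<bar>) \<le> \<bar>s\<bar> - \<bar>t\<bar>" if st: "\<bar>t\<bar> \<le> \<bar>s\<bar>" for s t
  proof -
    have "layer k t \<le> layer k s" for k
      using st power_increasing[of k "Suc k" "2::real"] unfolding layer_def min_def by auto
    then have "(\<Sum>k\<in>{a..<b}. \<bar>layer k s - layer k t\<bar>) = (\<Sum>k\<in>{a..<b}. layer k s) - (\<Sum>k\<in>{a..<b}. layer k t)"
      by (simp add: sum_subtractf)
    also have "\<dots> \<le> \<bar>s\<bar> - \<bar>t\<bar>"
      unfolding tele using st power_increasing[OF ab, of "2::real"] by linarith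
    finally show ?thesis .
  qed
  show ?thesis
  proof (cases "\<bar>t\<bar> \<le> \<bar>s\<bar>")
    case True
    from *[OF True] show ?thesis by linarith
  next
    case False
    have "(\<Sum>k\<in>{a..<b}. \<bar>layer k s - layer k t\<bar>) = (\<Sum>k\<in>{a..<b}. \<bar>layer k t - layer k s\<bar>)"
      by (simp add: abs_minus_commute)
    also have "\<dots> \<le> \<bar>t\<bar> - \<bar>s\<bar>" using False by (intro *) auto
    finally show ?thesis by linarith
  qed
qed auto

lemma borel_measurable_layer [measurable]: "layer k \<in> borel_measurable borel"
  unfolding layer_def by measurable

lemma transl_diff_sum_layers_le:
  fixes f :: "'a::euclidean_space \<Rightarrow> real"
  assumes [measurable]: "f \<in> borel_measurable borel" "U \<in> sets borel"
  shows "(\<Sum>k\<in>{a..<b}. transl_diff U h (\<lambda>x. layer k (f x))) \<le> transl_diff U h f"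
proof -
  have "(\<Sum>k\<in>{a..<b}. transl_diff U h (\<lambda>x. layer k (f x))) =
    (\<integral>\<^sup>+x. (\<Sum>k\<in>{a..<b}. ennreal (indicator U x * \<bar>layer k (f (x + h)) - layer k (f x)\<bar>)) \<partial>lborel)"
    unfolding transl_diff_def by (subst nn_integral_sum) auto
  also have "\<dots> = (\<integral>\<^sup>+x. ennreal (indicator U x * (\<Sum>k\<in>{a..<b}. \<bar>layer k (f (x + h)) - layer k (f x)\<bar>)) \<partial>lborel)"
    by (subst sum_ennreal) (auto simp: sum_distrib_left)
  also have "\<dots> \<le> transl_diff U h f" unfolding transl_diff_def
    by (intro nn_integral_mono ennreal_leI mult_left_mono sum_layer_diff_le) auto
  finally show ?thesis .
qed

section \<open>Decay of the level sets\<close>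

lemma level_set_Markov:
  fixes f :: "'a::euclidean_space \<Rightarrow> real"
  assumes f: "integrable lborel f" and t: "0 < t"
  shows "emeasure lborel {x. t \<le> \<bar>f x\<bar>} < \<infinity>" "measure lborel {x. t \<le> \<bar>f x\<bar>} \<le> (LINT x|lborel. \<bar>f x\<bar>) / t"
proof -
  have *: "emeasure lborel {x. t \<le> \<bar>f x\<bar>} \<le> ennreal (1 / t * (LINT x|lborel. \<bar>f x\<bar>))"
    using integral_Markov_inequality[of lborel "\<lambda>x. \<bar>f x\<bar>" t] f t by simp
  show "emeasure lborel {x. t \<le> \<bar>f x\<bar>} < \<infinity>" using * by (rule le_less_trans) simp
  have "0 \<le> 1 / t * (LINT x|lborel. \<bar>f x\<bar>)" using t by (intro mult_nonneg_nonneg integral_nonneg_AE) auto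
  then show "measure lborel {x. t \<le> \<bar>f x\<bar>} \<le> (LINT x|lborel. \<bar>f x\<bar>) / t"
    using enn2real_mono[OF *] unfolding measure_def by simp
qed

text \<open>Fix a point \<open>x\<close> with \<open>\<bar>f x\<bar> \<ge> 2\<^bsup>k+1\<^esup>\<close>. By \<open>small\<close> the set \<open>{\<bar>f\<bar> \<ge> 2\<^sup>k}\<close> has at most half the volume of the ball
  \<open>x + s *\<^sub>R cball e c\<close>. Hence for at least half of all \<open>b\<close> the \<open>k\<close>-th layer vanishes at \<open>x + s *\<^sub>R b\<close>,
  while it is \<open>2\<^sup>k\<close> at \<open>x\<close>. Integrating over \<open>x\<close> and \<open>b\<close> and exchanging the integrals gives the bound.\<close>

lemma level_step:
  fixes f :: "'a::euclidean_space \<Rightarrow> real"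
  assumes f: "integrable lborel f" and [measurable]: "U \<in> sets borel" and s: "0 < s"
    and small: "2 * measure lborel {x. 2 ^ k \<le> \<bar>f x\<bar>} \<le> measure lborel (cball e c) * s ^ DIM('a)"
  shows "ennreal (2 ^ k * (measure lborel (cball e c) / 2)) * emeasure lborel {x\<in>U. 2 ^ Suc k \<le> \<bar>f x\<bar>}
    \<le> (\<integral>\<^sup>+b. indicator (cball e c) b * transl_diff U (s *\<^sub>R b) (\<lambda>x. layer k (f x)) \<partial>lborel)"
proof -
  have [measurable]: "f \<in> borel_measurable borel" using f by auto
  let ?B = "cball e c" and ?E = "{x\<in>U. 2 ^ Suc k \<le> \<bar>f x\<bar>}" and ?\<beta> = "measure lborel (cball e c)"
  let ?H = "{x. 2 ^ k \<le> \<bar>f x\<bar>}"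
  have [measurable]: "?B \<in> sets borel" by simp
  have Bf: "emeasure lborel ?B < \<infinity>" by (rule emeasure_lborel_cball_finite)
  have half: "ennreal (?\<beta> / 2) \<le> emeasure lborel (?B \<inter> {b. \<bar>f (x + s *\<^sub>R b)\<bar> < 2 ^ k})" for x
  proof -
    let ?G = "{b. \<bar>f (x + s *\<^sub>R b)\<bar> < 2 ^ k}"
    let ?G' = "{b. x + s *\<^sub>R b \<in> ?H}"
    have [measurable]: "?G \<in> sets borel" "?G' \<in> sets borel" by measurable
    have fin: "emeasure lborel (?B - ?G) < \<infinity>" "emeasure lborel (?B \<inter> ?G) < \<infinity>"
      using Bf emeasure_mono[of "?B - ?G" ?B lborel] emeasure_mono[of "?B \<inter> ?G" ?B lborel]
      by (auto simp: less_top[symmetric] top.extremum_unique)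
    have *: "emeasure lborel ?H = ennreal (s ^ DIM('a)) * emeasure lborel ?G'"
      by (rule emeasure_lborel_affine_preimage) (use s in auto)
    have "emeasure lborel ?H < \<infinity>"
      by (rule level_set_Markov(1)[OF f]) simp
    have "measure lborel ?H = s ^ DIM('a) * measure lborel ?G'"
      unfolding measure_def * using s by (simp add: enn2real_mult)
    then have G': "2 * measure lborel ?G' \<le> ?\<beta>" using small s by (simp add: mult.commute)
    have G'fin: "emeasure lborel ?G' < \<infinity>"
      using * \<open>emeasure lborel ?H < \<infinity>\<close> s by (auto simp: ennreal_mult_less_top)
    have "measure lborel (?B - ?G) \<le> measure lborel ?G'"
      unfolding measure_def using G'fin by (intro enn2real_mono emeasure_mono) auto
    moreover have "?\<beta> = measure lborel (?B - ?G) + measure lborel (?B \<inter> ?G)"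
    proof -
      have "?\<beta> = measure lborel ((?B - ?G) \<union> (?B \<inter> ?G))" by (rule arg_cong[where f="measure lborel"]) auto
      also have "\<dots> = measure lborel (?B - ?G) + measure lborel (?B \<inter> ?G)"
        by (rule measure_Union) (use fin in auto)
      finally show ?thesis .
    qed
    ultimately have "?\<beta> / 2 \<le> measure lborel (?B \<inter> ?G)" using G' by simp
    then show ?thesis using fin(2) by (simp add: emeasure_eq_ennreal_measure ennreal_leI)
  qed
  have "ennreal (2 ^ k * (?\<beta> / 2)) * emeasure lborel ?E = (\<integral>\<^sup>+x. ennreal (2 ^ k * (?\<beta> / 2)) * indicator ?E x \<partial>lborel)"
    by (subst nn_integral_cmult_indicator) auto
  also have "\<dots> \<le> (\<integral>\<^sup>+x. \<integral>\<^sup>+b. indicator ?B b *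
       ennreal (indicator U x * \<bar>layer k (f (x + s *\<^sub>R b)) - layer k (f x)\<bar>) \<partial>lborel \<partial>lborel)"
  proof (rule nn_integral_mono)
    fix x
    show "ennreal (2 ^ k * (?\<beta> / 2)) * indicator ?E x \<le> (\<integral>\<^sup>+b. indicator ?B b *
       ennreal (indicator U x * \<bar>layer k (f (x + s *\<^sub>R b)) - layer k (f x)\<bar>) \<partial>lborel)"
    proof (cases "x \<in> ?E")
      case True
      let ?G = "{b. \<bar>f (x + s *\<^sub>R b)\<bar> < 2 ^ k}"
      have "ennreal (2 ^ k * (?\<beta> / 2)) \<le> ennreal (2 ^ k) * emeasure lborel (?B \<inter> ?G)"
        using half[of x] by (subst ennreal_mult) (auto intro!: mult_left_mono)
      also have "\<dots> = (\<integral>\<^sup>+b. ennreal (2 ^ k) * indicator (?B \<inter> ?G) b \<partial>lborel)"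
        by (subst nn_integral_cmult_indicator) auto
      also have "\<dots> \<le> (\<integral>\<^sup>+b. indicator ?B b *
       ennreal (indicator U x * \<bar>layer k (f (x + s *\<^sub>R b)) - layer k (f x)\<bar>) \<partial>lborel)"
      proof (rule nn_integral_mono)
        fix b
        have "layer k (f x) = 2 ^ k"
        proof -
          have "2 ^ Suc k \<le> \<bar>f x\<bar>" using True by simp
          then have "min \<bar>f x\<bar> (2 ^ Suc k) = 2 ^ Suc k" "min \<bar>f x\<bar> (2 ^ k) = 2 ^ k" by auto
          then show ?thesis by (simp add: layer_def)
        qed
        moreover have "layer k (f (x + s *\<^sub>R b)) = 0" if "b \<in> ?G"
        proof -
          have "\<bar>f (x + s *\<^sub>R b)\<bar> < 2 ^ k" using that by simp
          moreover have "(2::real) ^ k \<le> 2 ^ Suc k" by simp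
          ultimately have "min \<bar>f (x + s *\<^sub>R b)\<bar> (2 ^ Suc k) = \<bar>f (x + s *\<^sub>R b)\<bar>"
            "min \<bar>f (x + s *\<^sub>R b)\<bar> (2 ^ k) = \<bar>f (x + s *\<^sub>R b)\<bar>" by linarith+
          then show ?thesis by (simp add: layer_def)
        qed
        ultimately show "ennreal (2 ^ k) * indicator (?B \<inter> ?G) b \<le> indicator ?B b *
             ennreal (indicator U x * \<bar>layer k (f (x + s *\<^sub>R b)) - layer k (f x)\<bar>)"
          using True by (cases "b \<in> ?B \<inter> ?G") auto
      qed
      finally show ?thesis using True by simp
    qed simp
  qed
  also have "\<dots> = (\<integral>\<^sup>+b. \<integral>\<^sup>+x. indicator ?B b *
       ennreal (indicator U x * \<bar>layer k (f (x + s *\<^sub>R b)) - layer k (f x)\<bar>) \<partial>lborel \<partial>lborel)"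
  proof (rule lborel_pair.Fubini'[symmetric])
    have "(\<lambda>(x, b). indicator ?B b *
       ennreal (indicator U x * \<bar>layer k (f (x + s *\<^sub>R b)) - layer k (f x)\<bar>)) \<in> borel_measurable (borel \<Otimes>\<^sub>M borel)"
      by measurable
    then show "(\<lambda>(x, b). indicator ?B b *
       ennreal (indicator U x * \<bar>layer k (f (x + s *\<^sub>R b)) - layer k (f x)\<bar>)) \<in> borel_measurable (lborel \<Otimes>\<^sub>M lborel)"
      by (simp cong: measurable_cong_sets)
  qed
  also have "\<dots> = (\<integral>\<^sup>+b. indicator ?B b * transl_diff U (s *\<^sub>R b) (\<lambda>x. layer k (f x)) \<partial>lborel)"
    unfolding transl_diff_def by (intro nn_integral_cong nn_integral_cmult) auto
  finally show ?thesis .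
qed

lemma borel_measurable_transl_diff:
  fixes f :: "'a::euclidean_space \<Rightarrow> real"
  assumes [measurable]: "f \<in> borel_measurable borel" "U \<in> sets borel"
  shows "(\<lambda>b. transl_diff U (s *\<^sub>R b) f) \<in> borel_measurable borel"
proof -
  have "(\<lambda>b. \<integral>\<^sup>+x. ennreal (indicator U x * \<bar>f (x + s *\<^sub>R b) - f x\<bar>) \<partial>lborel) \<in> borel_measurable lborel"
    by measurable
  then show ?thesis by (simp add: transl_diff_def)
qed

lemma powr_inverse_power:
  assumes "0 \<le> x" "0 < n" shows "(x powr (1 / real n)) ^ n = x"
  using assms by (cases "x = 0") (auto simp: powr_realpow[symmetric] powr_powr)

definition level_vol :: "('a::euclidean_space \<Rightarrow> real) \<Rightarrow> nat \<Rightarrow> real" where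
  "level_vol f k = measure lborel {x. 2 ^ k \<le> \<bar>f x\<bar>}"

text \<open>The step length \<open>s k\<close> is the one for which the ball in \<open>level_step\<close> has twice the volume of the level set.
  The bound on a single layer is a translation difference at this length, and the lengths depend on \<open>k\<close>; to
  profit from \<open>sum_layer_diff_le\<close> all of them are rounded up to multiples of the smallest positive one, \<open>\<tau>\<close>,
  which at most doubles them, and then subdivided into steps of length \<open>\<tau>\<close>.\<close>

lemma level_estimate_local:
  fixes f :: "'a::euclidean_space \<Rightarrow> real"
  assumes \<Omega>: "open \<Omega>" and cone: "cone_at \<Omega> z R e c \<rho>" and f: "integrable lborel f" "variation_le \<Omega> f V"
    and V: "0 \<le> V" and small: "\<And>k. a \<le> k \<Longrightarrow> 2 * level_vol f k \<le> measure lborel (cball e c) * (\<rho> / 2) ^ DIM('a)"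
  shows "\<exists>W. (\<forall>k. 0 \<le> W k) \<and> (\<Sum>k\<in>{a..<K}. W k) \<le> 2 * V \<and>
    (\<forall>k\<in>{a..<K}. 2 ^ k * measure lborel {x\<in>\<Omega> \<inter> ball z (R/2). 2 ^ Suc k \<le> \<bar>f x\<bar>} \<le>
       4 * (2 / measure lborel (cball e c)) powr (1 / DIM('a)) * level_vol f k powr (1 / DIM('a)) * W k)"
proof -
  define \<beta> where "\<beta> = measure lborel (cball e c)"
  have c: "0 < c" "c \<le> 1" "norm e = 1" "0 < \<rho>" "4 * \<rho> \<le> R" using cone by (auto simp: cone_at_def)
  have \<beta>: "\<beta> > 0" unfolding \<beta>_def using c(1) by (rule content_cball_pos)
  have [measurable]: "f \<in> borel_measurable borel" using f by auto
  let ?U = "\<Omega> \<inter> ball z (R/2)" and ?U' = "\<Omega> \<inter> ball z R" and ?B = "cball e c"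
  have [measurable]: "?U \<in> sets borel" "?U' \<in> sets borel" using \<Omega> by auto
  let ?d = "DIM('a)"
  define s where "s k = (2 * level_vol f k / \<beta>) powr (1 / ?d)" for k
  have s0: "0 \<le> s k" for k by (simp add: s_def)
  have m0: "0 \<le> level_vol f k" for k by (simp add: level_vol_def)
  have sd: "s k ^ ?d = 2 * level_vol f k / \<beta>" for k
    unfolding s_def using \<beta> m0 by (intro powr_inverse_power) auto
  have s\<rho>: "s k \<le> \<rho> / 2" if "a \<le> k" for k
  proof (rule power_le_imp_le_base)
    have "s k ^ ?d \<le> (\<rho> / 2) ^ ?d" unfolding sd using small[OF that] \<beta> by (simp add: \<beta>_def divide_simps mult.commute)
    then show "s k ^ Suc (?d - 1) \<le> (\<rho> / 2) ^ Suc (?d - 1)" by simp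
  qed (use c in auto)
  define S where "S = insert \<rho> (s ` {k\<in>{a..<K}. s k > 0})"
  \<comment> \<open>Including \<open>\<rho>\<close> keeps the minimum meaningful when every \<open>s k\<close> vanishes.\<close>
  define \<tau> where "\<tau> = Min S"
  have S: "finite S" "S \<noteq> {}" by (auto simp: S_def)
  have \<tau>: "\<tau> > 0" "\<tau> \<le> \<rho>" and \<tau>s: "\<And>k. k \<in> {a..<K} \<Longrightarrow> s k > 0 \<Longrightarrow> \<tau> \<le> s k"
    unfolding \<tau>_def using S c by (auto simp: S_def)
  define I where "I k = (\<integral>\<^sup>+b. indicator ?B b * transl_diff ?U' (\<tau> *\<^sub>R b) (\<lambda>x. layer k (f x)) \<partial>lborel)" for k
  define W where "W k = enn2real (I k) / (\<tau> * \<beta>)" for k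
  have tm: "(\<lambda>b. transl_diff ?U' (t *\<^sub>R b) (\<lambda>x. layer k (f x))) \<in> borel_measurable borel" for k t
    by (rule borel_measurable_transl_diff) measurable
  have [measurable]: "?B \<in> sets borel" by simp
  have Im: "(\<lambda>b. indicator ?B b * transl_diff ?U' (t *\<^sub>R b) (\<lambda>x. layer k (f x))) \<in> borel_measurable borel" for k t
  proof -
    note [measurable] = tm
    show ?thesis by measurable
  qed
  have Bem: "emeasure lborel ?B = ennreal \<beta>"
    unfolding \<beta>_def using emeasure_lborel_cball_finite[of e c] by (intro emeasure_eq_ennreal_measure) auto
  have "(\<Sum>k\<in>{a..<K}. I k) = (\<integral>\<^sup>+b. indicator ?B b * (\<Sum>k\<in>{a..<K}. transl_diff ?U' (\<tau> *\<^sub>R b) (\<lambda>x. layer k (f x))) \<partial>lborel)"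
    unfolding I_def by (subst nn_integral_sum[symmetric]) (auto simp: sum_distrib_left Im)
  also have "\<dots> \<le> (\<integral>\<^sup>+b. ennreal (2 * \<tau> * V) * indicator ?B b \<partial>lborel)"
  proof (rule nn_integral_mono)
    fix b
    show "indicator ?B b * (\<Sum>k\<in>{a..<K}. transl_diff ?U' (\<tau> *\<^sub>R b) (\<lambda>x. layer k (f x))) \<le> ennreal (2 * \<tau> * V) * indicator ?B b"
    proof (cases "b \<in> ?B")
      case True
      have "(\<Sum>k\<in>{a..<K}. transl_diff ?U' (\<tau> *\<^sub>R b) (\<lambda>x. layer k (f x))) \<le> transl_diff ?U' (\<tau> *\<^sub>R b) f"
        by (rule transl_diff_sum_layers_le) measurable
      also have "\<dots> \<le> ennreal (2 * \<tau> * V)"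
        by (rule transl_diff_cone[OF \<Omega> cone f V _ _ True]) (use \<tau> in auto)
      finally show ?thesis using True by simp
    qed simp
  qed
  also have "\<dots> = ennreal (2 * \<tau> * V) * ennreal \<beta>"
    by (subst nn_integral_cmult_indicator) (auto simp: Bem)
  also have "\<dots> = ennreal (2 * \<tau> * V * \<beta>)" using V \<tau> \<beta> by (simp add: ennreal_mult')
  finally have sumI: "(\<Sum>k\<in>{a..<K}. I k) \<le> ennreal (2 * \<tau> * V * \<beta>)" .
  have Ifin: "I k = ennreal (enn2real (I k))" if "k \<in> {a..<K}" for k
  proof -
    have "I k \<le> (\<Sum>k\<in>{a..<K}. I k)" by (rule member_le_sum) (use that in auto)
    also have "\<dots> < \<infinity>" using sumI by (rule le_less_trans) simp
    finally show ?thesis by simp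
  qed
  have "ennreal (\<Sum>k\<in>{a..<K}. enn2real (I k)) = (\<Sum>k\<in>{a..<K}. I k)"
    using Ifin by (subst sum_ennreal[symmetric]) auto
  then have "(\<Sum>k\<in>{a..<K}. enn2real (I k)) \<le> 2 * \<tau> * V * \<beta>"
    using sumI ennreal_le_iff[of "2 * \<tau> * V * \<beta>"] mult_nonneg_nonneg[of "2 * \<tau> * V" \<beta>] V \<tau> \<beta>
    by (metis less_imp_le mult_nonneg_nonneg zero_le_numeral)
  then have sumW: "(\<Sum>k\<in>{a..<K}. W k) \<le> 2 * V"
    using \<tau> \<beta> unfolding W_def by (simp add: sum_divide_distrib[symmetric] divide_simps algebra_simps)
  have "2 ^ k * measure lborel {x\<in>?U. 2 ^ Suc k \<le> \<bar>f x\<bar>} \<le>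
       4 * (2 / \<beta>) powr (1 / ?d) * level_vol f k powr (1 / ?d) * W k" if k: "k \<in> {a..<K}" for k
  proof (cases "s k > 0")
    case False
    then have "s k = 0" using s0[of k] by simp
    then have "level_vol f k = 0" using sd[of k] \<beta> by (simp add: power_0_left)
    moreover have "measure lborel {x\<in>?U. 2 ^ Suc k \<le> \<bar>f x\<bar>} \<le> level_vol f k"
      unfolding level_vol_def measure_def
    proof (intro enn2real_mono emeasure_mono subsetI)
      fix x assume "x \<in> {x\<in>?U. 2 ^ Suc k \<le> \<bar>f x\<bar>}"
      moreover have "(2::real) ^ k \<le> 2 ^ Suc k" by simp
      ultimately have "2 ^ k \<le> \<bar>f x\<bar>" unfolding mem_Collect_eq by linarith
      then show "x \<in> {x. 2 ^ k \<le> \<bar>f x\<bar>}" by simp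
    qed (use level_set_Markov(1)[OF f(1), of "2 ^ k"] in auto)
    ultimately have "measure lborel {x\<in>?U. 2 ^ Suc k \<le> \<bar>f x\<bar>} = 0"
      by (simp add: measure_le_0_iff)
    then show ?thesis using \<beta> \<tau> by (simp add: W_def)
  next
    case True
    define N where "N = nat \<lceil>s k / \<tau>\<rceil>"
    have N: "s k \<le> real N * \<tau>" "real N * \<tau> \<le> 2 * s k"
    proof -
      have "s k / \<tau> \<le> real N" unfolding N_def by (rule real_nat_ceiling_ge)
      then show "s k \<le> real N * \<tau>" using \<tau> by (simp add: divide_simps)
      have "real N \<le> s k / \<tau> + 1" unfolding N_def using True \<tau> by simp
      then have "real N * \<tau> \<le> (s k / \<tau> + 1) * \<tau>" using \<tau> by (intro mult_right_mono) auto
      also have "\<dots> = s k + \<tau>" using \<tau> by (simp add: field_simps)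
      finally show "real N * \<tau> \<le> 2 * s k" using \<tau>s[OF k True] by simp
    qed
    have Npos: "0 < real N * \<tau>" using N True by linarith
    have N\<rho>: "real N * \<tau> \<le> \<rho>" using N s\<rho>[of k] k by auto
    have "s k ^ ?d \<le> (real N * \<tau>) ^ ?d" using N s0 by (intro power_mono) auto
    then have "2 * level_vol f k \<le> \<beta> * (real N * \<tau>) ^ ?d" unfolding sd using \<beta> by (simp add: divide_simps mult.commute)
    then have "ennreal (2 ^ k * (\<beta> / 2)) * emeasure lborel {x\<in>?U. 2 ^ Suc k \<le> \<bar>f x\<bar>}
      \<le> (\<integral>\<^sup>+b. indicator ?B b * transl_diff ?U ((real N * \<tau>) *\<^sub>R b) (\<lambda>x. layer k (f x)) \<partial>lborel)"
      unfolding \<beta>_def level_vol_def by (intro level_step[OF f(1) _ Npos]) auto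
    also have "\<dots> \<le> (\<integral>\<^sup>+b. of_nat N * (indicator ?B b * transl_diff ?U' (\<tau> *\<^sub>R b) (\<lambda>x. layer k (f x))) \<partial>lborel)"
    proof (rule nn_integral_mono)
      fix b
      show "indicator ?B b * transl_diff ?U ((real N * \<tau>) *\<^sub>R b) (\<lambda>x. layer k (f x))
         \<le> of_nat N * (indicator ?B b * transl_diff ?U' (\<tau> *\<^sub>R b) (\<lambda>x. layer k (f x)))"
      proof (cases "b \<in> ?B")
        case b: True
        have "transl_diff ?U (real N *\<^sub>R (\<tau> *\<^sub>R b)) (\<lambda>x. layer k (f x)) \<le>
              of_nat N * transl_diff ?U' (\<tau> *\<^sub>R b) (\<lambda>x. layer k (f x))"
        proof (rule transl_diff_subdivide)
          fix x j assume x: "x \<in> ?U" and j: "j < N"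
          have j\<tau>: "0 \<le> real j * \<tau>" "real j * \<tau> \<le> \<rho>"
            using \<tau> order_trans[OF mult_right_mono[of "real j" "real N" \<tau>] N\<rho>] j by auto
          have "(real j * \<tau>) * norm b \<le> \<rho> * 2"
            by (intro mult_mono) (use j\<tau> c norm_le_2_if_cball_unit[OF b c(3,2)] in auto)
          moreover have "dist z (x + (real j * \<tau>) *\<^sub>R b) \<le> dist z x + (real j * \<tau>) * norm b"
            using dist_triangle[of z "x + (real j * \<tau>) *\<^sub>R b" x] j\<tau> \<tau> by (simp add: dist_norm)
          moreover have "dist z x < R / 2" using x by simp
          ultimately have "x + (real j * \<tau>) *\<^sub>R b \<in> ball z R" using c by simp
          moreover have "x \<in> ?U'" using x c by auto
          then have "x + (real j * \<tau>) *\<^sub>R b \<in> \<Omega>"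
            using cone j\<tau> b unfolding cone_at_def by blast
          ultimately show "x + real j *\<^sub>R \<tau> *\<^sub>R b \<in> ?U'" by simp
        qed measurable
        then show ?thesis using b by simp
      qed simp
    qed
    also have "\<dots> = of_nat N * I k" unfolding I_def by (intro nn_integral_cmult) (simp add: Im)
    also have "\<dots> = ennreal (real N * enn2real (I k))"
      by (subst Ifin[OF k]) (simp add: ennreal_mult' ennreal_of_nat_eq_real_of_nat)
    finally have *: "ennreal (2 ^ k * (\<beta> / 2)) * emeasure lborel {x\<in>?U. 2 ^ Suc k \<le> \<bar>f x\<bar>} \<le> ennreal (real N * enn2real (I k))" .
    then have "enn2real (ennreal (2 ^ k * (\<beta> / 2)) * emeasure lborel {x\<in>?U. 2 ^ Suc k \<le> \<bar>f x\<bar>}) \<le> real N * enn2real (I k)"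
      using enn2real_mono[OF *] by simp
    then have "2 ^ k * (\<beta> / 2) * measure lborel {x\<in>?U. 2 ^ Suc k \<le> \<bar>f x\<bar>} \<le> real N * enn2real (I k)"
      using \<beta> by (simp add: enn2real_mult measure_def)
    also have "\<dots> = real N * \<tau> * \<beta> * W k" using \<tau> \<beta> by (simp add: W_def)
    also have "\<dots> \<le> 2 * s k * \<beta> * W k"
      using N \<beta> \<tau> by (intro mult_right_mono) (auto simp: W_def)
    finally have "2 ^ k * measure lborel {x\<in>?U. 2 ^ Suc k \<le> \<bar>f x\<bar>} * (\<beta> / 2) \<le> (4 * s k * W k) * (\<beta> / 2)"
      by (simp add: algebra_simps)
    then have "2 ^ k * measure lborel {x\<in>?U. 2 ^ Suc k \<le> \<bar>f x\<bar>} \<le> 4 * s k * W k"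
      by (rule mult_right_le_imp_le) (use \<beta> in simp)
    moreover have "s k = (2 / \<beta>) powr (1 / ?d) * level_vol f k powr (1 / ?d)"
      using \<beta> m0 unfolding s_def by (simp add: powr_mult[symmetric])
    ultimately show ?thesis by (simp add: mult.assoc)
  qed
  moreover have "0 \<le> W k" for k using \<tau> \<beta> by (simp add: W_def)
  ultimately show ?thesis using sumW unfolding \<beta>_def by blast
qed

section \<open>The embedding of BV into \<open>L\<^sup>r\<close>\<close>

lemma finite_cone_cover:
  fixes \<Omega> :: "'a::euclidean_space set"
  assumes "open \<Omega>" "bounded \<Omega>" "lipschitz_boundary \<Omega>"
  shows "\<exists>D R e c \<rho>. finite D \<and> (\<forall>z\<in>D. cone_at \<Omega> z (R z) (e z) (c z) (\<rho> z)) \<and>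
    \<Omega> \<subseteq> (\<Union>z\<in>D. ball z (R z / 2))"
proof -
  have "\<forall>z\<in>closure \<Omega>. \<exists>p. cone_at \<Omega> z (fst p) (fst (snd p)) (fst (snd (snd p))) (snd (snd (snd p)))"
  proof
    fix z assume "z \<in> closure \<Omega>"
    then obtain R e c \<rho> where "cone_at \<Omega> z R e c \<rho>" using exists_cone_at[OF assms(1,3)] by blast
    then show "\<exists>p. cone_at \<Omega> z (fst p) (fst (snd p)) (fst (snd (snd p))) (snd (snd (snd p)))"
      by (intro exI[of _ "(R, e, c, \<rho>)"]) simp
  qed
  from bchoice[OF this] obtain p where p': "\<forall>z\<in>closure \<Omega>.
      cone_at \<Omega> z (fst (p z)) (fst (snd (p z))) (fst (snd (snd (p z)))) (snd (snd (snd (p z))))" ..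
  note p = bspec[OF p']
  have "compact (closure \<Omega>)" using assms(2) by (simp add: compact_closure)
  then obtain D where D: "D \<subseteq> closure \<Omega>" "finite D" "closure \<Omega> \<subseteq> (\<Union>z\<in>D. ball z (fst (p z) / 2))"
  proof (rule compactE_image[of "closure \<Omega>" "closure \<Omega>" "\<lambda>z. ball z (fst (p z) / 2)"])
    show "closure \<Omega> \<subseteq> (\<Union>z\<in>closure \<Omega>. ball z (fst (p z) / 2))"
    proof
      fix z assume z: "z \<in> closure \<Omega>"
      then have "0 < fst (p z)" using p[OF z] by (simp add: cone_at_def)
      then show "z \<in> (\<Union>z\<in>closure \<Omega>. ball z (fst (p z) / 2))" using z by (intro UN_I[of z]) auto
    qed
  qed auto
  show ?thesis
    by (rule exI[of _ D], rule exI[of _ "\<lambda>z. fst (p z)"], rule exI[of _ "\<lambda>z. fst (snd (p z))"],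
        rule exI[of _ "\<lambda>z. fst (snd (snd (p z)))"], rule exI[of _ "\<lambda>z. snd (snd (snd (p z)))"])
       (use D p closure_subset[of \<Omega>] in auto)
qed

text \<open>\<open>W k\<close> stands for the variation of the \<open>k\<close>-th layer; the bound on the sum of the \<open>W k\<close> is what makes the
  recursion for the volumes summable.\<close>

definition level_decay :: "'a::euclidean_space set \<Rightarrow> real \<Rightarrow> real \<Rightarrow> bool" where
  "level_decay \<Omega> C \<delta> \<longleftrightarrow> (\<forall>f V a K. integrable lborel f \<longrightarrow> variation_le \<Omega> f V \<longrightarrow> 0 \<le> V \<longrightarrow>
    (\<forall>x. x \<notin> \<Omega> \<longrightarrow> f x = 0) \<longrightarrow> (\<forall>k\<ge>a. level_vol f k \<le> \<delta>) \<longrightarrow>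
    (\<exists>W. (\<forall>k. 0 \<le> W k) \<and> (\<Sum>k\<in>{a..<K}. W k) \<le> C * V \<and>
       (\<forall>k\<in>{a..<K}. 2 ^ k * level_vol f (Suc k) \<le> C * level_vol f k powr (1 / DIM('a)) * W k)))"

lemma level_estimate:
  fixes \<Omega> :: "'a::euclidean_space set"
  assumes \<Omega>: "open \<Omega>" "bounded \<Omega>" "lipschitz_boundary \<Omega>"
  shows "\<exists>C \<delta>. 0 \<le> C \<and> 0 < \<delta> \<and> \<delta> \<le> 1 \<and> level_decay \<Omega> C \<delta>"
proof -
  obtain D R e c \<rho> where D: "finite D" and cone': "\<forall>z\<in>D. cone_at \<Omega> z (R z) (e z) (c z) (\<rho> z)"
    and cov: "\<Omega> \<subseteq> (\<Union>z\<in>D. ball z (R z / 2))"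
    using finite_cone_cover[OF \<Omega>] by (elim exE conjE) (rule that)
  note cone = bspec[OF cone']
  define \<beta> where "\<beta> z = measure lborel (cball (e z) (c z))" for z
  have \<beta>: "\<beta> z > 0" if "z \<in> D" for z
    unfolding \<beta>_def using cone[OF that] by (intro content_cball_pos) (simp add: cone_at_def)
  \<comment> \<open>The \<open>1\<close> ensures \<open>\<delta> \<le> 1\<close>, as needed when the exponent \<open>1 / d\<close> is lowered.\<close>
  define S where "S = insert 1 ((\<lambda>z. \<beta> z * (\<rho> z / 2) ^ DIM('a) / 2) ` D)"
  have S: "finite S" "S \<noteq> {}" using D by (auto simp: S_def)
  define \<delta> where "\<delta> = Min S"
  have \<delta>: "0 < \<delta>"
    unfolding \<delta>_def using S \<beta> cone by (auto simp: S_def cone_at_def)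
  have \<delta>1: "\<delta> \<le> 1" unfolding \<delta>_def using S by (intro Min_le) (auto simp: S_def)
  have \<delta>z: "2 * \<delta> \<le> \<beta> z * (\<rho> z / 2) ^ DIM('a)" if "z \<in> D" for z
  proof -
    have "\<delta> \<le> \<beta> z * (\<rho> z / 2) ^ DIM('a) / 2" unfolding \<delta>_def using S that by (intro Min_le) (auto simp: S_def)
    then show ?thesis by simp
  qed
  define Cz where "Cz z = 4 * (2 / \<beta> z) powr (1 / DIM('a))" for z
  have Cz0: "0 \<le> Cz z" for z by (simp add: Cz_def)
  define C where "C = (\<Sum>z\<in>D. Cz z) + 2 * card D"
  have CzC: "Cz z \<le> C" if "z \<in> D" for z
    using member_le_sum[of z D Cz] that D Cz0 unfolding C_def by auto
  have C0: "0 \<le> C" unfolding C_def using Cz0 by (intro add_nonneg_nonneg sum_nonneg) auto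
  have "level_decay \<Omega> C \<delta>"
    unfolding level_decay_def
  proof (intro allI impI)
    fix f :: "'a \<Rightarrow> real" and V a K
    assume f: "integrable lborel f" "variation_le \<Omega> f V" and V: "0 \<le> V" and f0: "\<forall>x. x \<notin> \<Omega> \<longrightarrow> f x = 0"
      and small: "\<forall>k\<ge>a. level_vol f k \<le> \<delta>"
    have fm [measurable]: "f \<in> borel_measurable borel" using f by auto
    let ?E = "\<lambda>z k. {x\<in>\<Omega> \<inter> ball z (R z/2). 2 ^ Suc k \<le> \<bar>f x\<bar>}"
    have "\<forall>z. \<exists>W. z \<in> D \<longrightarrow> (\<forall>k. 0 \<le> W k) \<and> (\<Sum>k\<in>{a..<K}. W k) \<le> 2 * V \<and>
      (\<forall>k\<in>{a..<K}. 2 ^ k * measure lborel (?E z k) \<le> Cz z * level_vol f k powr (1 / DIM('a)) * W k)"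
    proof
      fix z
      show "\<exists>W. z \<in> D \<longrightarrow> (\<forall>k. 0 \<le> W k) \<and> (\<Sum>k\<in>{a..<K}. W k) \<le> 2 * V \<and>
      (\<forall>k\<in>{a..<K}. 2 ^ k * measure lborel (?E z k) \<le> Cz z * level_vol f k powr (1 / DIM('a)) * W k)"
      proof (cases "z \<in> D")
        case True
        have "2 * level_vol f k \<le> \<beta> z * (\<rho> z / 2) ^ DIM('a)" if "a \<le> k" for k
          using small \<delta>z[OF True] that by (meson mult_left_mono order_trans zero_le_numeral)
        then show ?thesis
          using level_estimate_local[OF \<Omega>(1) cone[OF True] f V, of a K]
          unfolding Cz_def \<beta>_def by auto
      qed auto
    qed
    from choice[OF this] obtain W where "\<forall>z. z \<in> D \<longrightarrow> (\<forall>k. 0 \<le> W z k) \<and> (\<Sum>k\<in>{a..<K}. W z k) \<le> 2 * V \<and>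
      (\<forall>k\<in>{a..<K}. 2 ^ k * measure lborel (?E z k) \<le> Cz z * level_vol f k powr (1 / DIM('a)) * W z k)" ..
    then have W: "\<And>z k. z \<in> D \<Longrightarrow> 0 \<le> W z k" "\<And>z. z \<in> D \<Longrightarrow> (\<Sum>k\<in>{a..<K}. W z k) \<le> 2 * V"
      "\<And>z k. z \<in> D \<Longrightarrow> k \<in> {a..<K} \<Longrightarrow> 2 ^ k * measure lborel (?E z k) \<le> Cz z * level_vol f k powr (1 / DIM('a)) * W z k"
      by simp_all
    show "\<exists>W. (\<forall>k. 0 \<le> W k) \<and> (\<Sum>k\<in>{a..<K}. W k) \<le> C * V \<and>
       (\<forall>k\<in>{a..<K}. 2 ^ k * level_vol f (Suc k) \<le> C * level_vol f k powr (1 / DIM('a)) * W k)"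
    proof (intro exI[of _ "\<lambda>k. \<Sum>z\<in>D. W z k"] conjI allI ballI)
      fix k show "0 \<le> (\<Sum>z\<in>D. W z k)" using W(1) by (intro sum_nonneg) auto
    next
      have "(\<Sum>k\<in>{a..<K}. \<Sum>z\<in>D. W z k) = (\<Sum>z\<in>D. \<Sum>k\<in>{a..<K}. W z k)" by (rule sum.swap)
      also have "\<dots> \<le> (\<Sum>z\<in>D. 2 * V)" using W(2) by (rule sum_mono)
      also have "\<dots> = (2 * card D) * V" by simp
      also have "\<dots> \<le> C * V"
        unfolding C_def using V Cz0 by (intro mult_right_mono) (auto intro: sum_nonneg)
      finally show "(\<Sum>k\<in>{a..<K}. \<Sum>z\<in>D. W z k) \<le> C * V" .
    next
      fix k assume k: "k \<in> {a..<K}"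
      have Em: "?E z k \<in> fmeasurable lborel" for z
      proof (rule fmeasurableI)
        show "?E z k \<in> sets lborel" using \<Omega>(1) by simp
        have "emeasure lborel (?E z k) \<le> emeasure lborel {x. 2 ^ Suc k \<le> \<bar>f x\<bar>}"
          by (rule emeasure_mono) auto
        also have "\<dots> < \<infinity>" by (rule level_set_Markov(1)[OF f(1)]) simp
        finally show "emeasure lborel (?E z k) < \<infinity>" .
      qed
      have "{x. 2 ^ Suc k \<le> \<bar>f x\<bar>} = (\<Union>z\<in>D. ?E z k)"
      proof (intro set_eqI iffI)
        fix x assume x: "x \<in> {x. 2 ^ Suc k \<le> \<bar>f x\<bar>}"
        have "x \<in> \<Omega>"
        proof (rule ccontr)
          assume "x \<notin> \<Omega>"
          then have "f x = 0" using f0 by blast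
          then have "(2::real) ^ Suc k \<le> 0" using x by simp
          moreover have "(0::real) < 2 ^ Suc k" by (rule zero_less_power) simp
          ultimately show False by linarith
        qed
        then show "x \<in> (\<Union>z\<in>D. ?E z k)" using x cov by blast
      qed auto
      then have "level_vol f (Suc k) = measure lborel (\<Union>z\<in>D. ?E z k)" by (simp add: level_vol_def)
      also have "\<dots> \<le> (\<Sum>z\<in>D. measure lborel (?E z k))" by (rule measure_UNION_le[OF D fmeasurableD[OF Em]])
      finally have "2 ^ k * level_vol f (Suc k) \<le> 2 ^ k * (\<Sum>z\<in>D. measure lborel (?E z k))" by (intro mult_left_mono) auto
      also have "\<dots> = (\<Sum>z\<in>D. 2 ^ k * measure lborel (?E z k))" by (simp add: sum_distrib_left)
      also have "\<dots> \<le> (\<Sum>z\<in>D. C * level_vol f k powr (1 / DIM('a)) * W z k)"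
      proof (rule sum_mono)
        fix z assume z: "z \<in> D"
        have "Cz z * (level_vol f k powr (1 / DIM('a)) * W z k) \<le> C * (level_vol f k powr (1 / DIM('a)) * W z k)"
          using CzC[OF z] W(1)[OF z] by (intro mult_right_mono) auto
        then show "2 ^ k * measure lborel (?E z k) \<le> C * level_vol f k powr (1 / DIM('a)) * W z k"
          using W(3)[OF z k] by (simp add: mult.assoc)
      qed
      also have "\<dots> = C * level_vol f k powr (1 / DIM('a)) * (\<Sum>z\<in>D. W z k)" by (simp add: sum_distrib_left)
      finally show "2 ^ k * level_vol f (Suc k) \<le> C * level_vol f k powr (1 / DIM('a)) * (\<Sum>z\<in>D. W z k)" .
    qed
  qed
  then show ?thesis using C0 \<delta> \<delta>1 by blast
qed

text \<open>With \<open>x\<^sub>k = 2\<^bsup>kr\<^esup> m\<^sub>k\<close> and \<open>r = p / (p - 1)\<close> the powers of two cancel from the recursion, leaving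
  \<open>x\<^bsub>k+1\<^esub> \<le> L x\<^sub>k\<^bsup>1/p\<^esup> W\<^sub>k\<close>. As \<open>1/p < 1\<close> and \<open>W\<^sub>k \<le> V\<close>, the \<open>x\<^sub>k\<close> stay below a constant \<open>A\<close> with \<open>L V A\<^bsup>1/p\<^esup> \<le> A\<close>;
  inserting this bound and summing the \<open>W\<^sub>k\<close> gives the claim.\<close>

lemma level_sum_bound:
  fixes m W :: "nat \<Rightarrow> real"
  defines "x \<equiv> \<lambda>r k. 2 powr (real k * r) * m k"
  assumes p: "1 < p" and r: "r = p / (p - 1)" and m: "\<And>k. 0 \<le> m k" and W: "\<And>k. 0 \<le> W k" and C: "0 \<le> C"
    and step: "\<And>k. a \<le> k \<Longrightarrow> k < K \<Longrightarrow> 2 ^ k * m (Suc k) \<le> C * m k powr (1 / p) * W k"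
    and sumW: "(\<Sum>k\<in>{a..<K}. W k) \<le> V" and X: "x r a \<le> X" and aK: "a \<le> K"
  shows "(\<Sum>k\<in>{a..K}. x r k) \<le> X + 2 powr r * C * V * max X ((2 powr r * C * V) powr r) powr (1 / p)"
proof -
  define L where "L = 2 powr r * C"
  have L: "0 \<le> L" using C by (simp add: L_def)
  have V: "0 \<le> V" using sumW sum_nonneg[of "{a..<K}" W] W by simp
  have r1: "r - 1 = r / p" and r0: "r > 0" and rp: "1 - 1 / p = 1 / r" using p unfolding r by (auto simp: field_simps)
  have x0: "0 \<le> x r k" for k using m by (simp add: x_def)
  have stepx: "x r (Suc k) \<le> L * x r k powr (1 / p) * W k" if k: "a \<le> k" "k < K" for k
  proof -
    have "x r (Suc k) = 2 powr r * 2 powr (real k * (r - 1)) * (2 powr real k * m (Suc k))"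
      unfolding x_def by (simp add: powr_add[symmetric] mult.assoc[symmetric] algebra_simps)
    also have "\<dots> \<le> 2 powr r * 2 powr (real k * (r - 1)) * (C * m k powr (1 / p) * W k)"
      using step[OF k] by (intro mult_left_mono) (auto simp: powr_realpow)
    also have "\<dots> = L * (2 powr (real k * r) * m k) powr (1 / p) * W k"
      unfolding L_def r1 using m by (simp add: powr_mult powr_powr)
    finally show ?thesis by (simp add: x_def)
  qed
  define A where "A = max X ((L * V) powr r)"
  have A0: "0 \<le> A" by (simp add: A_def le_max_iff_disj)
  \<comment> \<open>This is where \<open>1 / p + 1 / r = 1\<close> enters: \<open>L V \<le> A\<^bsup>1/r\<^esup>\<close>.\<close>
  have LV: "L * V * A powr (1 / p) \<le> A"
  proof -
    have "L * V = ((L * V) powr r) powr (1 / r)" using L V r0 by (simp add: powr_powr)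
    also have "\<dots> \<le> A powr (1 / r)" using r0 by (intro powr_mono2) (auto simp: A_def)
    finally have "L * V * A powr (1 / p) \<le> A powr (1 / r) * A powr (1 / p)" by (intro mult_right_mono) auto
    also have "\<dots> = A powr (1 / r + 1 / p)" by (simp add: powr_add)
    also have "1 / r + 1 / p = 1" using rp by simp
    finally show ?thesis using A0 by simp
  qed
  have WV: "W k \<le> V" if "a \<le> k" "k < K" for k
    using member_le_sum[of k "{a..<K}" W] that W sumW by auto
  have xA: "x r k \<le> A" if "a \<le> k" "k \<le> K" for k
    using that
  proof (induction k rule: dec_induct)
    case base
    then show ?case using X by (simp add: A_def)
  next
    case (step k)
    have "x r (Suc k) \<le> L * x r k powr (1 / p) * W k" using stepx step by simp
    also have "\<dots> \<le> L * A powr (1 / p) * V"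
      using step WV[of k] W[of k] L x0 p by (intro mult_mono powr_mono2) auto
    also have "\<dots> \<le> A" using LV by (simp add: mult_ac)
    finally show ?case .
  qed
  have "(\<Sum>k\<in>{a..K}. x r k) = x r a + (\<Sum>k\<in>{a..<K}. x r (Suc k))"
    using aK by (induction K rule: dec_induct) auto
  also have "\<dots> \<le> X + (\<Sum>k\<in>{a..<K}. L * A powr (1 / p) * W k)"
  proof (intro add_mono sum_mono X)
    fix k assume k: "k \<in> {a..<K}"
    have "x r (Suc k) \<le> L * x r k powr (1 / p) * W k" using stepx k by simp
    also have "\<dots> \<le> L * A powr (1 / p) * W k"
      using xA[of k] k W[of k] L x0 p by (intro mult_right_mono mult_left_mono powr_mono2) auto
    finally show "x r (Suc k) \<le> L * A powr (1 / p) * W k" .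
  qed
  also have "(\<Sum>k\<in>{a..<K}. L * A powr (1 / p) * W k) = L * A powr (1 / p) * (\<Sum>k\<in>{a..<K}. W k)"
    by (simp add: sum_distrib_left)
  also have "\<dots> \<le> L * A powr (1 / p) * V" using sumW L by (intro mult_left_mono) auto
  finally show ?thesis by (simp add: A_def L_def mult_ac)
qed

text \<open>For \<open>p = d\<close> this is the critical exponent \<open>r = d / (d - 1)\<close>. Larger \<open>p\<close> are admitted because \<open>m\<^bsup>1/d\<^esup> \<le> m\<^bsup>1/p\<^esup>\<close> for
  \<open>m \<le> 1\<close>; in dimension one, where \<open>p = d\<close> is excluded, this covers every finite exponent. The recursion starts
  at a level \<open>a\<close> that depends on \<open>M\<close> only, above which Chebyshev's inequality makes the level sets small.\<close>

lemma BV_embeds_Lr: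
  fixes \<Omega> :: "'a::euclidean_space set"
  assumes \<Omega>: "open \<Omega>" "bounded \<Omega>" "lipschitz_boundary \<Omega>" and p: "1 < p" "real DIM('a) \<le> p" and M: "0 \<le> M"
  shows "\<exists>B\<ge>0. \<forall>f. integrable lborel f \<longrightarrow> variation_le \<Omega> f M \<longrightarrow> (\<forall>x. x \<notin> \<Omega> \<longrightarrow> f x = 0) \<longrightarrow>
    (LINT x|lborel. \<bar>f x\<bar>) \<le> M \<longrightarrow> (\<integral>\<^sup>+x. ennreal (\<bar>f x\<bar> powr (p / (p - 1))) \<partial>lborel) \<le> ennreal B"
proof -
  define r where "r = p / (p - 1)"
  have r0: "r > 0" using p by (simp add: r_def)
  obtain C \<delta> where C: "0 \<le> C" and \<delta>: "0 < \<delta>" "\<delta> \<le> 1" and level: "level_decay \<Omega> C \<delta>"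
    using level_estimate[OF \<Omega>] by blast
  obtain a where a: "M / \<delta> < 2 ^ a" using real_arch_pow[of 2 "M / \<delta>"] by auto
  have \<Omega>fin: "emeasure lborel \<Omega> < \<infinity>" using \<Omega>(2) by (rule emeasure_bounded_finite)
  define B where "B = 2 powr (real a * r) * measure lborel \<Omega> +
     2 powr r * (2 powr (real a * r) + 2 powr r * C * (C * M) * max (2 powr (real a * r)) ((2 powr r * C * (C * M)) powr r) powr (1 / p))"
  have B0: "0 \<le> B" unfolding B_def using C M by (intro add_nonneg_nonneg mult_nonneg_nonneg) auto
  show ?thesis
  proof (intro exI[of _ B] conjI B0 allI impI)
    fix f :: "'a \<Rightarrow> real"
    assume f: "integrable lborel f" "variation_le \<Omega> f M" and f0: "\<forall>x. x \<notin> \<Omega> \<longrightarrow> f x = 0"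
      and fM: "(LINT x|lborel. \<bar>f x\<bar>) \<le> M"
    have [measurable]: "f \<in> borel_measurable borel" using f by auto
    have m0: "0 \<le> level_vol f k" for k by (simp add: level_vol_def)
    have small: "level_vol f k \<le> \<delta>" if "a \<le> k" for k
    proof -
      have "level_vol f k \<le> (LINT x|lborel. \<bar>f x\<bar>) / 2 ^ k" unfolding level_vol_def by (rule level_set_Markov(2)[OF f(1)]) simp
      also have "\<dots> \<le> M / 2 ^ k" using fM by (intro divide_right_mono) auto
      also have "\<dots> \<le> M / 2 ^ a" using M that by (intro divide_left_mono power_increasing) auto
      also have "\<dots> \<le> \<delta>" using a \<delta> by (simp add: divide_simps mult.commute)
      finally show ?thesis .
    qed
    have partial: "(\<Sum>k\<in>{a..K}. 2 powr (real k * r) * level_vol f k) \<le> 2 powr (real a * r) +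
        2 powr r * C * (C * M) * max (2 powr (real a * r)) ((2 powr r * C * (C * M)) powr r) powr (1 / p)" if aK: "a \<le> K" for K
    proof -
      have "\<exists>W. (\<forall>k. 0 \<le> W k) \<and> (\<Sum>k\<in>{a..<K}. W k) \<le> C * M \<and>
        (\<forall>k\<in>{a..<K}. 2 ^ k * level_vol f (Suc k) \<le> C * level_vol f k powr (1 / DIM('a)) * W k)"
        by (rule level[unfolded level_decay_def, rule_format]) (use f M f0 small in auto)
      then obtain W where W: "\<forall>k. 0 \<le> W k" "(\<Sum>k\<in>{a..<K}. W k) \<le> C * M"
        "\<forall>k\<in>{a..<K}. 2 ^ k * level_vol f (Suc k) \<le> C * level_vol f k powr (1 / DIM('a)) * W k"
        by blast
      show ?thesis
      proof (rule level_sum_bound[OF p(1) r_def m0 _ C _ W(2) _ aK])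
        fix k show "0 \<le> W k" using W by blast
        assume k: "a \<le> k" "k < K"
        have "level_vol f k powr (1 / DIM('a)) \<le> level_vol f k powr (1 / p)"
        proof (cases "level_vol f k = 0")
          case False
          then show ?thesis using small[OF k(1)] \<delta> m0[of k] p by (intro powr_mono') (auto simp: frac_le)
        qed simp
        then have "C * level_vol f k powr (1 / DIM('a)) * W k \<le> C * level_vol f k powr (1 / p) * W k"
          using C W(1) by (intro mult_right_mono mult_left_mono) auto
        then show "2 ^ k * level_vol f (Suc k) \<le> C * level_vol f k powr (1 / p) * W k" using W(3) k by (auto intro: order_trans)
      next
        show "2 powr (real a * r) * level_vol f a \<le> 2 powr (real a * r)"
          using small[of a] \<delta> by (simp add: mult_left_le)
      qed
    qed
    let ?g = "\<lambda>k x. (if a \<le> k then ennreal (2 powr (real (Suc k) * r)) * indicator {x. 2 ^ k \<le> \<bar>f x\<bar>} x else 0)"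
    have pt: "ennreal (\<bar>f x\<bar> powr r) \<le> ennreal (2 powr (real a * r)) * indicator \<Omega> x + (\<Sum>k. ?g k x)" for x
    proof (cases "\<bar>f x\<bar> < 2 ^ a")
      case True
      show ?thesis
      proof (cases "x \<in> \<Omega>")
        case x: True
        have "\<bar>f x\<bar> powr r \<le> (2 powr real a) powr r" using True r0 by (intro powr_mono2) (auto simp: powr_realpow)
        then have "ennreal (\<bar>f x\<bar> powr r) \<le> ennreal (2 powr (real a * r)) * indicator \<Omega> x"
          using x by (simp add: powr_powr ennreal_leI)
        then show ?thesis by (rule order_trans) simp
      qed (use f0 r0 in simp)
    next
      case False
      obtain n where n: "\<bar>f x\<bar> < 2 ^ n" using real_arch_pow[of 2 "\<bar>f x\<bar>"] by auto
      define n' where "n' = (LEAST n. \<bar>f x\<bar> < 2 ^ n)"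
      define k where "k = n' - 1"
      have n': "\<bar>f x\<bar> < 2 ^ n'" unfolding n'_def using n by (rule LeastI)
      have an': "a < n'"
      proof (rule ccontr)
        assume "\<not> a < n'"
        then have "(2::real) ^ n' \<le> 2 ^ a" by (intro power_increasing) auto
        then show False using n' False by linarith
      qed
      have nk: "n' = Suc k" using an' by (simp add: k_def)
      have "\<not> \<bar>f x\<bar> < 2 ^ k" using not_less_Least[of k "\<lambda>n. \<bar>f x\<bar> < 2 ^ n"] nk n'_def by simp
      then have k: "2 ^ k \<le> \<bar>f x\<bar>" "a \<le> k" using an' nk by auto
      have "\<bar>f x\<bar> powr r \<le> (2 powr real (Suc k)) powr r" using n' nk r0
        by (intro powr_mono2) (auto simp: powr_realpow simp del: of_nat_Suc power_Suc)
      then have "ennreal (\<bar>f x\<bar> powr r) \<le> ?g k x" using k by (simp add: powr_powr ennreal_leI)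
      also have "\<dots> = (\<Sum>k\<in>{k}. ?g k x)" by simp
      also have "\<dots> \<le> (\<Sum>k. ?g k x)" by (intro sum_le_suminf) auto
      finally show ?thesis by (rule order_trans) simp
    qed
    have "(\<integral>\<^sup>+x. ennreal (\<bar>f x\<bar> powr r) \<partial>lborel) \<le>
        (\<integral>\<^sup>+x. ennreal (2 powr (real a * r)) * indicator \<Omega> x + (\<Sum>k. ?g k x) \<partial>lborel)"
      by (rule nn_integral_mono) (rule pt)
    also have "\<dots> = ennreal (2 powr (real a * r)) * emeasure lborel \<Omega> + (\<integral>\<^sup>+x. (\<Sum>k. ?g k x) \<partial>lborel)"
      using \<Omega>(1) by (subst nn_integral_add) (auto simp: nn_integral_cmult_indicator)
    also have "(\<integral>\<^sup>+x. (\<Sum>k. ?g k x) \<partial>lborel) = (\<Sum>k. \<integral>\<^sup>+x. ?g k x \<partial>lborel)"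
      by (rule nn_integral_suminf) auto
    also have "(\<lambda>k. \<integral>\<^sup>+x. ?g k x \<partial>lborel) = (\<lambda>k. ennreal (if a \<le> k then 2 powr r * (2 powr (real k * r) * level_vol f k) else 0))"
    proof
      fix k
      have "emeasure lborel {x. 2 ^ k \<le> \<bar>f x\<bar>} = ennreal (level_vol f k)"
        unfolding level_vol_def using level_set_Markov(1)[OF f(1), of "2 ^ k"] by (intro emeasure_eq_ennreal_measure) auto
      then show "(\<integral>\<^sup>+x. ?g k x \<partial>lborel) = ennreal (if a \<le> k then 2 powr r * (2 powr (real k * r) * level_vol f k) else 0)"
      proof (cases "a \<le> k")
        case True
        have "(\<integral>\<^sup>+x. ?g k x \<partial>lborel) = (\<integral>\<^sup>+x. ennreal (2 powr (real (Suc k) * r)) * indicator {x. 2 ^ k \<le> \<bar>f x\<bar>} x \<partial>lborel)"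
          using True by simp
        also have "\<dots> = ennreal (2 powr (real (Suc k) * r)) * emeasure lborel {x. 2 ^ k \<le> \<bar>f x\<bar>}"
          by (rule nn_integral_cmult_indicator) simp
        also have "\<dots> = ennreal (2 powr (real (Suc k) * r) * level_vol f k)"
          unfolding \<open>emeasure lborel {x. 2 ^ k \<le> \<bar>f x\<bar>} = ennreal (level_vol f k)\<close>
          by (rule ennreal_mult'[symmetric]) simp
        also have "2 powr (real (Suc k) * r) * level_vol f k = 2 powr r * (2 powr (real k * r) * level_vol f k)"
          by (simp add: powr_add[symmetric] mult.assoc[symmetric] distrib_right)
        finally show ?thesis using True by simp
      qed simp
    qed
    also have "(\<Sum>k. ennreal (if a \<le> k then 2 powr r * (2 powr (real k * r) * level_vol f k) else 0)) \<le>
        ennreal (B - 2 powr (real a * r) * measure lborel \<Omega>)"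
      unfolding suminf_eq_SUP
    proof (rule SUP_least)
      fix n
      have "(\<Sum>k<n. ennreal (if a \<le> k then 2 powr r * (2 powr (real k * r) * level_vol f k) else 0)) =
         ennreal (\<Sum>k<n. (if a \<le> k then 2 powr r * (2 powr (real k * r) * level_vol f k) else 0))"
        using m0 by (subst sum_ennreal) auto
      also have "(\<Sum>k<n. (if a \<le> k then 2 powr r * (2 powr (real k * r) * level_vol f k) else 0)) \<le>
          (\<Sum>k\<in>{a..max a n}. 2 powr r * (2 powr (real k * r) * level_vol f k))"
        using m0 by (subst sum.inter_filter[symmetric]) (auto intro!: sum_mono2)
      also have "\<dots> = 2 powr r * (\<Sum>k\<in>{a..max a n}. 2 powr (real k * r) * level_vol f k)" by (simp add: sum_distrib_left)
      also have "\<dots> \<le> B - 2 powr (real a * r) * measure lborel \<Omega>"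
        using partial[of "max a n"] unfolding B_def by simp
      finally show "(\<Sum>k<n. ennreal (if a \<le> k then 2 powr r * (2 powr (real k * r) * level_vol f k) else 0))
          \<le> ennreal (B - 2 powr (real a * r) * measure lborel \<Omega>)" by (simp add: ennreal_leI)
    qed
    also have "ennreal (2 powr (real a * r)) * emeasure lborel \<Omega> = ennreal (2 powr (real a * r) * measure lborel \<Omega>)"
      using \<Omega>fin by (simp add: emeasure_eq_ennreal_measure ennreal_mult')
    also have "ennreal (2 powr (real a * r) * measure lborel \<Omega>) + ennreal (B - 2 powr (real a * r) * measure lborel \<Omega>) = ennreal B"
      using C M unfolding B_def by (subst ennreal_plus[symmetric]) auto
    finally show "(\<integral>\<^sup>+x. ennreal (\<bar>f x\<bar> powr (p / (p - 1))) \<partial>lborel) \<le> ennreal B"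
      by (simp add: r_def add_left_mono)
  qed
qed

section \<open>Compactness of BV in \<open>L\<^sup>1\<close>\<close>

text \<open>A subsequence with summable increments converges almost everywhere, and Fatou's lemma turns the Cauchy
  property into convergence to this limit.\<close>

lemma L1_complete:
  fixes f :: "nat \<Rightarrow> 'a \<Rightarrow> real"
  assumes f: "\<And>n. integrable M (f n)"
    and cauchy: "\<And>\<epsilon>. 0 < \<epsilon> \<Longrightarrow> \<exists>N. \<forall>i\<ge>N. \<forall>j\<ge>N. (LINT x|M. \<bar>f i x - f j x\<bar>) \<le> \<epsilon>"
  shows "\<exists>g. integrable M g \<and> (\<lambda>n. LINT x|M. \<bar>f n x - g x\<bar>) \<longlonglongrightarrow> 0"
proof -
  have [measurable]: "f n \<in> borel_measurable M" for n using f[of n] by auto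
  have int: "integrable M (\<lambda>x. \<bar>f i x - f j x\<bar>)" for i j using f by auto
  have nn: "(\<integral>\<^sup>+x. ennreal \<bar>f i x - f j x\<bar> \<partial>M) = ennreal (LINT x|M. \<bar>f i x - f j x\<bar>)" for i j
    by (rule nn_integral_eq_integral[OF int]) auto
  have "\<forall>k. \<exists>N. \<forall>i\<ge>N. \<forall>j\<ge>N. (LINT x|M. \<bar>f i x - f j x\<bar>) \<le> (1/2) ^ k"
    by (intro allI cauchy) simp
  from choice[OF this] obtain N where N: "\<forall>k. \<forall>i\<ge>N k. \<forall>j\<ge>N k. (LINT x|M. \<bar>f i x - f j x\<bar>) \<le> (1/2) ^ k" ..
  define r where "r k = (\<Sum>i\<le>k. N i) + k" for k
  have rN: "N k \<le> r k" for k using member_le_sum[of k "{..k}" N] by (simp add: r_def)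
  have rmono: "r k \<le> r (Suc k)" for k by (simp add: r_def)
  define h where "h k x = f (r (Suc k)) x - f (r k) x" for k x
  have [measurable]: "h k \<in> borel_measurable M" for k unfolding h_def by measurable
  have hb: "(\<integral>\<^sup>+x. ennreal \<bar>h k x\<bar> \<partial>M) \<le> ennreal ((1/2) ^ k)" for k
    unfolding h_def nn using N rN[of k] rmono[of k] by (intro ennreal_leI) (meson order_trans)
  have "(\<integral>\<^sup>+x. (\<Sum>k. ennreal \<bar>h k x\<bar>) \<partial>M) = (\<Sum>k. \<integral>\<^sup>+x. ennreal \<bar>h k x\<bar> \<partial>M)"
    by (rule nn_integral_suminf) auto
  also have "\<dots> \<le> (\<Sum>k. ennreal ((1/2) ^ k))" by (intro suminf_le hb) auto
  also have "\<dots> = ennreal (\<Sum>k. (1/2) ^ k)" by (rule suminf_ennreal2) (auto intro: summable_geometric)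
  finally have "(\<integral>\<^sup>+x. (\<Sum>k. ennreal \<bar>h k x\<bar>) \<partial>M) < \<infinity>" by (rule le_less_trans) simp
  then have "AE x in M. (\<Sum>k. ennreal \<bar>h k x\<bar>) \<noteq> \<infinity>" by (intro nn_integral_PInf_AE) auto
  then have summ: "AE x in M. summable (\<lambda>k. \<bar>h k x\<bar>)"
    by (rule AE_mp) (auto intro!: AE_I2 summable_suminf_not_top)
  define g where "g x = f (r 0) x + (\<Sum>k. h k x)" for x
  have gm [measurable]: "g \<in> borel_measurable M" unfolding g_def by measurable
  have lim: "AE x in M. (\<lambda>k. f (r k) x) \<longlonglongrightarrow> g x"
    using summ
  proof eventually_elim
    case (elim x)
    then have "summable (\<lambda>k. h k x)" by (rule summable_rabs_cancel)
    then have "(\<lambda>n. \<Sum>k<n. h k x) \<longlonglongrightarrow> (\<Sum>k. h k x)" by (rule summable_LIMSEQ)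
    then have "(\<lambda>n. f (r 0) x + (\<Sum>k<n. h k x)) \<longlonglongrightarrow> g x" unfolding g_def by (intro tendsto_intros)
    moreover have "f (r 0) x + (\<Sum>k<n. h k x) = f (r n) x" for n
      unfolding h_def using sum_lessThan_telescope[of "\<lambda>k. f (r k) x" n] by simp
    ultimately show ?case by simp
  qed
  have bound: "(\<integral>\<^sup>+x. ennreal \<bar>f i x - g x\<bar> \<partial>M) \<le> ennreal \<epsilon>"
    if N0: "\<forall>i\<ge>N0. \<forall>j\<ge>N0. (LINT x|M. \<bar>f i x - f j x\<bar>) \<le> \<epsilon>" and i: "N0 \<le> i" for i N0 \<epsilon>
  proof -
    have "(\<integral>\<^sup>+x. ennreal \<bar>f i x - g x\<bar> \<partial>M) = (\<integral>\<^sup>+x. liminf (\<lambda>k. ennreal \<bar>f i x - f (r k) x\<bar>) \<partial>M)"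
    proof (rule nn_integral_cong_AE)
      show "AE x in M. ennreal \<bar>f i x - g x\<bar> = liminf (\<lambda>k. ennreal \<bar>f i x - f (r k) x\<bar>)"
        using lim
      proof eventually_elim
        case (elim x)
        have "(\<lambda>k. ennreal \<bar>f i x - f (r k) x\<bar>) \<longlonglongrightarrow> ennreal \<bar>f i x - g x\<bar>"
          by (intro tendsto_ennrealI tendsto_intros elim)
        then show ?case by (rule lim_imp_Liminf[OF trivial_limit_sequentially, symmetric])
      qed
    qed
    also have "\<dots> \<le> liminf (\<lambda>k. \<integral>\<^sup>+x. ennreal \<bar>f i x - f (r k) x\<bar> \<partial>M)"
      by (rule nn_integral_liminf) auto
    also have "\<dots> \<le> ennreal \<epsilon>"
    proof (rule Liminf_le)
      show "\<forall>\<^sub>F k in sequentially. (\<integral>\<^sup>+x. ennreal \<bar>f i x - f (r k) x\<bar> \<partial>M) \<le> ennreal \<epsilon>"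
      proof (rule eventually_sequentiallyI[of N0])
        fix k assume "N0 \<le> k"
        then have "N0 \<le> r k" by (simp add: r_def)
        then show "(\<integral>\<^sup>+x. ennreal \<bar>f i x - f (r k) x\<bar> \<partial>M) \<le> ennreal \<epsilon>"
          unfolding nn using N0 i by (intro ennreal_leI) auto
      qed
    qed simp
    finally show ?thesis .
  qed
  have dint: "integrable M (\<lambda>x. f i x - g x)" if N0: "\<forall>i\<ge>N0. \<forall>j\<ge>N0. (LINT x|M. \<bar>f i x - f j x\<bar>) \<le> 1" "N0 \<le> i" for i N0
  proof (rule integrableI_bounded)
    have "(\<integral>\<^sup>+x. ennreal (norm (f i x - g x)) \<partial>M) \<le> ennreal 1" using bound[OF N0] by simp
    also have "\<dots> < \<infinity>" by simp
    finally show "(\<integral>\<^sup>+x. ennreal (norm (f i x - g x)) \<partial>M) < \<infinity>" .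
  qed measurable
  obtain N1 where N1: "\<forall>i\<ge>N1. \<forall>j\<ge>N1. (LINT x|M. \<bar>f i x - f j x\<bar>) \<le> 1" using cauchy[of 1] by auto
  have "integrable M (\<lambda>x. f N1 x - (f N1 x - g x))" by (intro Bochner_Integration.integrable_diff f dint[OF N1]) simp
  then have g: "integrable M g" by simp
  have "(\<lambda>n. LINT x|M. \<bar>f n x - g x\<bar>) \<longlonglongrightarrow> 0"
  proof (rule LIMSEQ_I)
    fix e :: real assume e: "0 < e"
    obtain N0 where N0: "\<forall>i\<ge>N0. \<forall>j\<ge>N0. (LINT x|M. \<bar>f i x - f j x\<bar>) \<le> e / 2" using cauchy[of "e/2"] e by auto
    show "\<exists>no. \<forall>n\<ge>no. norm ((LINT x|M. \<bar>f n x - g x\<bar>) - 0) < e"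
    proof (intro exI[of _ N0] allI impI)
      fix n assume n: "N0 \<le> n"
      have "integrable M (\<lambda>x. \<bar>f n x - g x\<bar>)" using f g by auto
      then have "ennreal (LINT x|M. \<bar>f n x - g x\<bar>) = (\<integral>\<^sup>+x. ennreal \<bar>f n x - g x\<bar> \<partial>M)"
        by (subst nn_integral_eq_integral) auto
      also have "\<dots> \<le> ennreal (e / 2)" by (rule bound[OF N0 n])
      finally have "(LINT x|M. \<bar>f n x - g x\<bar>) \<le> e / 2" using e by (subst (asm) ennreal_le_iff) auto
      moreover have "0 \<le> (LINT x|M. \<bar>f n x - g x\<bar>)" by (intro integral_nonneg_AE) auto
      ultimately show "norm ((LINT x|M. \<bar>f n x - g x\<bar>) - 0) < e" using e by simp
    qed
  qed
  then show ?thesis using g by blast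
qed

text \<open>A kernel supported in \<open>cball a t\<close>. Being Lipschitz, it makes the averages below equi-Lipschitz on bounded
  sets of \<open>L\<^sup>1\<close>.\<close>

definition tent :: "'a::euclidean_space \<Rightarrow> real \<Rightarrow> 'a \<Rightarrow> real" where
  "tent a t h = max 0 (t - norm (h - a))"

lemma tent_bounds: "0 \<le> tent a t h" "0 \<le> t \<Longrightarrow> tent a t h \<le> t" "0 \<le> t \<Longrightarrow> \<bar>tent a t h\<bar> \<le> t"
  by (auto simp: tent_def)

lemma tent_eq_0: "h \<notin> cball a t \<Longrightarrow> tent a t h = 0"
  by (auto simp: tent_def dist_norm norm_minus_commute)

lemma tent_Lipschitz: "\<bar>tent a t h - tent a t h'\<bar> \<le> norm (h - h')"
proof -
  have "\<bar>norm (h - a) - norm (h' - a)\<bar> \<le> norm ((h - a) - (h' - a))" by (rule norm_triangle_ineq3)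
  then show ?thesis unfolding tent_def by (simp add: max_def abs_if split: if_splits)
qed

lemma borel_measurable_tent [measurable]: "tent a t \<in> borel_measurable borel"
  unfolding tent_def by measurable

lemma integrable_tent:
  assumes "0 < t" shows "integrable lborel (tent a t)" "0 < (LINT h|lborel. tent a t h)"
proof -
  show 1: "integrable lborel (tent a t)"
  proof (rule integrableI_bounded_set[where A="cball a t" and B=t])
    show "emeasure lborel (cball a t) < \<infinity>" by (rule emeasure_lborel_cball_finite)
  qed (use assms tent_bounds(3)[of t a] tent_eq_0[of _ a t] in \<open>auto intro!: AE_I2\<close>)
  have "0 < (t / 2) * measure lborel (cball a (t / 2))"
    using assms by (intro mult_pos_pos content_cball_pos) auto
  also have "\<dots> = (LINT h|lborel. (t / 2) * indicator (cball a (t / 2)) h)" by simp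
  also have "\<dots> \<le> (LINT h|lborel. tent a t h)"
  proof (rule integral_mono[OF _ 1])
    show "integrable lborel (\<lambda>h. (t / 2) * indicator (cball a (t / 2)) h)"
      using emeasure_lborel_cball_finite[of a "t / 2"]
      by (intro integrable_mult_right integrable_real_indicator) auto
    show "(t / 2) * indicator (cball a (t / 2)) h \<le> tent a t h" for h
      using assms tent_bounds(1)[of a t h] by (auto simp: indicator_def tent_def dist_norm norm_minus_commute)
  qed
  finally show "0 < (LINT h|lborel. tent a t h)" .
qed

text \<open>The kernel is not normalized; its mass enters the estimates as a factor.\<close>

definition tent_avg :: "'a::euclidean_space \<Rightarrow> real \<Rightarrow> ('a \<Rightarrow> real) \<Rightarrow> 'a \<Rightarrow> real" where
  "tent_avg a t f x = (LINT y|lborel. tent a t (y - x) * f y)"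

lemma integrable_tent_mult:
  fixes f :: "'a::euclidean_space \<Rightarrow> real"
  assumes "integrable lborel f" "0 \<le> t" shows "integrable lborel (\<lambda>y. tent a t (y - x) * f y)"
proof (rule Bochner_Integration.integrable_bound[of _ "\<lambda>y. t * f y"])
  show "AE y in lborel. norm (tent a t (y - x) * f y) \<le> norm (t * f y)"
    using tent_bounds assms(2) by (intro AE_I2) (auto simp: abs_mult intro!: mult_right_mono)
qed (use assms in auto)

lemma tent_avg_bound:
  fixes f :: "'a::euclidean_space \<Rightarrow> real"
  assumes f: "integrable lborel f" "(LINT x|lborel. \<bar>f x\<bar>) \<le> M" and t: "0 \<le> t"
  shows "\<bar>tent_avg a t f x\<bar> \<le> t * M"
proof -
  have "\<bar>tent_avg a t f x\<bar> \<le> (LINT y|lborel. \<bar>tent a t (y - x) * f y\<bar>)"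
    unfolding tent_avg_def by (rule integral_abs_bound)
  also have "\<dots> \<le> (LINT y|lborel. t * \<bar>f y\<bar>)"
    using tent_bounds t f integrable_tent_mult[OF f(1) t]
    by (intro integral_mono integrable_abs) (auto simp: abs_mult intro!: mult_right_mono)
  also have "\<dots> \<le> t * M" using f t by (simp add: mult_left_mono)
  finally show ?thesis .
qed

lemma tent_avg_Lipschitz:
  fixes f :: "'a::euclidean_space \<Rightarrow> real"
  assumes f: "integrable lborel f" "(LINT x|lborel. \<bar>f x\<bar>) \<le> M" and t: "0 \<le> t"
  shows "\<bar>tent_avg a t f x - tent_avg a t f x'\<bar> \<le> norm (x - x') * M"
proof -
  have "tent_avg a t f x - tent_avg a t f x' = (LINT y|lborel. tent a t (y - x) * f y - tent a t (y - x') * f y)"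
    unfolding tent_avg_def using integrable_tent_mult[OF f(1) t] by simp
  also have "\<bar>\<dots>\<bar> \<le> (LINT y|lborel. \<bar>tent a t (y - x) * f y - tent a t (y - x') * f y\<bar>)"
    by (rule integral_abs_bound)
  also have "\<dots> \<le> (LINT y|lborel. norm (x - x') * \<bar>f y\<bar>)"
  proof (rule integral_mono)
    show "integrable lborel (\<lambda>y. \<bar>tent a t (y - x) * f y - tent a t (y - x') * f y\<bar>)"
      using integrable_tent_mult[OF f(1) t] by auto
    show "integrable lborel (\<lambda>y. norm (x - x') * \<bar>f y\<bar>)" using f by auto
    fix y
    have "\<bar>tent a t (y - x) - tent a t (y - x')\<bar> \<le> norm ((y - x) - (y - x'))" by (rule tent_Lipschitz)
    then have "\<bar>tent a t (y - x) - tent a t (y - x')\<bar> \<le> norm (x - x')" by (simp add: norm_minus_commute)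
    from mult_right_mono[OF this, of "\<bar>f y\<bar>"]
    show "\<bar>tent a t (y - x) * f y - tent a t (y - x') * f y\<bar> \<le> norm (x - x') * \<bar>f y\<bar>"
      by (simp add: abs_mult[symmetric] left_diff_distrib)
  qed
  also have "\<dots> \<le> norm (x - x') * M" using f by (simp add: mult_left_mono)
  finally show ?thesis .
qed

text \<open>The kernel with centre \<open>s *\<^sub>R e\<close> and radius \<open>s * c\<close> lives on admissible directions of length at most \<open>2 * s\<close>, so
  this is the average of the translation estimates over the kernel.\<close>

lemma tent_avg_approx:
  fixes f :: "'a::euclidean_space \<Rightarrow> real"
  assumes \<Omega>: "open \<Omega>" and cone: "cone_at \<Omega> z R e c \<rho>" and f: "integrable lborel f" "variation_le \<Omega> f V"
    and V: "0 \<le> V" and s: "0 < s" "s \<le> \<rho>"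
  defines "\<kappa> \<equiv> (LINT h|lborel. tent (s *\<^sub>R e) (s * c) h)"
  shows "(\<integral>\<^sup>+x. ennreal (indicator (\<Omega> \<inter> ball z R) x * \<bar>\<kappa> * f x - tent_avg (s *\<^sub>R e) (s * c) f x\<bar>) \<partial>lborel) \<le> ennreal (\<kappa> * (2 * s * V))"
proof -
  let ?w = "tent (s *\<^sub>R e) (s * c)" and ?U = "\<Omega> \<inter> ball z R"
  have c: "0 < c" using cone by (simp add: cone_at_def)
  have sc: "0 < s * c" using c s by simp
  have [measurable]: "f \<in> borel_measurable borel" "?U \<in> sets borel" using f \<Omega> by auto
  note wi = integrable_tent[OF sc, of "s *\<^sub>R e"]
  have avg: "tent_avg (s *\<^sub>R e) (s * c) f x = (LINT h|lborel. ?w h * f (x + h))" for x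
    unfolding tent_avg_def
    using lborel_integral_shift[of "\<lambda>y. ?w (y - x) * f y" x] by (simp add: add.commute)
  have wf: "integrable lborel (\<lambda>h. ?w h * f (x + h))" for x
    using lborel_integrable_shift[OF integrable_tent_mult[OF f(1) less_imp_le[OF sc], of "s *\<^sub>R e" x], of x] by (simp add: add.commute)
  have pt: "ennreal (indicator ?U x * \<bar>\<kappa> * f x - tent_avg (s *\<^sub>R e) (s * c) f x\<bar>) \<le>
    (\<integral>\<^sup>+h. ennreal (?w h) * ennreal (indicator ?U x * \<bar>f (x + h) - f x\<bar>) \<partial>lborel)" for x
  proof (cases "x \<in> ?U")
    case True
    have "\<kappa> * f x - tent_avg (s *\<^sub>R e) (s * c) f x = (LINT h|lborel. ?w h * f x - ?w h * f (x + h))"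
      unfolding avg \<kappa>_def using wi wf by simp
    also have "\<bar>\<dots>\<bar> \<le> (LINT h|lborel. \<bar>?w h * f x - ?w h * f (x + h)\<bar>)" by (rule integral_abs_bound)
    finally have "ennreal \<bar>\<kappa> * f x - tent_avg (s *\<^sub>R e) (s * c) f x\<bar> \<le> ennreal (LINT h|lborel. \<bar>?w h * f x - ?w h * f (x + h)\<bar>)"
      by (rule ennreal_leI)
    also have "\<dots> = (\<integral>\<^sup>+h. ennreal \<bar>?w h * f x - ?w h * f (x + h)\<bar> \<partial>lborel)"
      by (rule nn_integral_eq_integral[symmetric]) (use wi wf in auto)
    also have "\<dots> = (\<integral>\<^sup>+h. ennreal (?w h) * ennreal (indicator ?U x * \<bar>f (x + h) - f x\<bar>) \<partial>lborel)"
    proof (rule nn_integral_cong)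
      fix h
      have "\<bar>?w h * f x - ?w h * f (x + h)\<bar> = ?w h * \<bar>f (x + h) - f x\<bar>"
        using tent_bounds(1)[of "s *\<^sub>R e" "s * c" h]
        by (simp add: right_diff_distrib[symmetric] abs_mult abs_minus_commute)
      then show "ennreal \<bar>?w h * f x - ?w h * f (x + h)\<bar> = ennreal (?w h) * ennreal (indicator ?U x * \<bar>f (x + h) - f x\<bar>)"
        using True tent_bounds(1)[of "s *\<^sub>R e" "s * c" h] by (simp add: ennreal_mult')
    qed
    finally show ?thesis using True by simp
  qed simp
  have "(\<integral>\<^sup>+x. ennreal (indicator ?U x * \<bar>\<kappa> * f x - tent_avg (s *\<^sub>R e) (s * c) f x\<bar>) \<partial>lborel) \<le>
    (\<integral>\<^sup>+x. \<integral>\<^sup>+h. ennreal (?w h) * ennreal (indicator ?U x * \<bar>f (x + h) - f x\<bar>) \<partial>lborel \<partial>lborel)"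
    by (rule nn_integral_mono) (rule pt)
  also have "\<dots> = (\<integral>\<^sup>+h. \<integral>\<^sup>+x. ennreal (?w h) * ennreal (indicator ?U x * \<bar>f (x + h) - f x\<bar>) \<partial>lborel \<partial>lborel)"
  proof (rule lborel_pair.Fubini'[symmetric])
    have "(\<lambda>(x, h). ennreal (?w h) * ennreal (indicator ?U x * \<bar>f (x + h) - f x\<bar>)) \<in> borel_measurable (borel \<Otimes>\<^sub>M borel)"
      by measurable
    then show "(\<lambda>(x, h). ennreal (?w h) * ennreal (indicator ?U x * \<bar>f (x + h) - f x\<bar>)) \<in> borel_measurable (lborel \<Otimes>\<^sub>M lborel)"
      by (simp cong: measurable_cong_sets)
  qed
  also have "\<dots> = (\<integral>\<^sup>+h. ennreal (?w h) * transl_diff ?U h f \<partial>lborel)"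
    unfolding transl_diff_def by (intro nn_integral_cong nn_integral_cmult) auto
  also have "\<dots> \<le> (\<integral>\<^sup>+h. ennreal (2 * s * V) * ennreal (?w h) \<partial>lborel)"
  proof (rule nn_integral_mono)
    fix h
    show "ennreal (?w h) * transl_diff ?U h f \<le> ennreal (2 * s * V) * ennreal (?w h)"
    proof (cases "h \<in> cball (s *\<^sub>R e) (s * c)")
      case True
      define b where "b = h /\<^sub>R s"
      have hb: "h = s *\<^sub>R b" using s by (simp add: b_def)
      have "dist (s *\<^sub>R e) (s *\<^sub>R b) = s * dist e b" using s by (simp add: dist_norm scaleR_diff_right[symmetric])
      then have "b \<in> cball e c" using True s unfolding hb by simp
      then have "transl_diff ?U h f \<le> ennreal (2 * s * V)"
        unfolding hb using s by (intro transl_diff_cone[OF \<Omega> cone f V]) auto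
      then show ?thesis by (subst mult.commute) (rule mult_right_mono, simp_all)
    qed (simp add: tent_eq_0)
  qed
  also have "\<dots> = ennreal (2 * s * V) * (\<integral>\<^sup>+h. ennreal (?w h) \<partial>lborel)" by (rule nn_integral_cmult) auto
  also have "(\<integral>\<^sup>+h. ennreal (?w h) \<partial>lborel) = ennreal \<kappa>"
    unfolding \<kappa>_def by (rule nn_integral_eq_integral[OF wi(1)]) (simp add: tent_bounds)
  also have "ennreal (2 * s * V) * ennreal \<kappa> = ennreal (\<kappa> * (2 * s * V))"
    using s V by (subst ennreal_mult'[symmetric]) (auto simp: mult.commute)
  finally show ?thesis .
qed

text \<open>Normalized representatives of a bounded set in BV: Borel functions that vanish outside \<open>\<Omega>\<close>.\<close>

definition BV_family :: "'a::euclidean_space set \<Rightarrow> real \<Rightarrow> ('a \<Rightarrow> real) set" where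
  "BV_family \<Omega> M = {f. integrable lborel f \<and> variation_le \<Omega> f M \<and> (\<forall>x. x \<notin> \<Omega> \<longrightarrow> f x = 0) \<and>
     (LINT x|lborel. \<bar>f x\<bar>) \<le> M}"

definition L1_Cauchy_on :: "'a::euclidean_space set \<Rightarrow> (nat \<Rightarrow> 'a \<Rightarrow> real) \<Rightarrow> bool" where
  "L1_Cauchy_on U f \<longleftrightarrow> (\<forall>\<epsilon>>0. \<exists>N. \<forall>i\<ge>N. \<forall>j\<ge>N. (LINT x|lborel. indicator U x * \<bar>f i x - f j x\<bar>) \<le> \<epsilon>)"

lemma integrable_indicator_abs_diff:
  fixes f g :: "'a::euclidean_space \<Rightarrow> real"
  assumes "integrable lborel f" "integrable lborel g" "U \<in> sets borel"
  shows "integrable lborel (\<lambda>x. indicator U x * \<bar>f x - g x\<bar>)"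
  using integrable_mult_indicator[of U lborel "\<lambda>x. \<bar>f x - g x\<bar>"] assms by auto

lemma L1_Cauchy_on_subseq:
  assumes "L1_Cauchy_on U f" "strict_mono k" shows "L1_Cauchy_on U (f \<circ> k)"
  unfolding L1_Cauchy_on_def
proof (intro allI impI)
  fix \<epsilon> :: real assume "0 < \<epsilon>"
  then obtain N where N: "\<forall>i\<ge>N. \<forall>j\<ge>N. (LINT x|lborel. indicator U x * \<bar>f i x - f j x\<bar>) \<le> \<epsilon>"
    using assms(1) unfolding L1_Cauchy_on_def by blast
  show "\<exists>N. \<forall>i\<ge>N. \<forall>j\<ge>N. (LINT x|lborel. indicator U x * \<bar>(f \<circ> k) i x - (f \<circ> k) j x\<bar>) \<le> \<epsilon>"
  proof (intro exI[of _ N] allI impI)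
    fix i j assume "N \<le> i" "N \<le> j"
    then have "N \<le> k i" "N \<le> k j" using seq_suble[OF assms(2)] order_trans by blast+
    then show "(LINT x|lborel. indicator U x * \<bar>(f \<circ> k) i x - (f \<circ> k) j x\<bar>) \<le> \<epsilon>" using N by simp
  qed
qed

lemma convergent_if_equi_Lipschitz:
  fixes F :: "nat \<Rightarrow> 'a::metric_space \<Rightarrow> real"
  assumes lip: "\<And>n x y. \<bar>F n x - F n y\<bar> \<le> dist x y * M"
    and dense: "\<And>U. open U \<Longrightarrow> U \<noteq> {} \<Longrightarrow> \<exists>y\<in>S. y \<in> U"
    and conv: "\<And>y. y \<in> S \<Longrightarrow> convergent (\<lambda>n. F n y)"
  shows "convergent (\<lambda>n. F n x)"
proof -
  have "Cauchy (\<lambda>n. F n x)"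
  proof (rule metric_CauchyI)
    fix \<epsilon> :: real assume e: "0 < \<epsilon>"
    define \<delta> where "\<delta> = \<epsilon> / (3 * (\<bar>M\<bar> + 1))"
    have \<delta>: "0 < \<delta>" "\<delta> * \<bar>M\<bar> < \<epsilon> / 3" using e by (auto simp: \<delta>_def divide_simps mult_strict_left_mono)
    obtain y where y: "y \<in> S" "y \<in> ball x \<delta>" using dense[of "ball x \<delta>"] \<delta> by auto
    have close: "\<bar>F n x - F n y\<bar> < \<epsilon> / 3" for n
    proof -
      have "\<bar>F n x - F n y\<bar> \<le> dist x y * M" by (rule lip)
      also have "\<dots> \<le> dist x y * \<bar>M\<bar>" by (intro mult_left_mono) auto
      also have "\<dots> \<le> \<delta> * \<bar>M\<bar>" using y by (intro mult_right_mono) auto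
      finally show ?thesis using \<delta> by linarith
    qed
    have "Cauchy (\<lambda>n. F n y)" using conv[OF y(1)] by (rule convergent_Cauchy)
    then obtain N where N: "\<And>m n. m \<ge> N \<Longrightarrow> n \<ge> N \<Longrightarrow> dist (F m y) (F n y) < \<epsilon> / 3"
      using metric_CauchyD[of "\<lambda>n. F n y" "\<epsilon> / 3"] e by auto
    show "\<exists>N. \<forall>m\<ge>N. \<forall>n\<ge>N. dist (F m x) (F n x) < \<epsilon>"
    proof (intro exI[of _ N] allI impI)
      fix m n assume "N \<le> m" "N \<le> n"
      then have "\<bar>F m y - F n y\<bar> < \<epsilon> / 3" using N by (simp add: dist_real_def)
      then show "dist (F m x) (F n x) < \<epsilon>" using close[of m] close[of n] unfolding dist_real_def by linarith
    qed
  qed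
  then show ?thesis by (simp add: real_Cauchy_convergent)
qed

lemma L1_Cauchy_on_bounded_pointwise:
  fixes F :: "nat \<Rightarrow> 'a::euclidean_space \<Rightarrow> real"
  assumes [measurable]: "\<And>n. F n \<in> borel_measurable borel" and U: "U \<in> sets borel" "bounded U"
    and bd: "\<And>n x. \<bar>F n x\<bar> \<le> B" and conv: "\<And>x. convergent (\<lambda>n. F n x)"
  shows "L1_Cauchy_on U F"
proof -
  have [measurable]: "U \<in> sets borel" by (rule U)
  define g where "g x = lim (\<lambda>n. F n x)" for x
  have lim: "(\<lambda>n. F n x) \<longlonglongrightarrow> g x" for x using conv unfolding g_def by (simp add: convergent_LIMSEQ_iff)
  have [measurable]: "g \<in> borel_measurable borel"
    by (rule borel_measurable_LIMSEQ_real[OF lim]) measurable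
  have gb: "\<bar>g x\<bar> \<le> B" for x
    using lim bd by (intro LIMSEQ_le_const2[of "\<lambda>n. \<bar>F n x\<bar>"]) (auto intro: tendsto_rabs)
  have Ufin: "emeasure lborel U < \<infinity>" using U(2) by (rule emeasure_bounded_finite)
  have wi: "integrable lborel (\<lambda>x. indicator U x * (2 * B))"
    using Ufin U by (intro integrable_mult_left integrable_real_indicator) auto
  have "(\<lambda>n. LINT x|lborel. indicator U x * \<bar>F n x - g x\<bar>) \<longlonglongrightarrow> (LINT x|(lborel::'a measure). 0)"
  proof (rule integral_dominated_convergence[OF _ _ wi])
    show "AE x in lborel. (\<lambda>n. indicator U x * \<bar>F n x - g x\<bar>) \<longlonglongrightarrow> 0"
    proof (intro AE_I2)
      fix x
      have "(\<lambda>n. indicator U x * \<bar>F n x - g x\<bar>) \<longlonglongrightarrow> indicator U x * \<bar>g x - g x\<bar>"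
        by (intro tendsto_intros lim)
      then show "(\<lambda>n. indicator U x * \<bar>F n x - g x\<bar>) \<longlonglongrightarrow> 0" by simp
    qed
    fix n
    show "AE x in lborel. norm (indicator U x * \<bar>F n x - g x\<bar>) \<le> indicator U x * (2 * B)"
    proof (intro AE_I2)
      fix x show "norm (indicator U x * \<bar>F n x - g x\<bar>) \<le> indicator U x * (2 * B)"
        using bd[of n x] gb[of x] by (auto simp: indicator_def)
    qed
  qed auto
  then have L: "(\<lambda>n. LINT x|lborel. indicator U x * \<bar>F n x - g x\<bar>) \<longlonglongrightarrow> 0" by simp
  have int: "integrable lborel (\<lambda>x. indicator U x * \<bar>G x - H x\<bar>)"
    if [measurable]: "G \<in> borel_measurable borel" "H \<in> borel_measurable borel" and "\<And>x. \<bar>G x\<bar> \<le> B" "\<And>x. \<bar>H x\<bar> \<le> B" for G H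
  proof (rule Bochner_Integration.integrable_bound[OF wi])
    show "AE x in lborel. norm (indicator U x * \<bar>G x - H x\<bar>) \<le> norm (indicator U x * (2 * B))"
    proof (intro AE_I2)
      fix x show "norm (indicator U x * \<bar>G x - H x\<bar>) \<le> norm (indicator U x * (2 * B))"
        using that(3,4)[of x] by (auto simp: indicator_def)
    qed
  qed measurable
  show ?thesis
    unfolding L1_Cauchy_on_def
  proof (intro allI impI)
    fix \<epsilon> :: real assume "0 < \<epsilon>"
    then obtain N where N: "\<And>n. n \<ge> N \<Longrightarrow> norm ((LINT x|lborel. indicator U x * \<bar>F n x - g x\<bar>) - 0) < \<epsilon> / 2"
      using LIMSEQ_D[OF L, of "\<epsilon> / 2"] by auto
    show "\<exists>N. \<forall>i\<ge>N. \<forall>j\<ge>N. (LINT x|lborel. indicator U x * \<bar>F i x - F j x\<bar>) \<le> \<epsilon>"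
    proof (intro exI[of _ N] allI impI)
      fix i j assume ij: "N \<le> i" "N \<le> j"
      have "(LINT x|lborel. indicator U x * \<bar>F i x - F j x\<bar>) \<le>
        (LINT x|lborel. indicator U x * \<bar>F i x - g x\<bar> + indicator U x * \<bar>F j x - g x\<bar>)"
        using bd gb by (intro integral_mono Bochner_Integration.integrable_add int) (auto simp: indicator_def)
      also have "\<dots> = (LINT x|lborel. indicator U x * \<bar>F i x - g x\<bar>) + (LINT x|lborel. indicator U x * \<bar>F j x - g x\<bar>)"
        using bd gb by (intro Bochner_Integration.integral_add int) auto
      also have "\<dots> \<le> \<epsilon>" using N[OF ij(1)] N[OF ij(2)] by simp
      finally show "(LINT x|lborel. indicator U x * \<bar>F i x - F j x\<bar>) \<le> \<epsilon>" .
    qed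
  qed
qed

text \<open>For the scales \<open>s\<^sub>l = \<rho> / (l + 1)\<close> a diagonal argument over a countable dense set selects a subsequence
  along which the averages converge at every dense point and every scale, hence everywhere and in \<open>L\<^sup>1\<close>.
  The averages at scale \<open>s\<^sub>l\<close> differ from the functions by \<open>O(s\<^sub>l)\<close> in \<open>L\<^sup>1\<close>.\<close>

lemma BV_local_compact:
  fixes \<Omega> :: "'a::euclidean_space set"
  assumes \<Omega>: "open \<Omega>" "bounded \<Omega>" and cone: "cone_at \<Omega> z R e c \<rho>" and M: "0 \<le> M"
    and f: "\<And>n. f n \<in> BV_family \<Omega> M"
  shows "\<exists>k. strict_mono (k::nat \<Rightarrow> nat) \<and> L1_Cauchy_on (\<Omega> \<inter> ball z R) (f \<circ> k)"
proof -
  let ?U = "\<Omega> \<inter> ball z R"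
  have c: "0 < c" "c \<le> 1" "0 < \<rho>" using cone by (auto simp: cone_at_def)
  have fi: "integrable lborel (f n)" "variation_le \<Omega> (f n) M" "(LINT x|lborel. \<bar>f n x\<bar>) \<le> M" for n
    using f[of n] by (auto simp: BV_family_def)
  have [measurable]: "?U \<in> sets borel" using \<Omega> by auto
  define s where "s l = \<rho> / real (Suc l)" for l
  have s: "0 < s l" "s l \<le> \<rho>" for l using c by (auto simp: s_def divide_simps)
  define A where "A l n = tent_avg (s l *\<^sub>R e) (s l * c) (f n)" for l n
  have t0: "0 \<le> s l * c" for l using s[of l] c by simp
  have A_bound: "\<bar>A l n x\<bar> \<le> \<rho> * M" for l n x
  proof -
    have "\<bar>A l n x\<bar> \<le> (s l * c) * M" unfolding A_def by (rule tent_avg_bound[OF fi(1,3) t0])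
    also have "\<dots> \<le> (\<rho> * 1) * M" using s[of l] c M by (intro mult_right_mono mult_mono) auto
    finally show ?thesis by simp
  qed
  have A_lip: "\<bar>A l n x - A l n y\<bar> \<le> dist x y * M" for l n x y
    unfolding A_def dist_norm by (rule tent_avg_Lipschitz[OF fi(1,3) t0])
  have A_meas: "A l n \<in> borel_measurable borel" for l n
  proof (rule borel_measurable_continuous_onI)
    have "M-lipschitz_on UNIV (A l n)"
      by (rule lipschitz_onI) (use A_lip M in \<open>auto simp: dist_real_def mult.commute\<close>)
    then show "continuous_on UNIV (A l n)" by (rule lipschitz_on_continuous_on)
  qed
  obtain S :: "'a set" where S: "countable S" "\<forall>U. open U \<longrightarrow> U \<noteq> {} \<longrightarrow> (\<exists>y\<in>S. y \<in> U)"
    using countable_dense_exists[where 'a='a] by blast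
  obtain k :: "nat \<Rightarrow> nat" where k: "strict_mono k"
    and conv: "\<And>p. p \<in> (UNIV :: nat set) \<times> S \<Longrightarrow> \<exists>L. (\<lambda>n. (case p of (l, x) \<Rightarrow> A l (k n) x)) \<longlonglongrightarrow> L"
  proof (rule function_convergent_subsequence[of "(UNIV :: nat set) \<times> S" "\<lambda>n p. (case p of (l, x) \<Rightarrow> A l n x)" "\<rho> * M"])
    show "countable ((UNIV :: nat set) \<times> S)" using S by auto
  qed (use A_bound in \<open>auto\<close>)
  have AC: "L1_Cauchy_on ?U (\<lambda>n. A l (k n))" for l
  proof (rule L1_Cauchy_on_bounded_pointwise)
    show "convergent (\<lambda>n. A l (k n) x)" for x
    proof (rule convergent_if_equi_Lipschitz[OF A_lip S(2)[rule_format]])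
      fix y assume "y \<in> S"
      then show "convergent (\<lambda>n. A l (k n) y)" using conv[of "(l, y)"] unfolding convergent_def by simp
    qed
    show "bounded ?U" using \<Omega>(2) by (rule bounded_subset) auto
  qed (use A_meas A_bound in auto)
  have "L1_Cauchy_on ?U (f \<circ> k)"
    unfolding L1_Cauchy_on_def
  proof (intro allI impI)
    fix \<epsilon> :: real assume \<epsilon>: "0 < \<epsilon>"
    obtain l where l: "8 * \<rho> * M / \<epsilon> < real l" using reals_Archimedean2 by blast
    have sl: "4 * s l * M \<le> \<epsilon> / 2"
    proof -
      have "8 * \<rho> * M < real l * \<epsilon>" using l \<epsilon> by (simp add: divide_simps)
      also have "\<dots> \<le> real (Suc l) * \<epsilon>" using \<epsilon> by (intro mult_right_mono) auto
      finally have "8 * \<rho> * M < real (Suc l) * \<epsilon>" .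
      then show ?thesis unfolding s_def by (simp add: divide_simps mult_ac)
    qed
    define \<kappa> where "\<kappa> = (LINT h|lborel. tent (s l *\<^sub>R e) (s l * c) h)"
    have \<kappa>: "0 < \<kappa>" unfolding \<kappa>_def using s[of l] c by (intro integrable_tent) simp
    obtain N where N: "\<And>i j. i \<ge> N \<Longrightarrow> j \<ge> N \<Longrightarrow>
        (LINT x|lborel. indicator ?U x * \<bar>A l (k i) x - A l (k j) x\<bar>) \<le> \<kappa> * (\<epsilon> / 2)"
    proof -
      have "0 < \<kappa> * (\<epsilon> / 2)" using \<kappa> \<epsilon> by simp
      then have "\<exists>N. \<forall>i\<ge>N. \<forall>j\<ge>N. (LINT x|lborel. indicator ?U x * \<bar>A l (k i) x - A l (k j) x\<bar>) \<le> \<kappa> * (\<epsilon> / 2)"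
        by (rule AC[of l, unfolded L1_Cauchy_on_def, THEN spec, THEN mp])
      then show ?thesis using that by auto
    qed
    let ?D = "\<lambda>n x. indicator ?U x * \<bar>\<kappa> * f n x - A l n x\<bar>"
    have Ufin: "emeasure lborel ?U < \<infinity>" by (rule emeasure_bounded_finite, rule bounded_subset[OF \<Omega>(2)]) auto
    have Ai: "integrable lborel (\<lambda>x. indicator ?U x * A l n x)" for n
    proof (rule integrableI_bounded_set[where A="?U" and B="\<rho> * M"])
      show "(\<lambda>x. indicator ?U x * A l n x) \<in> borel_measurable lborel" using A_meas by simp
      show "AE x \<in> ?U in lborel. norm (indicator ?U x * A l n x) \<le> \<rho> * M" using A_bound by auto
    qed (use Ufin in auto)
    have fin: "integrable lborel (\<lambda>x. indicator ?U x * f n x)" for n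
      using integrable_mult_indicator[of ?U lborel "f n"] fi by simp
    have Di: "integrable lborel (?D n)" for n
    proof -
      have "integrable lborel (\<lambda>x. \<bar>\<kappa> * (indicator ?U x * f n x) - indicator ?U x * A l n x\<bar>)"
        using Ai fin by auto
      also have "(\<lambda>x. \<bar>\<kappa> * (indicator ?U x * f n x) - indicator ?U x * A l n x\<bar>) = ?D n"
        by (auto simp: indicator_def)
      finally show ?thesis .
    qed
    have AAi: "integrable lborel (\<lambda>x. indicator ?U x * \<bar>A l m x - A l n x\<bar>)" for m n
    proof -
      have "integrable lborel (\<lambda>x. \<bar>indicator ?U x * A l m x - indicator ?U x * A l n x\<bar>)"
        using Ai by auto
      also have "(\<lambda>x. \<bar>indicator ?U x * A l m x - indicator ?U x * A l n x\<bar>) = (\<lambda>x. indicator ?U x * \<bar>A l m x - A l n x\<bar>)"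
        by (auto simp: indicator_def)
      finally show ?thesis .
    qed
    have D: "(LINT x|lborel. ?D n x) \<le> \<kappa> * (2 * s l * M)" for n
    proof -
      have "ennreal (LINT x|lborel. ?D n x) = (\<integral>\<^sup>+x. ennreal (?D n x) \<partial>lborel)"
        by (rule nn_integral_eq_integral[symmetric, OF Di]) simp
      also have "\<dots> \<le> ennreal (\<kappa> * (2 * s l * M))"
        unfolding \<kappa>_def A_def using tent_avg_approx[OF \<Omega>(1) cone fi(1,2) M s] .
      finally show ?thesis using \<kappa> s[of l] M by (subst (asm) ennreal_le_iff) auto
    qed
    show "\<exists>N. \<forall>i\<ge>N. \<forall>j\<ge>N. (LINT x|lborel. indicator ?U x * \<bar>(f \<circ> k) i x - (f \<circ> k) j x\<bar>) \<le> \<epsilon>"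
    proof (intro exI[of _ N] allI impI)
      fix i j assume ij: "N \<le> i" "N \<le> j"
      have "\<kappa> * (LINT x|lborel. indicator ?U x * \<bar>f (k i) x - f (k j) x\<bar>) =
         (LINT x|lborel. \<kappa> * (indicator ?U x * \<bar>f (k i) x - f (k j) x\<bar>))" by simp
      also have "\<dots> \<le> (LINT x|lborel. ?D (k i) x + indicator ?U x * \<bar>A l (k i) x - A l (k j) x\<bar> + ?D (k j) x)"
      proof (rule integral_mono)
        show "integrable lborel (\<lambda>x. \<kappa> * (indicator ?U x * \<bar>f (k i) x - f (k j) x\<bar>))"
          by (intro integrable_mult_right integrable_indicator_abs_diff fi) simp
        show "integrable lborel (\<lambda>x. ?D (k i) x + indicator ?U x * \<bar>A l (k i) x - A l (k j) x\<bar> + ?D (k j) x)"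
          by (intro Bochner_Integration.integrable_add Di AAi)
        fix x
        have "\<kappa> * \<bar>f (k i) x - f (k j) x\<bar> = \<bar>\<kappa> * f (k i) x - \<kappa> * f (k j) x\<bar>"
          using \<kappa> by (simp add: right_diff_distrib[symmetric] abs_mult)
        then show "\<kappa> * (indicator ?U x * \<bar>f (k i) x - f (k j) x\<bar>) \<le>
            ?D (k i) x + indicator ?U x * \<bar>A l (k i) x - A l (k j) x\<bar> + ?D (k j) x"
          by (cases "x \<in> ?U") auto
      qed
      also have "\<dots> = (LINT x|lborel. ?D (k i) x) + (LINT x|lborel. indicator ?U x * \<bar>A l (k i) x - A l (k j) x\<bar>) + (LINT x|lborel. ?D (k j) x)"
        by (simp add: Di AAi)
      also have "\<dots> \<le> \<kappa> * (2 * s l * M) + \<kappa> * (\<epsilon> / 2) + \<kappa> * (2 * s l * M)"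
        by (intro add_mono D N ij)
      also have "\<dots> = \<kappa> * (4 * s l * M + \<epsilon> / 2)" by (simp add: algebra_simps)
      also have "\<dots> \<le> \<kappa> * \<epsilon>" using sl \<kappa> by (intro mult_left_mono) auto
      finally have "(LINT x|lborel. indicator ?U x * \<bar>f (k i) x - f (k j) x\<bar>) \<le> \<epsilon>"
        by (rule mult_left_le_imp_le) (use \<kappa> in simp)
      then show "(LINT x|lborel. indicator ?U x * \<bar>(f \<circ> k) i x - (f \<circ> k) j x\<bar>) \<le> \<epsilon>" by simp
    qed
  qed
  then show ?thesis using k by blast
qed

lemma BV_compact_pieces:
  fixes \<Omega> :: "'a::euclidean_space set"
  assumes \<Omega>: "open \<Omega>" "bounded \<Omega>" and M: "0 \<le> M"
    and D: "finite D" "\<And>z. z \<in> D \<Longrightarrow> cone_at \<Omega> z (R z) (e z) (c z) (\<rho> z)"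
    and f: "\<And>n. f n \<in> BV_family \<Omega> M"
  shows "\<exists>k. strict_mono (k::nat \<Rightarrow> nat) \<and> (\<forall>z\<in>D. L1_Cauchy_on (\<Omega> \<inter> ball z (R z)) (f \<circ> k))"
  using D
proof (induction D rule: finite_induct)
  case empty
  then show ?case using strict_mono_id by blast
next
  case (insert z D)
  have "\<exists>k. strict_mono (k::nat \<Rightarrow> nat) \<and> (\<forall>z\<in>D. L1_Cauchy_on (\<Omega> \<inter> ball z (R z)) (f \<circ> k))"
    by (rule insert.IH) (use insert.prems in auto)
  then obtain k :: "nat \<Rightarrow> nat" where k: "strict_mono k" "\<forall>z\<in>D. L1_Cauchy_on (\<Omega> \<inter> ball z (R z)) (f \<circ> k)" by blast
  obtain k' :: "nat \<Rightarrow> nat" where k': "strict_mono k'" "L1_Cauchy_on (\<Omega> \<inter> ball z (R z)) ((f \<circ> k) \<circ> k')"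
    using BV_local_compact[OF \<Omega> insert.prems[of z] M, of "f \<circ> k"] f by auto
  have "L1_Cauchy_on (\<Omega> \<inter> ball y (R y)) (f \<circ> (k \<circ> k'))" if "y \<in> insert z D" for y
    using that k'(2) L1_Cauchy_on_subseq[OF _ k'(1), of "\<Omega> \<inter> ball y (R y)" "f \<circ> k"] k(2) by (auto simp: o_assoc)
  then show ?case using strict_mono_o[OF k(1) k'(1)] by blast
qed

theorem BV_compact_L1:
  fixes \<Omega> :: "'a::euclidean_space set"
  assumes \<Omega>: "open \<Omega>" "bounded \<Omega>" "lipschitz_boundary \<Omega>" and M: "0 \<le> M"
    and f: "\<And>n. f n \<in> BV_family \<Omega> M"
  shows "\<exists>k g. strict_mono (k::nat \<Rightarrow> nat) \<and> integrable lborel g \<and> (\<lambda>n. LINT x|lborel. \<bar>f (k n) x - g x\<bar>) \<longlonglongrightarrow> 0"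
proof -
  obtain D R e c \<rho> where D: "finite D" and cone: "\<forall>z\<in>D. cone_at \<Omega> z (R z) (e z) (c z) (\<rho> z)"
    and cov: "\<Omega> \<subseteq> (\<Union>z\<in>D. ball z (R z / 2))"
    using finite_cone_cover[OF \<Omega>] by (elim exE conjE) (rule that)
  obtain k :: "nat \<Rightarrow> nat" where k: "strict_mono k" "\<forall>z\<in>D. L1_Cauchy_on (\<Omega> \<inter> ball z (R z)) (f \<circ> k)"
  proof -
    have "\<exists>k. strict_mono (k::nat \<Rightarrow> nat) \<and> (\<forall>z\<in>D. L1_Cauchy_on (\<Omega> \<inter> ball z (R z)) (f \<circ> k))"
      by (rule BV_compact_pieces[OF \<Omega>(1,2) M D bspec[OF cone]]) (use f in auto)
    then show ?thesis using that by blast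
  qed
  have fi: "integrable lborel (f n)" and f0: "x \<notin> \<Omega> \<Longrightarrow> f n x = 0" for n x
    using f[of n] by (auto simp: BV_family_def)
  have "\<exists>g. integrable lborel g \<and> (\<lambda>n. LINT x|lborel. \<bar>(f \<circ> k) n x - g x\<bar>) \<longlonglongrightarrow> 0"
  proof (rule L1_complete)
    show "integrable lborel ((f \<circ> k) n)" for n using fi by simp
    fix \<epsilon> :: real assume \<epsilon>: "0 < \<epsilon>"
    define \<eta> where "\<eta> = \<epsilon> / (card D + 1)"
    have \<eta>: "0 < \<eta>" "card D * \<eta> \<le> \<epsilon>" using \<epsilon> by (auto simp: \<eta>_def divide_simps)
    have "\<forall>z\<in>D. \<exists>N. \<forall>i\<ge>N. \<forall>j\<ge>N. (LINT x|lborel. indicator (\<Omega> \<inter> ball z (R z)) x * \<bar>(f \<circ> k) i x - (f \<circ> k) j x\<bar>) \<le> \<eta>"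
      using k(2) \<eta>(1) unfolding L1_Cauchy_on_def by blast
    from bchoice[OF this] obtain N where N: "\<forall>z\<in>D. \<forall>i\<ge>N z. \<forall>j\<ge>N z.
      (LINT x|lborel. indicator (\<Omega> \<inter> ball z (R z)) x * \<bar>(f \<circ> k) i x - (f \<circ> k) j x\<bar>) \<le> \<eta>" ..
    show "\<exists>N. \<forall>i\<ge>N. \<forall>j\<ge>N. (LINT x|lborel. \<bar>(f \<circ> k) i x - (f \<circ> k) j x\<bar>) \<le> \<epsilon>"
    proof (intro exI[of _ "\<Sum>z\<in>D. N z"] allI impI)
      fix i j assume ij: "(\<Sum>z\<in>D. N z) \<le> i" "(\<Sum>z\<in>D. N z) \<le> j"
      have Nz: "N z \<le> i" "N z \<le> j" if "z \<in> D" for z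
        using member_le_sum[of z D N] that D ij by auto
      let ?g = "\<lambda>z x. indicator (\<Omega> \<inter> ball z (R z)) x * \<bar>(f \<circ> k) i x - (f \<circ> k) j x\<bar>"
      have gi: "integrable lborel (?g z)" for z
        using \<Omega>(1) fi by (intro integrable_indicator_abs_diff) auto
      have "(LINT x|lborel. \<bar>(f \<circ> k) i x - (f \<circ> k) j x\<bar>) \<le> (LINT x|lborel. (\<Sum>z\<in>D. ?g z x))"
      proof (rule integral_mono)
        show "integrable lborel (\<lambda>x. \<Sum>z\<in>D. ?g z x)" using gi by (intro Bochner_Integration.integrable_sum)
        show "integrable lborel (\<lambda>x. \<bar>(f \<circ> k) i x - (f \<circ> k) j x\<bar>)" using fi by auto
        fix x
        show "\<bar>(f \<circ> k) i x - (f \<circ> k) j x\<bar> \<le> (\<Sum>z\<in>D. ?g z x)"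
        proof (cases "x \<in> \<Omega>")
          case True
          then obtain z where z: "z \<in> D" "x \<in> ball z (R z / 2)" using cov by blast
          have "0 < R z" using bspec[OF cone z(1)] by (simp add: cone_at_def)
          then have "\<bar>(f \<circ> k) i x - (f \<circ> k) j x\<bar> = ?g z x" using z(2) True by simp
          also have "\<dots> \<le> (\<Sum>z\<in>D. ?g z x)" using z(1) D by (intro member_le_sum) auto
          finally show ?thesis .
        next
          case False
          then have "\<bar>(f \<circ> k) i x - (f \<circ> k) j x\<bar> = 0" using f0 by simp
          also have "0 \<le> (\<Sum>z\<in>D. ?g z x)" by (intro sum_nonneg) auto
          finally show ?thesis .
        qed
      qed
      also have "\<dots> = (\<Sum>z\<in>D. LINT x|lborel. ?g z x)" using gi by (intro Bochner_Integration.integral_sum)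
      also have "\<dots> \<le> (\<Sum>z\<in>D. \<eta>)" using N Nz by (intro sum_mono) blast
      also have "\<dots> \<le> \<epsilon>" using \<eta> by simp
      finally show "(LINT x|lborel. \<bar>(f \<circ> k) i x - (f \<circ> k) j x\<bar>) \<le> \<epsilon>" .
    qed
  qed
  then show ?thesis using k(1) by auto
qed

section \<open>Strong and weak convergence in \<open>L\<^sup>p\<close>\<close>

abbreviation Lp_mass :: "'a::euclidean_space set \<Rightarrow> real \<Rightarrow> ('a \<Rightarrow> real) \<Rightarrow> real" where
  "Lp_mass S p u \<equiv> (LINT x|lebesgue_on S. \<bar>u x\<bar> powr p)"

lemma Lp_mass_nonneg: "0 \<le> Lp_mass S p u"
  by (intro integral_nonneg_AE) auto

lemma abs_add_powr_le:
  fixes a b :: real assumes "0 \<le> p"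
  shows "\<bar>a + b\<bar> powr p \<le> 2 powr p * (\<bar>a\<bar> powr p + \<bar>b\<bar> powr p)"
proof -
  have "\<bar>a + b\<bar> powr p \<le> (2 * max \<bar>a\<bar> \<bar>b\<bar>) powr p" using assms by (intro powr_mono2) auto
  also have "\<dots> = 2 powr p * max \<bar>a\<bar> \<bar>b\<bar> powr p" by (simp add: powr_mult)
  also have "max \<bar>a\<bar> \<bar>b\<bar> powr p \<le> \<bar>a\<bar> powr p + \<bar>b\<bar> powr p" by (simp add: max_def)
  finally show ?thesis by (simp add: mult_left_mono)
qed

lemma Lp_spaceI_bound:
  assumes "u \<in> borel_measurable (lebesgue_on S)" "v \<in> Lp_space S p" "\<And>x. \<bar>u x\<bar> \<le> \<bar>v x\<bar>" "0 \<le> p"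
  shows "u \<in> Lp_space S p"
proof -
  have "integrable (lebesgue_on S) (\<lambda>x. \<bar>u x\<bar> powr p)"
  proof (rule Bochner_Integration.integrable_bound)
    show "integrable (lebesgue_on S) (\<lambda>x. \<bar>v x\<bar> powr p)" using assms(2) by (simp add: Lp_space_def)
    show "AE x in lebesgue_on S. norm (\<bar>u x\<bar> powr p) \<le> norm (\<bar>v x\<bar> powr p)"
      using assms by (intro AE_I2) (auto intro!: powr_mono2)
  qed (use assms(1) in measurable)
  then show ?thesis using assms(1) by (simp add: Lp_space_def)
qed

lemma Lp_space_add:
  assumes "u \<in> Lp_space S p" "v \<in> Lp_space S p" "0 \<le> p"
  shows "(\<lambda>x. u x + v x) \<in> Lp_space S p"
proof -
  have [measurable]: "u \<in> borel_measurable (lebesgue_on S)" "v \<in> borel_measurable (lebesgue_on S)"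
    using assms by (auto simp: Lp_space_def)
  have "integrable (lebesgue_on S) (\<lambda>x. \<bar>u x + v x\<bar> powr p)"
  proof (rule Bochner_Integration.integrable_bound)
    show "integrable (lebesgue_on S) (\<lambda>x. 2 powr p * (\<bar>u x\<bar> powr p + \<bar>v x\<bar> powr p))"
      using assms by (auto simp: Lp_space_def)
    show "AE x in lebesgue_on S. norm (\<bar>u x + v x\<bar> powr p) \<le> norm (2 powr p * (\<bar>u x\<bar> powr p + \<bar>v x\<bar> powr p))"
      using abs_add_powr_le[OF assms(3)] by (intro AE_I2) simp
  qed measurable
  then show ?thesis by (simp add: Lp_space_def)
qed

lemma Lp_space_scale:
  assumes "u \<in> Lp_space S p" shows "(\<lambda>x. c * u x) \<in> Lp_space S p"
  using assms by (auto simp: Lp_space_def abs_mult powr_mult)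

lemma Lp_space_diff:
  assumes "u \<in> Lp_space S p" "v \<in> Lp_space S p" "0 \<le> p"
  shows "(\<lambda>x. u x - v x) \<in> Lp_space S p"
  using Lp_space_add[OF assms(1) Lp_space_scale[OF assms(2), of "-1"] assms(3)] by simp

lemma Lp_mass_scale:
  "Lp_mass S p (\<lambda>x. c * u x) = \<bar>c\<bar> powr p * Lp_mass S p u"
  by (simp add: abs_mult powr_mult)

lemma Lp_mass_diff_le:
  assumes u: "u \<in> Lp_space S p" "v \<in> Lp_space S p" "0 \<le> p" and B: "Lp_mass S p u \<le> B" "Lp_mass S p v \<le> B"
  shows "Lp_mass S p (\<lambda>x. u x - v x) \<le> 2 powr p * (2 * B)"
proof -
  have "Lp_mass S p (\<lambda>x. u x - v x) \<le> (LINT x|lebesgue_on S. 2 powr p * (\<bar>u x\<bar> powr p + \<bar>v x\<bar> powr p))"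
  proof (rule integral_mono)
    show "integrable (lebesgue_on S) (\<lambda>x. \<bar>u x - v x\<bar> powr p)"
      using Lp_space_diff[OF u] by (simp add: Lp_space_def)
    show "integrable (lebesgue_on S) (\<lambda>x. 2 powr p * (\<bar>u x\<bar> powr p + \<bar>v x\<bar> powr p))"
      using u by (auto simp: Lp_space_def)
    show "\<bar>u x - v x\<bar> powr p \<le> 2 powr p * (\<bar>u x\<bar> powr p + \<bar>v x\<bar> powr p)" for x
      using abs_add_powr_le[OF u(3), of "u x" "- v x"] by simp
  qed
  also have "\<dots> = 2 powr p * (Lp_mass S p u + Lp_mass S p v)" using u by (simp add: Lp_space_def)
  also have "\<dots> \<le> 2 powr p * (2 * B)" using B by (intro mult_left_mono) auto
  finally show ?thesis .
qed

text \<open>Interpolation between \<open>L\<^sup>1\<close> and \<open>L\<^sup>r\<close> by splitting at height \<open>K\<close>; the second coefficient is small for large \<open>K\<close>.\<close>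

lemma abs_powr_interpolate:
  fixes t :: real
  assumes "1 \<le> q" "q < r" "1 \<le> K"
  shows "\<bar>t\<bar> powr q \<le> K powr (q - 1) * \<bar>t\<bar> + K powr (q - r) * \<bar>t\<bar> powr r"
proof (cases "\<bar>t\<bar> \<le> K")
  case True
  have "\<bar>t\<bar> powr q \<le> K powr (q - 1) * \<bar>t\<bar>"
  proof (cases "t = 0")
    case False
    have "\<bar>t\<bar> powr q = \<bar>t\<bar> powr (q - 1) * \<bar>t\<bar>" using False by (simp add: powr_diff)
    also have "\<dots> \<le> K powr (q - 1) * \<bar>t\<bar>" using True assms by (intro mult_right_mono powr_mono2) auto
    finally show ?thesis .
  qed simp
  then show ?thesis by (simp add: add_increasing2)
next
  case False
  have "\<bar>t\<bar> powr q = \<bar>t\<bar> powr (q - r) * \<bar>t\<bar> powr r" by (simp add: powr_add[symmetric])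
  also have "\<dots> \<le> K powr (q - r) * \<bar>t\<bar> powr r"
    using False assms by (intro mult_right_mono powr_mono2') auto
  finally show ?thesis by (simp add: add_increasing)
qed

lemma Lq_convergence_by_interpolation:
  fixes w :: "nat \<Rightarrow> 'a::euclidean_space \<Rightarrow> real"
  assumes q: "1 \<le> q" "q < r" and w: "\<And>n. integrable (lebesgue_on S) (w n)" "\<And>n. w n \<in> Lp_space S q" "\<And>n. w n \<in> Lp_space S r"
    and B: "\<And>n. Lp_mass S r (w n) \<le> B" and lim: "(\<lambda>n. LINT x|lebesgue_on S. \<bar>w n x\<bar>) \<longlonglongrightarrow> 0"
  shows "(\<lambda>n. Lp_norm S q (w n)) \<longlonglongrightarrow> 0"
proof -
  have B0: "0 \<le> B" using Lp_mass_nonneg[of S "w 0" r] B[of 0] by linarith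
  have "(\<lambda>n. Lp_mass S q (w n)) \<longlonglongrightarrow> 0"
  proof (rule LIMSEQ_I)
    fix \<epsilon> :: real assume \<epsilon>: "0 < \<epsilon>"
    have "((\<lambda>K. K powr (q - r) * B) \<longlongrightarrow> 0 * B) at_top"
      using q by (intro tendsto_mult tendsto_const tendsto_neg_powr filterlim_ident) simp
    then have "\<forall>\<^sub>F K in at_top. K powr (q - r) * B < \<epsilon> / 2" using \<epsilon> by (intro order_tendstoD) auto
    then obtain K where K: "1 \<le> K" "K powr (q - r) * B < \<epsilon> / 2"
      using eventually_conj[OF eventually_ge_at_top[of "1::real"]] eventually_happens' trivial_limit_at_top_linorder by blast
    have "(\<lambda>n. K powr (q - 1) * (LINT x|lebesgue_on S. \<bar>w n x\<bar>)) \<longlonglongrightarrow> K powr (q - 1) * 0"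
      by (intro tendsto_intros lim)
    then have "\<forall>\<^sub>F n in sequentially. K powr (q - 1) * (LINT x|lebesgue_on S. \<bar>w n x\<bar>) < \<epsilon> / 2"
      using \<epsilon> by (intro order_tendstoD) auto
    then obtain N where N: "\<And>n. n \<ge> N \<Longrightarrow> K powr (q - 1) * (LINT x|lebesgue_on S. \<bar>w n x\<bar>) < \<epsilon> / 2"
      by (auto simp: eventually_sequentially)
    show "\<exists>no. \<forall>n\<ge>no. norm (Lp_mass S q (w n) - 0) < \<epsilon>"
    proof (intro exI[of _ N] allI impI)
      fix n assume n: "N \<le> n"
      have "Lp_mass S q (w n) \<le> (LINT x|lebesgue_on S. K powr (q - 1) * \<bar>w n x\<bar> + K powr (q - r) * \<bar>w n x\<bar> powr r)"
        using w[of n] K q abs_powr_interpolate[OF q K(1)]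
        by (intro integral_mono) (auto simp: Lp_space_def)
      also have "\<dots> = K powr (q - 1) * (LINT x|lebesgue_on S. \<bar>w n x\<bar>) + K powr (q - r) * Lp_mass S r (w n)"
        using w[of n] by (simp add: Lp_space_def)
      also have "\<dots> < \<epsilon> / 2 + \<epsilon> / 2"
        using N[OF n] K(2) mult_left_mono[OF B[of n], of "K powr (q - r)"] by (intro add_strict_mono) auto
      finally show "norm (Lp_mass S q (w n) - 0) < \<epsilon>" using Lp_mass_nonneg[of S "w n" q] by simp
    qed
  qed
  then have "(\<lambda>n. Lp_mass S q (w n) powr (1 / q)) \<longlonglongrightarrow> 0 powr (1 / q)"
    using q Lp_mass_nonneg by (intro tendsto_powr') auto
  then show ?thesis by (simp add: Lp_norm_def)
qed

text \<open>Absolute continuity of the integral: the sets \<open>{\<bar>w n\<bar> > 1}\<close> have measure tending to zero.\<close>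

lemma integral_on_small_sets:
  fixes g :: "'a \<Rightarrow> real" and w :: "nat \<Rightarrow> 'a \<Rightarrow> real"
  assumes g: "integrable M g" "\<And>x. 0 \<le> g x" and w: "\<And>n. integrable M (w n)"
    and lim: "(\<lambda>n. LINT x|M. \<bar>w n x\<bar>) \<longlonglongrightarrow> 0"
  shows "(\<lambda>n. LINT x|M. g x * indicator {x. 1 < \<bar>w n x\<bar>} x) \<longlonglongrightarrow> 0"
proof (rule LIMSEQ_I)
  fix \<epsilon> :: real assume \<epsilon>: "0 < \<epsilon>"
  have [measurable]: "g \<in> borel_measurable M" "w n \<in> borel_measurable M" for n using g w[of n] by auto
  have bi: "integrable M (\<lambda>x. if P x then g x else 0)" if [measurable]: "Measurable.pred M P" for P
    by (rule Bochner_Integration.integrable_bound[OF g(1)]) (use g in \<open>auto intro!: AE_I2\<close>)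
  have "(\<lambda>R. LINT x|M. (if real R < g x then g x else 0)) \<longlonglongrightarrow> (LINT x|M. 0)"
  proof (rule integral_dominated_convergence[OF _ _ g(1)])
    show "AE x in M. (\<lambda>R. if real R < g x then g x else 0) \<longlonglongrightarrow> 0"
    proof (intro AE_I2)
      fix x
      obtain R0 where "g x < real R0" using reals_Archimedean2 by blast
      then have "\<forall>\<^sub>F R in sequentially. (if real R < g x then g x else 0) = 0"
        by (intro eventually_sequentiallyI[of R0]) auto
      then show "(\<lambda>R. if real R < g x then g x else 0) \<longlonglongrightarrow> 0" by (rule tendsto_eventually)
    qed
  qed (use g in \<open>auto intro!: AE_I2\<close>)
  then have "\<forall>\<^sub>F R in sequentially. (LINT x|M. (if real R < g x then g x else 0)) < \<epsilon> / 2"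
    using \<epsilon> by (intro order_tendstoD) auto
  then obtain R where R: "(LINT x|M. (if real R < g x then g x else 0)) < \<epsilon> / 2"
    using eventually_happens' sequentially_bot by blast
  have "(\<lambda>n. real R * (LINT x|M. \<bar>w n x\<bar>)) \<longlonglongrightarrow> real R * 0" by (intro tendsto_intros lim)
  then have "\<forall>\<^sub>F n in sequentially. real R * (LINT x|M. \<bar>w n x\<bar>) < \<epsilon> / 2"
    using \<epsilon> by (intro order_tendstoD) auto
  then obtain N where N: "\<And>n. n \<ge> N \<Longrightarrow> real R * (LINT x|M. \<bar>w n x\<bar>) < \<epsilon> / 2"
    by (auto simp: eventually_sequentially)
  show "\<exists>no. \<forall>n\<ge>no. norm ((LINT x|M. g x * indicator {x. 1 < \<bar>w n x\<bar>} x) - 0) < \<epsilon>"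
  proof (intro exI[of _ N] allI impI)
    fix n assume n: "N \<le> n"
    have eq: "(\<lambda>x. g x * indicator {x. 1 < \<bar>w n x\<bar>} x) = (\<lambda>x. if 1 < \<bar>w n x\<bar> then g x else 0)"
      by (auto simp: indicator_def)
    have "(LINT x|M. g x * indicator {x. 1 < \<bar>w n x\<bar>} x) \<le>
        (LINT x|M. real R * \<bar>w n x\<bar> + (if real R < g x then g x else 0))"
      unfolding eq
    proof (rule integral_mono)
      show "integrable M (\<lambda>x. if 1 < \<bar>w n x\<bar> then g x else 0)" by (rule bi) measurable
      show "integrable M (\<lambda>x. real R * \<bar>w n x\<bar> + (if real R < g x then g x else 0))"
        by (intro Bochner_Integration.integrable_add integrable_mult_right integrable_abs w bi) measurable
      fix x
      show "(if 1 < \<bar>w n x\<bar> then g x else 0) \<le> real R * \<bar>w n x\<bar> + (if real R < g x then g x else 0)"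
        using g(2)[of x] mult_left_mono[of 1 "\<bar>w n x\<bar>" "real R"] by auto
    qed
    also have "\<dots> = real R * (LINT x|M. \<bar>w n x\<bar>) + (LINT x|M. (if real R < g x then g x else 0))"
    proof -
      have "integrable M (\<lambda>x. if real R < g x then g x else 0)" by (rule bi) measurable
      then show ?thesis using w by simp
    qed
    also have "\<dots> < \<epsilon>" using N[OF n] R by linarith
    finally have "(LINT x|M. g x * indicator {x. 1 < \<bar>w n x\<bar>} x) < \<epsilon>" .
    moreover have "0 \<le> (LINT x|M. g x * indicator {x. 1 < \<bar>w n x\<bar>} x)"
      using g(2) by (intro integral_nonneg_AE AE_I2) auto
    ultimately show "norm ((LINT x|M. g x * indicator {x. 1 < \<bar>w n x\<bar>} x) - 0) < \<epsilon>" by simp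
  qed
qed

lemma Lp_space_borel: "u \<in> Lp_space S p \<Longrightarrow> u \<in> borel_measurable (lebesgue_on S)"
  by (simp add: Lp_space_def)

lemma Lp_space_integrable: "u \<in> Lp_space S p \<Longrightarrow> integrable (lebesgue_on S) (\<lambda>x. \<bar>u x\<bar> powr p)"
  by (simp add: Lp_space_def)

lemma Lp_dualD:
  assumes "\<phi> \<in> Lp_dual S p"
  shows "u \<in> Lp_space S p \<Longrightarrow> v \<in> Lp_space S p \<Longrightarrow> \<phi> (\<lambda>x. u x + v x) = \<phi> u + \<phi> v"
    "u \<in> Lp_space S p \<Longrightarrow> \<phi> (\<lambda>x. c * u x) = c * \<phi> u"
    "\<exists>K\<ge>0. \<forall>u\<in>Lp_space S p. \<bar>\<phi> u\<bar> \<le> K * Lp_norm S p u"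
proof -
  show "u \<in> Lp_space S p \<Longrightarrow> v \<in> Lp_space S p \<Longrightarrow> \<phi> (\<lambda>x. u x + v x) = \<phi> u + \<phi> v"
    "u \<in> Lp_space S p \<Longrightarrow> \<phi> (\<lambda>x. c * u x) = c * \<phi> u"
    using assms by (auto simp: Lp_dual_def)
  obtain K where K: "\<forall>u\<in>Lp_space S p. \<bar>\<phi> u\<bar> \<le> K * Lp_norm S p u" using assms unfolding Lp_dual_def by auto
  have "\<bar>\<phi> u\<bar> \<le> \<bar>K\<bar> * Lp_norm S p u" if "u \<in> Lp_space S p" for u
  proof -
    have "0 \<le> Lp_norm S p u" by (simp add: Lp_norm_def)
    then show ?thesis using K that mult_right_mono[of K "\<bar>K\<bar>" "Lp_norm S p u"] by fastforce
  qed
  then show "\<exists>K\<ge>0. \<forall>u\<in>Lp_space S p. \<bar>\<phi> u\<bar> \<le> K * Lp_norm S p u" by (intro exI[of _ "\<bar>K\<bar>"]) auto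
qed

text \<open>Let \<open>f\<close> nearly maximize \<open>\<phi>\<close> on the unit ball, and let \<open>h\<close> be the restriction of \<open>w n\<close> to \<open>{\<bar>w n\<bar> > 1}\<close>. Removing
  this small set from the support of \<open>f\<close> hardly changes \<open>\<phi> f\<close>. After that \<open>f\<close> and \<open>h\<close> have disjoint supports, so
  the \<open>q\<close>-th power of the norm of \<open>f + t h\<close> is at most \<open>1 + t\<^sup>q B\<close>, and maximality gives
  \<open>t \<phi> h \<le> O(t\<^sup>q) + o(1)\<close>. As \<open>q > 1\<close>, a small \<open>t\<close> makes \<open>\<phi> h\<close> small.\<close>

lemma dual_large_values_eventually_small:
  fixes w :: "nat \<Rightarrow> 'a::euclidean_space \<Rightarrow> real"
  assumes q: "1 < q" and w: "\<And>n. integrable (lebesgue_on S) (w n)" "\<And>n. w n \<in> Lp_space S q"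
    and B: "\<And>n. Lp_mass S q (w n) \<le> B" and lim: "(\<lambda>n. LINT x|lebesgue_on S. \<bar>w n x\<bar>) \<longlonglongrightarrow> 0"
    and \<phi>: "\<phi> \<in> Lp_dual S q" and \<epsilon>: "0 < \<epsilon>"
  shows "\<forall>\<^sub>F n in sequentially. \<phi> (\<lambda>x. if 1 < \<bar>w n x\<bar> then w n x else 0) < \<epsilon>"
proof -
  let ?L = "Lp_space S q"
  let ?A = "\<lambda>n x. 1 < \<bar>w n x\<bar>"
  have wm [measurable]: "w n \<in> borel_measurable (lebesgue_on S)" for n using w(2) by (rule Lp_space_borel)
  have B0: "0 \<le> B" using Lp_mass_nonneg[of S "w 0" q] B[of 0] by linarith
  have cut: "(\<lambda>x. if P x then f x else 0) \<in> ?L" if f: "f \<in> ?L" and [measurable]: "Measurable.pred (lebesgue_on S) P" for f P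
  proof (rule Lp_spaceI_bound[OF _ f])
    have [measurable]: "f \<in> borel_measurable (lebesgue_on S)" using f by (rule Lp_space_borel)
    show "(\<lambda>x. if P x then f x else 0) \<in> borel_measurable (lebesgue_on S)" by measurable
  qed (use q in auto)
  obtain K where K: "K \<ge> 0" "\<And>u. u \<in> ?L \<Longrightarrow> \<bar>\<phi> u\<bar> \<le> K * Lp_norm S q u" using Lp_dualD(3)[OF \<phi>] by blast
  define Q where "Q = {\<phi> u | u. u \<in> ?L \<and> Lp_mass S q u \<le> 1}"
  define K0 where "K0 = Sup Q"
  have Kle: "\<phi> u \<le> K" if u: "u \<in> ?L" "Lp_mass S q u \<le> 1" for u
  proof -
    have "Lp_norm S q u \<le> 1" unfolding Lp_norm_def using u(2) Lp_mass_nonneg[of S u q] q by (intro powr_le1) auto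
    then have "K * Lp_norm S q u \<le> K" using K(1) by (rule mult_left_le)
    then show ?thesis using K(2)[OF u(1)] by linarith
  qed
  have bdd: "bdd_above Q" unfolding Q_def by (intro bdd_aboveI[of _ K]) (auto intro: Kle)
  have zero: "(\<lambda>x. 0) \<in> ?L" by (simp add: Lp_space_def)
  have "\<phi> (\<lambda>x. 0 * (0::real)) = 0 * \<phi> (\<lambda>x. 0)" by (rule Lp_dualD(2)[OF \<phi> zero])
  then have \<phi>0: "\<phi> (\<lambda>x. 0) = 0" by simp
  have Qne: "0 \<in> Q" unfolding Q_def using zero \<phi>0 by (auto intro!: exI[of _ "\<lambda>x. 0"])
  have K00: "0 \<le> K0" unfolding K0_def by (rule cSup_upper[OF Qne bdd])
  have K0: "\<phi> v \<le> K0 * A" if v: "v \<in> ?L" "Lp_mass S q v \<le> A" and A: "1 \<le> A" for v A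
  proof -
    have "Lp_mass S q (\<lambda>x. (1 / A) * v x) = (1 / A) powr q * Lp_mass S q v"
      unfolding Lp_mass_scale using A by simp
    also have "\<dots> \<le> (1 / A) powr 1 * A"
      using v(2) A q Lp_mass_nonneg[of S v q] by (intro mult_mono powr_mono') auto
    also have "\<dots> = 1" using A by simp
    finally have "\<phi> (\<lambda>x. (1 / A) * v x) \<in> Q" unfolding Q_def using Lp_space_scale[OF v(1)] by blast
    then have "\<phi> (\<lambda>x. (1 / A) * v x) \<le> K0" unfolding K0_def using bdd by (rule cSup_upper)
    then have "(1 / A) * \<phi> v \<le> K0" unfolding Lp_dualD(2)[OF \<phi> v(1), of "1 / A"] .
    then show ?thesis using A by (simp add: divide_simps mult.commute)
  qed
  have "((\<lambda>t. t powr (q - 1) * (K0 * B + 1)) \<longlongrightarrow> 0 powr (q - 1) * (K0 * B + 1)) (at_right 0)"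
    using q by (intro tendsto_intros tendsto_powr') (auto simp: eventually_at_right_less less_imp_le eventually_mono[OF eventually_at_right_less])
  then have "\<forall>\<^sub>F t in at_right 0. t powr (q - 1) * (K0 * B + 1) < \<epsilon> / 2"
    using \<epsilon> q by (intro order_tendstoD) auto
  then obtain t where t: "0 < t" "t powr (q - 1) * (K0 * B + 1) < \<epsilon> / 2"
    using eventually_conj[OF eventually_at_right_less[of "0::real"]] eventually_happens' trivial_limit_at_right_real by blast
  \<comment> \<open>The defect \<open>t\<^sup>q\<close> of the near maximizer is of the same order as the term \<open>t\<^sup>q B\<close>.\<close>
  have "K0 - t powr q < K0" using t by simp
  then obtain y where "y \<in> Q" "K0 - t powr q < y" unfolding K0_def using less_cSup_iff[of Q] Qne bdd by blast
  then obtain f where f: "f \<in> ?L" "Lp_mass S q f \<le> 1" "K0 - t powr q < \<phi> f" unfolding Q_def by blast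
  have fm [measurable]: "f \<in> borel_measurable (lebesgue_on S)" using f(1) by (rule Lp_space_borel)
  define \<eta> where "\<eta> n = Lp_norm S q (\<lambda>x. if ?A n x then f x else 0)" for n
  have \<eta>lim: "\<eta> \<longlonglongrightarrow> 0"
  proof -
    have "(\<lambda>n. LINT x|lebesgue_on S. \<bar>f x\<bar> powr q * indicator {x. 1 < \<bar>w n x\<bar>} x) \<longlonglongrightarrow> 0"
      using Lp_space_integrable[OF f(1)] w(1) lim by (intro integral_on_small_sets) auto
    then have "(\<lambda>n. Lp_mass S q (\<lambda>x. if ?A n x then f x else 0)) \<longlonglongrightarrow> 0"
    proof (rule back_subst[where P="\<lambda>X. X \<longlonglongrightarrow> 0"])
      show "(\<lambda>n. LINT x|lebesgue_on S. \<bar>f x\<bar> powr q * indicator {x. 1 < \<bar>w n x\<bar>} x) =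
         (\<lambda>n. Lp_mass S q (\<lambda>x. if ?A n x then f x else 0))"
        using q by (intro ext Bochner_Integration.integral_cong) (auto simp: indicator_def)
    qed
    then have "(\<lambda>n. Lp_mass S q (\<lambda>x. if ?A n x then f x else 0) powr (1 / q)) \<longlonglongrightarrow> 0 powr (1 / q)"
      using q Lp_mass_nonneg by (intro tendsto_powr') auto
    moreover have "\<eta> = (\<lambda>n. Lp_mass S q (\<lambda>x. if ?A n x then f x else 0) powr (1 / q))"
      by (rule ext) (simp add: \<eta>_def Lp_norm_def)
    ultimately show ?thesis by simp
  qed
  have "(\<lambda>n. K * \<eta> n) \<longlonglongrightarrow> K * 0" by (intro tendsto_intros \<eta>lim)
  moreover have "0 < t * (\<epsilon> / 2)" using t \<epsilon> by simp
  ultimately have "\<forall>\<^sub>F n in sequentially. K * \<eta> n < t * (\<epsilon> / 2)" by (intro order_tendstoD(2)[of _ 0]) auto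
  then show ?thesis
  proof eventually_elim
    case (elim n)
    let ?h = "\<lambda>x. if ?A n x then w n x else 0" and ?f1 = "\<lambda>x. if ?A n x then f x else 0"
      and ?f2 = "\<lambda>x. if \<not> ?A n x then f x else 0"
    have hL: "?h \<in> ?L" "?f1 \<in> ?L" "?f2 \<in> ?L" using w(2) f(1) by (auto intro!: cut)
    have "Lp_mass S q (\<lambda>x. ?f2 x + t * ?h x) \<le> (LINT x|lebesgue_on S. \<bar>f x\<bar> powr q + t powr q * \<bar>w n x\<bar> powr q)"
    proof (rule integral_mono)
      show "integrable (lebesgue_on S) (\<lambda>x. \<bar>?f2 x + t * ?h x\<bar> powr q)"
        by (rule Lp_space_integrable, rule Lp_space_add[OF hL(3) Lp_space_scale[OF hL(1)]]) (use q in simp)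
      show "integrable (lebesgue_on S) (\<lambda>x. \<bar>f x\<bar> powr q + t powr q * \<bar>w n x\<bar> powr q)"
        using Lp_space_integrable[OF f(1)] Lp_space_integrable[OF w(2)] by simp
      show "\<bar>?f2 x + t * ?h x\<bar> powr q \<le> \<bar>f x\<bar> powr q + t powr q * \<bar>w n x\<bar> powr q" for x
        using t q by (auto simp: abs_mult powr_mult)
    qed
    also have "\<dots> = Lp_mass S q f + t powr q * Lp_mass S q (w n)"
      using Lp_space_integrable[OF f(1)] Lp_space_integrable[OF w(2)] by simp
    also have "\<dots> \<le> 1 + t powr q * B" using f(2) B[of n] by (intro add_mono mult_left_mono) auto
    finally have "\<phi> (\<lambda>x. ?f2 x + t * ?h x) \<le> K0 * (1 + t powr q * B)"
      using hL q B0 by (intro K0 Lp_space_add Lp_space_scale) auto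
    also have "\<phi> (\<lambda>x. ?f2 x + t * ?h x) = \<phi> ?f2 + t * \<phi> ?h"
      using Lp_dualD(1)[OF \<phi> hL(3) Lp_space_scale[OF hL(1)]] Lp_dualD(2)[OF \<phi> hL(1)] by simp
    finally have 1: "\<phi> ?f2 + t * \<phi> ?h \<le> K0 * (1 + t powr q * B)" .
    have "\<phi> (\<lambda>x. ?f1 x + ?f2 x) = \<phi> ?f1 + \<phi> ?f2" by (rule Lp_dualD(1)[OF \<phi> hL(2,3)])
    moreover have "(\<lambda>x. ?f1 x + ?f2 x) = f" by auto
    ultimately have 2: "\<phi> f = \<phi> ?f1 + \<phi> ?f2" by simp
    have 3: "\<phi> ?f1 \<le> K * \<eta> n" using K(2)[OF hL(2)] unfolding \<eta>_def by linarith
    have "t * \<phi> ?h \<le> t powr q * (K0 * B + 1) + K * \<eta> n"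
      using 1 2 3 f(3) by (simp add: algebra_simps)
    also have "t powr q = t * t powr (q - 1)" using t by (simp add: powr_diff)
    also have "t * t powr (q - 1) * (K0 * B + 1) + K * \<eta> n < t * (\<epsilon> / 2) + t * (\<epsilon> / 2)"
      using t elim by (intro add_strict_mono) (auto simp: mult.assoc)
    also have "t * (\<epsilon> / 2) + t * (\<epsilon> / 2) = t * \<epsilon>" by (simp add: distrib_left[symmetric])
    finally have "t * \<phi> ?h < t * \<epsilon>" .
    then show "\<phi> ?h < \<epsilon>" using t by simp
  qed
qed

text \<open>On \<open>{\<bar>w n\<bar> \<le> 1}\<close> the \<open>q\<close>-th power is at most \<open>\<bar>w n\<bar>\<close>, so that part tends to zero in norm; the large values,
  and those of \<open>- w n\<close>, are covered by \<open>dual_large_values_eventually_small\<close>.\<close>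

lemma weakly_null_if_bounded_and_L1_null:
  fixes w :: "nat \<Rightarrow> 'a::euclidean_space \<Rightarrow> real"
  assumes q: "1 < q" and w: "\<And>n. integrable (lebesgue_on S) (w n)" "\<And>n. w n \<in> Lp_space S q"
    and B: "\<And>n. Lp_mass S q (w n) \<le> B" and lim: "(\<lambda>n. LINT x|lebesgue_on S. \<bar>w n x\<bar>) \<longlonglongrightarrow> 0"
    and \<phi>: "\<phi> \<in> Lp_dual S q"
  shows "(\<lambda>n. \<phi> (w n)) \<longlonglongrightarrow> 0"
proof -
  let ?L = "Lp_space S q"
  let ?h = "\<lambda>n x. if 1 < \<bar>w n x\<bar> then w n x else 0" and ?s = "\<lambda>n x. if 1 < \<bar>w n x\<bar> then 0 else w n x"
  have wm [measurable]: "w n \<in> borel_measurable (lebesgue_on S)" for n using w(2) by (rule Lp_space_borel)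
  have hs: "?h n \<in> ?L" "?s n \<in> ?L" for n
  proof -
    show "?h n \<in> ?L" by (rule Lp_spaceI_bound[OF _ w(2)[of n]]) (use q in auto)
    show "?s n \<in> ?L" by (rule Lp_spaceI_bound[OF _ w(2)[of n]]) (use q in auto)
  qed
  obtain K where K: "K \<ge> 0" "\<And>u. u \<in> ?L \<Longrightarrow> \<bar>\<phi> u\<bar> \<le> K * Lp_norm S q u" using Lp_dualD(3)[OF \<phi>] by blast
  have "(\<lambda>n. \<phi> (?h n)) \<longlonglongrightarrow> 0"
  proof (rule LIMSEQ_I)
    fix \<epsilon> :: real assume \<epsilon>: "0 < \<epsilon>"
    have up: "\<forall>\<^sub>F n in sequentially. \<phi> (?h n) < \<epsilon>"
      by (rule dual_large_values_eventually_small[OF q w B lim \<phi> \<epsilon>])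
    have wneg: "integrable (lebesgue_on S) (\<lambda>x. - w n x)" "(\<lambda>x. - w n x) \<in> ?L" for n
      using w(1) Lp_space_scale[OF w(2)[of n], of "-1"] by auto
    have "\<forall>\<^sub>F n in sequentially. \<phi> (\<lambda>x. if 1 < \<bar>- w n x\<bar> then - w n x else 0) < \<epsilon>"
      by (rule dual_large_values_eventually_small[OF q wneg _ _ \<phi> \<epsilon>]) (use B lim in auto)
    moreover have "\<phi> (\<lambda>x. if 1 < \<bar>- w n x\<bar> then - w n x else 0) = - \<phi> (?h n)" for n
    proof -
      have "(\<lambda>x. if 1 < \<bar>- w n x\<bar> then - w n x else 0) = (\<lambda>x. (-1) * ?h n x)" by auto
      then show ?thesis using Lp_dualD(2)[OF \<phi> hs(1)[of n], of "-1"] by simp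
    qed
    ultimately have "\<forall>\<^sub>F n in sequentially. - \<phi> (?h n) < \<epsilon>" by simp
    with up have "\<forall>\<^sub>F n in sequentially. norm (\<phi> (?h n) - 0) < \<epsilon>" by eventually_elim auto
    then show "\<exists>no. \<forall>n\<ge>no. norm (\<phi> (?h n) - 0) < \<epsilon>" by (simp add: eventually_sequentially)
  qed
  moreover have "(\<lambda>n. \<phi> (?s n)) \<longlonglongrightarrow> 0"
  proof (rule Lim_null_comparison)
    show "\<forall>\<^sub>F n in sequentially. norm (\<phi> (?s n)) \<le> K * (LINT x|lebesgue_on S. \<bar>w n x\<bar>) powr (1 / q)"
    proof (intro always_eventually allI)
      fix n
      have "Lp_mass S q (?s n) \<le> (LINT x|lebesgue_on S. \<bar>w n x\<bar>)"
      proof (rule integral_mono)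
        show "integrable (lebesgue_on S) (\<lambda>x. \<bar>?s n x\<bar> powr q)" by (rule Lp_space_integrable[OF hs(2)])
        show "\<bar>?s n x\<bar> powr q \<le> \<bar>w n x\<bar>" for x
          using q powr_mono'[of 1 q "\<bar>w n x\<bar>"] by (auto simp: not_less)
      qed (use w(1) in auto)
      then have "Lp_norm S q (?s n) \<le> (LINT x|lebesgue_on S. \<bar>w n x\<bar>) powr (1 / q)"
        unfolding Lp_norm_def using q Lp_mass_nonneg[of S "?s n" q] by (intro powr_mono2) auto
      then show "norm (\<phi> (?s n)) \<le> K * (LINT x|lebesgue_on S. \<bar>w n x\<bar>) powr (1 / q)"
        using K(2)[OF hs(2)[of n]] mult_left_mono[OF _ K(1)] by fastforce
    qed
    have "(\<lambda>n. K * (LINT x|lebesgue_on S. \<bar>w n x\<bar>) powr (1 / q)) \<longlonglongrightarrow> K * 0 powr (1 / q)"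
      using q by (intro tendsto_intros tendsto_powr' lim) (auto intro!: always_eventually)
    then show "(\<lambda>n. K * (LINT x|lebesgue_on S. \<bar>w n x\<bar>) powr (1 / q)) \<longlonglongrightarrow> 0" by simp
  qed
  ultimately have "(\<lambda>n. \<phi> (?h n) + \<phi> (?s n)) \<longlonglongrightarrow> 0 + 0" by (rule tendsto_add)
  moreover have "\<phi> (?h n) + \<phi> (?s n) = \<phi> (w n)" for n
  proof -
    have "(\<lambda>x. ?h n x + ?s n x) = w n" by auto
    then show ?thesis using Lp_dualD(1)[OF \<phi> hs(1,2)[of n]] by simp
  qed
  ultimately show ?thesis by simp
qed

section \<open>Representatives of \<open>L\<^sup>p\<close> functions of bounded variation\<close>

lemma lborel_lebesgue_on:
  fixes k :: "'a::euclidean_space \<Rightarrow> real"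
  assumes \<Omega>: "\<Omega> \<in> sets borel" and k: "k \<in> borel_measurable borel" and k0: "\<And>x. x \<notin> \<Omega> \<Longrightarrow> k x = 0"
  shows "(LINT x|lebesgue_on \<Omega>. k x) = (LINT x|lborel. k x)"
    "integrable (lebesgue_on \<Omega>) k \<longleftrightarrow> integrable lborel k"
    "(\<integral>\<^sup>+x. ennreal \<bar>k x\<bar> \<partial>lebesgue_on \<Omega>) = (\<integral>\<^sup>+x. ennreal \<bar>k x\<bar> \<partial>lborel)"
proof -
  have \<Omega>': "\<Omega> \<inter> space lebesgue \<in> sets lebesgue" using \<Omega> by auto
  have eq: "(\<lambda>x. indicator \<Omega> x *\<^sub>R k x) = k" by (rule ext) (use k0 in \<open>auto simp: indicator_def\<close>)
  show "(LINT x|lebesgue_on \<Omega>. k x) = (LINT x|lborel. k x)"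
    unfolding integral_restrict_space[OF \<Omega>'] eq using k by (intro integral_completion) simp
  show "integrable (lebesgue_on \<Omega>) k \<longleftrightarrow> integrable lborel k"
    unfolding integrable_restrict_space[OF \<Omega>'] eq using k by (intro integrable_completion) simp
  have "(\<integral>\<^sup>+x. ennreal \<bar>k x\<bar> \<partial>lebesgue_on \<Omega>) = (\<integral>\<^sup>+x. ennreal \<bar>k x\<bar> * indicator \<Omega> x \<partial>lebesgue)"
    by (rule nn_integral_restrict_space[OF \<Omega>'])
  also have "(\<lambda>x. ennreal \<bar>k x\<bar> * indicator \<Omega> x) = (\<lambda>x. ennreal \<bar>k x\<bar>)" using k0 by (auto simp: indicator_def)
  also have "(\<integral>\<^sup>+x. ennreal \<bar>k x\<bar> \<partial>lebesgue) = (\<integral>\<^sup>+x. ennreal \<bar>k x\<bar> \<partial>lborel)"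
    by (rule nn_integral_completion)
  finally show "(\<integral>\<^sup>+x. ennreal \<bar>k x\<bar> \<partial>lebesgue_on \<Omega>) = (\<integral>\<^sup>+x. ennreal \<bar>k x\<bar> \<partial>lborel)" .
qed

lemma integrable_const_lebesgue_on:
  fixes \<Omega> :: "'a::euclidean_space set"
  assumes "open \<Omega>" "bounded \<Omega>" shows "integrable (lebesgue_on \<Omega>) (\<lambda>x. c::real)"
proof -
  have "\<Omega> \<in> lmeasurable" using assms by (simp add: lmeasurable_open)
  then interpret finite_measure "lebesgue_on \<Omega>" by (rule finite_measure_lebesgue_on)
  show ?thesis by simp
qed

lemma powr_le_1_add_powr:
  fixes t :: real assumes "0 \<le> a" "a \<le> b" shows "\<bar>t\<bar> powr a \<le> 1 + \<bar>t\<bar> powr b"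
proof (cases "\<bar>t\<bar> \<le> 1")
  case True
  then have "\<bar>t\<bar> powr a \<le> 1" using assms by (intro powr_le1) auto
  then show ?thesis by (simp add: add_increasing2)
next
  case False
  then have "\<bar>t\<bar> powr a \<le> \<bar>t\<bar> powr b" using assms by (intro powr_mono) auto
  then show ?thesis by simp
qed

lemma Lp_space_antimono:
  fixes \<Omega> :: "'a::euclidean_space set"
  assumes \<Omega>: "open \<Omega>" "bounded \<Omega>" and u: "u \<in> Lp_space \<Omega> b" and ab: "0 \<le> a" "a \<le> b"
  shows "u \<in> Lp_space \<Omega> a"
proof -
  have [measurable]: "u \<in> borel_measurable (lebesgue_on \<Omega>)" using u by (rule Lp_space_borel)
  have "integrable (lebesgue_on \<Omega>) (\<lambda>x. \<bar>u x\<bar> powr a)"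
  proof (rule Bochner_Integration.integrable_bound)
    show "integrable (lebesgue_on \<Omega>) (\<lambda>x. 1 + \<bar>u x\<bar> powr b)"
      using integrable_const_lebesgue_on[OF \<Omega>, of 1] Lp_space_integrable[OF u] by simp
    show "AE x in lebesgue_on \<Omega>. norm (\<bar>u x\<bar> powr a) \<le> norm (1 + \<bar>u x\<bar> powr b)"
      using powr_le_1_add_powr[OF ab] by (intro AE_I2) simp
  qed measurable
  then show ?thesis by (simp add: Lp_space_def)
qed

lemma Lp_space_L1:
  fixes \<Omega> :: "'a::euclidean_space set"
  assumes \<Omega>: "open \<Omega>" "bounded \<Omega>" and u: "u \<in> Lp_space \<Omega> q" "1 \<le> q"
  shows "integrable (lebesgue_on \<Omega>) u"
proof -
  have "u \<in> Lp_space \<Omega> 1" using Lp_space_antimono[OF \<Omega> u(1)] u(2) by simp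
  then have "integrable (lebesgue_on \<Omega>) (\<lambda>x. \<bar>u x\<bar>)" "u \<in> borel_measurable (lebesgue_on \<Omega>)" by (auto simp: Lp_space_def)
  then show ?thesis using integrable_abs_cancel by blast
qed

lemma BV_seminorm_nonneg: "0 \<le> BV_seminorm \<Omega> u"
proof -
  have d: "divergence (\<lambda>x. 0::'a) x = 0" for x :: 'a
    by (simp add: divergence_def)
  have "(\<lambda>x. 0) \<in> BV_test_fields \<Omega>" by (simp add: BV_test_fields_def)
  then have "ereal (LINT x|lebesgue_on \<Omega>. - u x * divergence (\<lambda>x. 0) x) \<le> BV_seminorm \<Omega> u"
    unfolding BV_seminorm_def by (rule SUP_upper)
  then show ?thesis by (simp add: d zero_ereal_def)
qed

lemma Lp_norm_nonneg: "0 \<le> Lp_norm S p u" by (simp add: Lp_norm_def)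

text \<open>The arguments by Fubini's theorem require Borel measurability on the whole space, whereas members of
  \<open>Lp_space\<close> are Lebesgue measurable on \<open>\<Omega>\<close> only.\<close>

lemma BV_representative:
  fixes \<Omega> :: "'a::euclidean_space set"
  assumes \<Omega>: "open \<Omega>" "bounded \<Omega>" and q: "1 \<le> q" and u: "u \<in> Lp_space \<Omega> q" and M: "BV_norm \<Omega> u \<le> ereal M"
  shows "\<exists>f\<in>BV_family \<Omega> M. AE x in lebesgue_on \<Omega>. u x = f x"
proof -
  have \<Omega>b: "\<Omega> \<in> sets borel" and \<Omega>l: "\<Omega> \<in> sets lebesgue" using \<Omega> by auto
  have um: "u \<in> borel_measurable (lebesgue_on \<Omega>)" using u by (rule Lp_space_borel)
  have "(\<lambda>x. if x \<in> \<Omega> then u x else 0) \<in> borel_measurable lebesgue"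
    using um \<Omega>l by (simp add: borel_measurable_if)
  then obtain g where gm: "g \<in> borel_measurable lborel" and g: "AE x in lborel. (if x \<in> \<Omega> then u x else 0) = g x"
    using completion_ex_borel_measurable_real by blast
  define f where "f x = (if x \<in> \<Omega> then g x else 0)" for x
  have fm [measurable]: "f \<in> borel_measurable borel"
    unfolding f_def using gm \<Omega>b by measurable
  have f0: "x \<notin> \<Omega> \<Longrightarrow> f x = 0" for x by (simp add: f_def)
  have "AE x in lebesgue. x \<in> \<Omega> \<longrightarrow> u x = f x"
    by (rule AE_completion) (use g in \<open>eventually_elim, auto simp: f_def\<close>)
  then have uf: "AE x in lebesgue_on \<Omega>. u x = f x"
    using \<Omega>l by (subst AE_restrict_space_iff) auto
  have ui: "integrable (lebesgue_on \<Omega>) u" using Lp_space_L1[OF \<Omega> u q] .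
  have fm': "f \<in> borel_measurable (lebesgue_on \<Omega>)"
    by (rule measurable_restrict_space1) (use fm in \<open>simp add: measurable_completion\<close>)
  have fi: "integrable lborel f"
    using ui integrable_cong_AE[OF um fm' uf] lborel_lebesgue_on(2)[OF \<Omega>b fm f0] by simp
  have semin: "0 \<le> BV_seminorm \<Omega> u" by (rule BV_seminorm_nonneg)
  have norm1: "Lp_norm \<Omega> 1 u = (LINT x|lborel. \<bar>f x\<bar>)"
  proof -
    have "Lp_norm \<Omega> 1 u = (LINT x|lebesgue_on \<Omega>. \<bar>u x\<bar>)"
      unfolding Lp_norm_def by (simp add: integral_nonneg_AE)
    also have "\<dots> = (LINT x|lebesgue_on \<Omega>. \<bar>f x\<bar>)"
      using um fm' uf by (intro integral_cong_AE) auto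
    also have "\<dots> = (LINT x|lborel. \<bar>f x\<bar>)" by (rule lborel_lebesgue_on(1)[OF \<Omega>b]) (use fm f0 in auto)
    finally show ?thesis .
  qed
  have "ereal (Lp_norm \<Omega> 1 u) \<le> ereal M"
  proof -
    have "ereal (Lp_norm \<Omega> 1 u) + 0 \<le> BV_norm \<Omega> u" unfolding BV_norm_def using semin by (rule add_left_mono)
    then show ?thesis using M by (simp del: ereal_less_eq)
  qed
  then have fM: "(LINT x|lborel. \<bar>f x\<bar>) \<le> M" using norm1 by simp
  have "variation_le \<Omega> f M"
    unfolding variation_le_def
  proof
    fix \<sigma> assume \<sigma>: "\<sigma> \<in> BV_test_fields \<Omega>"
    let ?k = "\<lambda>x. - f x * (indicator \<Omega> x *\<^sub>R divergence \<sigma> x)"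
    have dc: "continuous_on \<Omega> (divergence \<sigma>)"
      unfolding divergence_def[abs_def] using \<sigma> by (auto intro!: continuous_intros simp: BV_test_fields_def)
    have dm [measurable]: "(\<lambda>x. indicator \<Omega> x *\<^sub>R divergence \<sigma> x) \<in> borel_measurable borel"
      by (rule borel_measurable_continuous_on_indicator[OF \<Omega>b dc])
    have dl: "divergence \<sigma> \<in> borel_measurable (lebesgue_on \<Omega>)"
      by (rule continuous_imp_measurable_on_sets_lebesgue[OF dc \<Omega>l])
    have km: "?k \<in> borel_measurable borel" by measurable
    have "(LINT x|lborel. - f x * divergence \<sigma> x) = (LINT x|lborel. ?k x)"
      by (intro Bochner_Integration.integral_cong) (auto simp: indicator_def f_def)
    also have "\<dots> = (LINT x|lebesgue_on \<Omega>. ?k x)"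
      by (rule lborel_lebesgue_on(1)[symmetric, OF \<Omega>b km]) (simp add: f0)
    also have "\<dots> = (LINT x|lebesgue_on \<Omega>. - u x * divergence \<sigma> x)"
    proof (rule integral_cong_AE)
      show "?k \<in> borel_measurable (lebesgue_on \<Omega>)"
        by (rule measurable_restrict_space1) (use km in \<open>simp add: measurable_completion\<close>)
      show "(\<lambda>x. - u x * divergence \<sigma> x) \<in> borel_measurable (lebesgue_on \<Omega>)" using um dl by measurable
      have "AE x in lebesgue_on \<Omega>. x \<in> \<Omega>" using \<Omega>l by (intro AE_I2) (simp add: space_restrict_space)
      then show "AE x in lebesgue_on \<Omega>. ?k x = - u x * divergence \<sigma> x" using uf by eventually_elim simp
    qed
    finally have eq: "(LINT x|lborel. - f x * divergence \<sigma> x) = (LINT x|lebesgue_on \<Omega>. - u x * divergence \<sigma> x)" .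
    have "ereal (LINT x|lborel. - f x * divergence \<sigma> x) \<le> BV_seminorm \<Omega> u"
      unfolding eq BV_seminorm_def using \<sigma> by (rule SUP_upper)
    also have "\<dots> \<le> BV_norm \<Omega> u"
      unfolding BV_norm_def using Lp_norm_nonneg[of \<Omega> 1 u] by (simp add: add_increasing)
    also have "\<dots> \<le> ereal M" by (rule M)
    finally show "(LINT x|lborel. - f x * divergence \<sigma> x) \<le> M" by simp
  qed
  then have "f \<in> BV_family \<Omega> M" using fi fM f0 by (auto simp: BV_family_def)
  then show ?thesis using uf by blast
qed

lemma BV_Lr_mass_bound:
  fixes \<Omega> :: "'a::euclidean_space set"
  assumes \<Omega>: "open \<Omega>" "bounded \<Omega>" "lipschitz_boundary \<Omega>" and q: "1 \<le> q" and p: "1 < p" "real DIM('a) \<le> p" and M: "0 \<le> M"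
  shows "\<exists>B\<ge>0. \<forall>u\<in>Lp_space \<Omega> q. BV_norm \<Omega> u \<le> ereal M \<longrightarrow>
     u \<in> Lp_space \<Omega> (p / (p - 1)) \<and> Lp_mass \<Omega> (p / (p - 1)) u \<le> B"
proof -
  let ?r = "p / (p - 1)"
  obtain B where B: "B \<ge> 0" "\<forall>f. integrable lborel f \<longrightarrow> variation_le \<Omega> f M \<longrightarrow> (\<forall>x. x \<notin> \<Omega> \<longrightarrow> f x = 0) \<longrightarrow>
    (LINT x|lborel. \<bar>f x\<bar>) \<le> M \<longrightarrow> (\<integral>\<^sup>+x. ennreal (\<bar>f x\<bar> powr ?r) \<partial>lborel) \<le> ennreal B"
    using BV_embeds_Lr[OF \<Omega> p M] by blast
  show ?thesis
  proof (intro exI[of _ B] conjI B(1) ballI impI)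
    fix u assume u: "u \<in> Lp_space \<Omega> q" and uM: "BV_norm \<Omega> u \<le> ereal M"
    obtain f where f: "f \<in> BV_family \<Omega> M" and uf: "AE x in lebesgue_on \<Omega>. u x = f x"
      using BV_representative[OF \<Omega>(1,2) q u uM] by blast
    have um [measurable]: "u \<in> borel_measurable (lebesgue_on \<Omega>)" using u by (rule Lp_space_borel)
    have fi: "integrable lborel f" and f0: "\<And>x. x \<notin> \<Omega> \<Longrightarrow> f x = 0" using f by (auto simp: BV_family_def)
    have fm: "f \<in> borel_measurable borel" using fi by auto
    have "(\<integral>\<^sup>+x. ennreal (\<bar>u x\<bar> powr ?r) \<partial>lebesgue_on \<Omega>) = (\<integral>\<^sup>+x. ennreal \<bar>\<bar>f x\<bar> powr ?r\<bar> \<partial>lebesgue_on \<Omega>)"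
      by (rule nn_integral_cong_AE) (use uf in \<open>eventually_elim, simp\<close>)
    also have "\<dots> = (\<integral>\<^sup>+x. ennreal \<bar>\<bar>f x\<bar> powr ?r\<bar> \<partial>lborel)"
      by (rule lborel_lebesgue_on(3)) (use \<Omega> fm f0 p in auto)
    also have "\<dots> \<le> ennreal B" using B(2) f by (auto simp: BV_family_def)
    finally have le: "(\<integral>\<^sup>+x. ennreal (\<bar>u x\<bar> powr ?r) \<partial>lebesgue_on \<Omega>) \<le> ennreal B" .
    have int: "integrable (lebesgue_on \<Omega>) (\<lambda>x. \<bar>u x\<bar> powr ?r)"
    proof (rule integrableI_bounded)
      show "(\<integral>\<^sup>+x. ennreal (norm (\<bar>u x\<bar> powr ?r)) \<partial>lebesgue_on \<Omega>) < \<infinity>"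
        using le_less_trans[OF le, of \<infinity>] by simp
    qed measurable
    then show "u \<in> Lp_space \<Omega> ?r" using um by (simp add: Lp_space_def)
    have "ennreal (Lp_mass \<Omega> ?r u) \<le> ennreal B" using le nn_integral_eq_integral[OF int] by simp
    then show "Lp_mass \<Omega> ?r u \<le> B" using B(1) by (simp add: ennreal_le_iff)
  qed
qed

text \<open>The limit inherits the \<open>L\<^sup>r\<close> bound by Fatou's lemma along an almost everywhere convergent subsequence.\<close>

lemma BV_bounded_L1_subsequence:
  fixes \<Omega> :: "'a::euclidean_space set"
  assumes \<Omega>: "open \<Omega>" "bounded \<Omega>" "lipschitz_boundary \<Omega>" and q: "1 \<le> q" and M: "0 \<le> M"
    and v: "\<And>n. v n \<in> Lp_space \<Omega> q" "\<And>n. BV_norm \<Omega> (v n) \<le> ereal M"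
    and B: "\<And>n. v n \<in> Lp_space \<Omega> r" "\<And>n. Lp_mass \<Omega> r (v n) \<le> B"
  shows "\<exists>k g. strict_mono (k::nat \<Rightarrow> nat) \<and> integrable (lebesgue_on \<Omega>) g \<and> g \<in> Lp_space \<Omega> r \<and> Lp_mass \<Omega> r g \<le> B \<and>
     (\<lambda>n. LINT x|lebesgue_on \<Omega>. \<bar>v (k n) x - g x\<bar>) \<longlonglongrightarrow> 0"
proof -
  have \<Omega>b: "\<Omega> \<in> sets borel" and \<Omega>l: "\<Omega> \<in> sets lebesgue" using \<Omega> by auto
  have "\<forall>n. \<exists>f. f \<in> BV_family \<Omega> M \<and> (AE x in lebesgue_on \<Omega>. v n x = f x)"
    using BV_representative[OF \<Omega>(1,2) q v] by blast
  from choice[OF this] obtain f where f: "\<forall>n. f n \<in> BV_family \<Omega> M \<and> (AE x in lebesgue_on \<Omega>. v n x = f n x)" ..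
  have f1: "f n \<in> BV_family \<Omega> M" for n using f by blast
  have f2: "AE x in lebesgue_on \<Omega>. v n x = f n x" for n using f by blast
  obtain k :: "nat \<Rightarrow> nat" and g0 where k: "strict_mono k" and g0: "integrable lborel g0"
    and lim0: "(\<lambda>n. LINT x|lborel. \<bar>f (k n) x - g0 x\<bar>) \<longlonglongrightarrow> 0"
    using BV_compact_L1[OF \<Omega> M, of f] f1 by blast
  define g where "g x = indicator \<Omega> x * g0 x" for x
  have [measurable]: "g0 \<in> borel_measurable borel" "\<Omega> \<in> sets borel" using g0 \<Omega>b by auto
  have gm [measurable]: "g \<in> borel_measurable borel" unfolding g_def by measurable
  have gi: "integrable lborel g"
    unfolding g_def using integrable_mult_indicator[of \<Omega> lborel g0] g0 by simp
  have gi': "integrable (lebesgue_on \<Omega>) g"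
    using lborel_lebesgue_on(2)[OF \<Omega>b gm] gi by (simp add: g_def)
  have fi: "integrable lborel (f n)" and f0: "\<And>x. x \<notin> \<Omega> \<Longrightarrow> f n x = 0" for n using f1[of n] by (auto simp: BV_family_def)
  have fm [measurable]: "f n \<in> borel_measurable borel" for n using fi[of n] by auto
  have vi: "integrable (lebesgue_on \<Omega>) (v n)" for n by (rule Lp_space_L1[OF \<Omega>(1,2) v(1) q])
  have eq: "(LINT x|lebesgue_on \<Omega>. \<bar>v n x - g x\<bar>) = (LINT x|lborel. \<bar>f n x - g x\<bar>)" for n
  proof -
    have "(\<lambda>x. \<bar>f n x - g x\<bar>) \<in> borel_measurable (lebesgue_on \<Omega>)"
      by (rule measurable_restrict_space1, rule measurable_completion) measurable
    then have "(LINT x|lebesgue_on \<Omega>. \<bar>v n x - g x\<bar>) = (LINT x|lebesgue_on \<Omega>. \<bar>f n x - g x\<bar>)"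
      using vi[of n] gi' f2[of n] by (intro integral_cong_AE) (auto elim: eventually_mono)
    also have "\<dots> = (LINT x|lborel. \<bar>f n x - g x\<bar>)"
      by (rule lborel_lebesgue_on(1)[OF \<Omega>b]) (auto simp: f0 g_def)
    finally show ?thesis .
  qed
  have lim: "(\<lambda>n. LINT x|lebesgue_on \<Omega>. \<bar>v (k n) x - g x\<bar>) \<longlonglongrightarrow> 0"
  proof (rule Lim_null_comparison[OF _ lim0], intro always_eventually allI)
    fix n
    have "(LINT x|lborel. \<bar>f (k n) x - g x\<bar>) \<le> (LINT x|lborel. \<bar>f (k n) x - g0 x\<bar>)"
    proof (rule integral_mono)
      show "integrable lborel (\<lambda>x. \<bar>f (k n) x - g x\<bar>)" "integrable lborel (\<lambda>x. \<bar>f (k n) x - g0 x\<bar>)"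
        using fi gi g0 by auto
      show "\<bar>f (k n) x - g x\<bar> \<le> \<bar>f (k n) x - g0 x\<bar>" for x
        by (cases "x \<in> \<Omega>") (auto simp: g_def f0)
    qed
    moreover have "0 \<le> (LINT x|lborel. \<bar>f (k n) x - g x\<bar>)" by (intro integral_nonneg_AE) auto
    ultimately show "norm (LINT x|lebesgue_on \<Omega>. \<bar>v (k n) x - g x\<bar>) \<le> (LINT x|lborel. \<bar>f (k n) x - g0 x\<bar>)"
      unfolding eq by simp
  qed
  have "integrable (lebesgue_on \<Omega>) (\<lambda>x. v (k n) x - g x)" for n using vi gi' by auto
  then obtain l :: "nat \<Rightarrow> nat" where l: "strict_mono l" and ae: "AE x in lebesgue_on \<Omega>. (\<lambda>n. v (k (l n)) x - g x) \<longlonglongrightarrow> 0"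
    using tendsto_L1_AE_subseq[of "lebesgue_on \<Omega>" "\<lambda>n x. v (k n) x - g x"] lim by (auto)
  have [measurable]: "v n \<in> borel_measurable (lebesgue_on \<Omega>)" for n using v(1) by (rule Lp_space_borel)
  have [measurable]: "g \<in> borel_measurable (lebesgue_on \<Omega>)" using gi' by auto
  have "(\<integral>\<^sup>+x. ennreal (\<bar>g x\<bar> powr r) \<partial>lebesgue_on \<Omega>) \<le> (\<integral>\<^sup>+x. liminf (\<lambda>n. ennreal (\<bar>v (k (l n)) x\<bar> powr r)) \<partial>lebesgue_on \<Omega>)"
  proof (rule nn_integral_mono_AE)
    show "AE x in lebesgue_on \<Omega>. ennreal (\<bar>g x\<bar> powr r) \<le> liminf (\<lambda>n. ennreal (\<bar>v (k (l n)) x\<bar> powr r))"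
      using ae
    proof eventually_elim
      case (elim x)
      then have "(\<lambda>n. v (k (l n)) x) \<longlonglongrightarrow> g x" by (simp add: LIM_zero_iff)
      then have L: "(\<lambda>n. \<bar>v (k (l n)) x\<bar>) \<longlonglongrightarrow> \<bar>g x\<bar>" by (rule tendsto_rabs)
      show ?case
      proof (cases "g x = 0")
        case False
        then have "(\<lambda>n. \<bar>v (k (l n)) x\<bar> powr r) \<longlonglongrightarrow> \<bar>g x\<bar> powr r"
          by (intro tendsto_powr L tendsto_const) simp
        then have "(\<lambda>n. ennreal (\<bar>v (k (l n)) x\<bar> powr r)) \<longlonglongrightarrow> ennreal (\<bar>g x\<bar> powr r)" by (rule tendsto_ennrealI)
        then have "liminf (\<lambda>n. ennreal (\<bar>v (k (l n)) x\<bar> powr r)) = ennreal (\<bar>g x\<bar> powr r)"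
          by (rule lim_imp_Liminf[OF trivial_limit_sequentially])
        then show ?thesis by simp
      qed simp
    qed
  qed
  also have "\<dots> \<le> liminf (\<lambda>n. \<integral>\<^sup>+x. ennreal (\<bar>v (k (l n)) x\<bar> powr r) \<partial>lebesgue_on \<Omega>)"
    by (rule nn_integral_liminf) measurable
  also have "\<dots> \<le> ennreal B"
  proof (rule Liminf_le)
    show "\<forall>\<^sub>F n in sequentially. (\<integral>\<^sup>+x. ennreal (\<bar>v (k (l n)) x\<bar> powr r) \<partial>lebesgue_on \<Omega>) \<le> ennreal B"
      using nn_integral_eq_integral[OF Lp_space_integrable[OF B(1)]] B(2)
      by (intro always_eventually allI) (simp add: ennreal_leI)
  qed simp
  finally have le: "(\<integral>\<^sup>+x. ennreal (\<bar>g x\<bar> powr r) \<partial>lebesgue_on \<Omega>) \<le> ennreal B" .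
  have int: "integrable (lebesgue_on \<Omega>) (\<lambda>x. \<bar>g x\<bar> powr r)"
  proof (rule integrableI_bounded)
    show "(\<integral>\<^sup>+x. ennreal (norm (\<bar>g x\<bar> powr r)) \<partial>lebesgue_on \<Omega>) < \<infinity>"
      using le_less_trans[OF le, of \<infinity>] by simp
  qed measurable
  then have gL: "g \<in> Lp_space \<Omega> r" by (simp add: Lp_space_def)
  have B0: "0 \<le> B" using Lp_mass_nonneg[of \<Omega> "v 0" r] B(2)[of 0] by linarith
  have "ennreal (Lp_mass \<Omega> r g) \<le> ennreal B" using le nn_integral_eq_integral[OF int] by simp
  then have "Lp_mass \<Omega> r g \<le> B" using B0 by (simp add: ennreal_le_iff)
  then show ?thesis using k gi' gL lim by blast
qed

section \<open>Stability of minimizers\<close>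

lemma LIMSEQ_if_subsubseq:
  fixes X :: "nat \<Rightarrow> real"
  assumes "\<And>k. strict_mono (k::nat \<Rightarrow> nat) \<Longrightarrow> \<exists>l. strict_mono (l::nat \<Rightarrow> nat) \<and> (\<lambda>n. X (k (l n))) \<longlonglongrightarrow> L"
  shows "X \<longlonglongrightarrow> L"
proof (rule ccontr)
  assume "\<not> X \<longlonglongrightarrow> L"
  then obtain e where e: "e > 0" "\<forall>N. \<exists>n\<ge>N. e \<le> dist (X n) L"
    unfolding lim_sequentially by (force simp: not_less)
  have "infinite {n. e \<le> dist (X n) L}"
    unfolding infinite_nat_iff_unbounded_le using e(2) by auto
  then obtain k :: "nat \<Rightarrow> nat" where k: "strict_mono k" "\<And>n. k n \<in> {n. e \<le> dist (X n) L}"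
    using infinite_enumerate by blast
  obtain l :: "nat \<Rightarrow> nat" where l: "strict_mono l" "(\<lambda>n. X (k (l n))) \<longlonglongrightarrow> L" using assms[OF k(1)] by blast
  then have "\<exists>N. \<forall>n\<ge>N. dist (X (k (l n))) L < e" using e(1) unfolding lim_sequentially by blast
  then obtain N where "dist (X (k (l N))) L < e" by blast
  moreover have "e \<le> dist (X (k (l N))) L" using k(2)[of "l N"] by simp
  ultimately show False by simp
qed

lemma Lp_minimizerD:
  assumes "Lp_minimizer S p F u"
  shows "u \<in> Lp_space S p" "v \<in> Lp_space S p \<Longrightarrow> F u \<le> F v"
  using assms unfolding Lp_minimizer_def is_arg_min_def by (auto simp: not_less)

lemma Lp_minimizerI:
  "u \<in> Lp_space S p \<Longrightarrow> (\<And>v. v \<in> Lp_space S p \<Longrightarrow> F u \<le> F v) \<Longrightarrow> Lp_minimizer S p F u"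
  unfolding Lp_minimizer_def is_arg_min_def by (auto simp: not_less)

text \<open>If the minimal value were infinite, every function would be a minimizer, in particular the constants \<open>0\<close> and \<open>1\<close>,
  which differ on the set \<open>\<Omega>\<close> of positive measure.\<close>

lemma unique_minimizer_finite:
  fixes \<Omega> :: "'a::euclidean_space set"
  assumes \<Omega>: "open \<Omega>" "bounded \<Omega>" "\<Omega> \<noteq> {}" and q: "0 \<le> q"
    and uniq: "Lp_unique_minimizer \<Omega> q F" and u: "Lp_minimizer \<Omega> q F u"
  shows "F u \<noteq> \<infinity>"
proof
  assume inf: "F u = \<infinity>"
  have all: "Lp_minimizer \<Omega> q F v" if "v \<in> Lp_space \<Omega> q" for v
  proof (rule Lp_minimizerI[OF that])
    fix w assume "w \<in> Lp_space \<Omega> q"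
    then have "F w = \<infinity>" using Lp_minimizerD(2)[OF u, of w] inf by simp
    then show "F v \<le> F w" by simp
  qed
  have c: "(\<lambda>x. c) \<in> Lp_space \<Omega> q" for c
    using integrable_const_lebesgue_on[OF \<Omega>(1,2)] by (simp add: Lp_space_def)
  obtain w where w: "\<And>v. Lp_minimizer \<Omega> q F v \<Longrightarrow> Lp_eq \<Omega> v w" using uniq unfolding Lp_unique_minimizer_def by blast
  have "AE x in lebesgue_on \<Omega>. 0 = w x" "AE x in lebesgue_on \<Omega>. 1 = w x"
    using w[OF all[OF c[of 0]]] w[OF all[OF c[of 1]]] unfolding Lp_eq_def .
  then have "AE x in lebesgue_on \<Omega>. False" by eventually_elim simp
  then have "emeasure (lebesgue_on \<Omega>) (space (lebesgue_on \<Omega>)) = 0"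
    using ae_filter_eq_bot_iff trivial_limit_def by metis
  moreover have "emeasure (lebesgue_on \<Omega>) (space (lebesgue_on \<Omega>)) = emeasure lborel \<Omega>"
    using \<Omega>(1) by (simp add: space_restrict_space emeasure_restrict_space)
  ultimately have "emeasure lborel \<Omega> = 0" by simp
  moreover obtain z e where ze: "0 < e" "cball z e \<subseteq> \<Omega>" using \<Omega>(1,3) open_contains_cball by blast
  have "0 < measure lborel (cball z e)" using ze(1) by (rule content_cball_pos)
  then have "emeasure lborel (cball z e) \<noteq> 0" by (simp add: measure_def) (metis enn2real_0 less_irrefl)
  ultimately show False using emeasure_mono[OF ze(2), of lborel] \<Omega>(1) by simp
qed

lemma finite_J_if_coercive:
  assumes "CBV_coercive \<Omega> q J F" "u \<in> Lp_space \<Omega> q" "F u \<noteq> \<infinity>"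
  shows "J u \<noteq> \<infinity>"
proof
  assume "J u = \<infinity>"
  then have "(\<lambda>n::nat. J u) \<longlonglongrightarrow> \<infinity>" by simp
  moreover have "(\<lambda>n::nat. J u) \<longlonglongrightarrow> \<infinity> \<longrightarrow> (\<lambda>n::nat. F u) \<longlonglongrightarrow> \<infinity>"
    using assms(1,2) unfolding CBV_coercive_def by (auto dest!: spec[of _ "\<lambda>n. u"])
  ultimately have "(\<lambda>n::nat. F u) \<longlonglongrightarrow> \<infinity>" by blast
  then have "F u = \<infinity>" using LIMSEQ_const_iff by blast
  then show False using assms(3) by simp
qed

text \<open>Uniform coercivity speaks of whole sequences \<open>v\<^sub>n\<close>, evaluated at the matching \<open>T\<^sub>n\<close>. If \<open>J (u\<^sub>n)\<close> were unbounded
  along a subsequence \<open>k\<close>, keeping \<open>u\<^sub>n\<close> at the indices in the range of \<open>k\<close> and filling the gaps with \<open>u\<close> at the index \<open>k n\<close> yields a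
  sequence with \<open>J (v\<^sub>n) \<rightarrow> \<infinity>\<close>, and \<open>T\<^sub>n (u\<^sub>n)\<close> would be unbounded along \<open>k\<close>.\<close>

lemma bounded_along_minimizers:
  fixes J :: "('a::euclidean_space \<Rightarrow> real) \<Rightarrow> ereal"
  assumes J0: "\<And>v. v \<in> Lp_space \<Omega> q \<Longrightarrow> 0 \<le> J v"
    and unif: "uniformly_CBV_coercive \<Omega> q J Tn"
    and u: "\<And>n. u n \<in> Lp_space \<Omega> q" and fin: "\<And>n. J (u n) \<noteq> \<infinity>"
    and up: "\<forall>\<^sub>F n in sequentially. Tn n (u n) \<le> ereal c"
  shows "\<exists>B>0. \<forall>n. J (u n) \<le> ereal B"
proof -
  have "\<exists>B N. \<forall>n\<ge>N. J (u n) \<le> ereal (real B)"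
  proof (rule ccontr)
    assume no: "\<not> (\<exists>B N. \<forall>n\<ge>N. J (u n) \<le> ereal (real B))"
    have "\<exists>n>m. ereal (real i) < J (u n)" for i m :: nat
    proof -
      have "\<not> (\<forall>n\<ge>Suc m. J (u n) \<le> ereal (real i))" using no by blast
      then show ?thesis by (auto simp: not_le Suc_le_eq)
    qed
    then have "\<forall>p. \<exists>n. snd p < n \<and> ereal (real (fst p)) < J (u n)" by blast
    from choice[OF this] obtain h where h: "\<And>p. snd p < h p \<and> ereal (real (fst p)) < J (u (h p))" by blast
    \<comment> \<open>A strictly increasing choice of indices at which \<open>J (u n)\<close> exceeds \<open>i\<close>.\<close>
    define k where "k = rec_nat (h (0, 0)) (\<lambda>i m. h (Suc i, m))"
    have kS: "k (Suc i) = h (Suc i, k i)" and k0: "k 0 = h (0, 0)" for i by (simp_all add: k_def)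
    have mono: "strict_mono k" unfolding strict_mono_Suc_iff using h kS by (metis snd_conv)
    have kJ: "ereal (real i) < J (u (k i))" for i
      using h[of "(0, 0)"] h[of "(i, k (i - 1))"] by (cases i) (auto simp: kS k0)
    define v where "v n = (if n \<in> range k then u n else u (k n))" for n
    have "(\<lambda>n. J (v n)) \<longlonglongrightarrow> \<infinity>"
      unfolding tendsto_PInfty
    proof (intro allI)
      fix r :: real
      obtain b :: nat where b: "r < real b" using reals_Archimedean2 by blast
      show "\<forall>\<^sub>F n in sequentially. ereal r < J (v n)"
      proof (rule eventually_sequentiallyI[of "k b"])
        fix n assume n: "k b \<le> n"
        have "\<exists>i\<ge>b. v n = u (k i)"
        proof (cases "n \<in> range k")
          case True
          then obtain i where i: "n = k i" by blast
          then have "b \<le> i" using n strict_mono_less_eq[OF mono] by simp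
          then show ?thesis using i True by (auto simp: v_def)
        next
          case False
          have "b \<le> n" using n seq_suble[OF mono, of b] by linarith
          then show ?thesis using False by (auto simp: v_def)
        qed
        then obtain i where i: "b \<le> i" "v n = u (k i)" by blast
        have "ereal r < ereal (real i)" using b i(1) by simp
        then show "ereal r < J (v n)" using kJ[of i] i(2) by (metis less_trans)
      qed
    qed
    moreover have "v n \<in> Lp_space \<Omega> q" for n by (simp add: v_def u)
    ultimately have "(\<lambda>n. Tn n (v n)) \<longlonglongrightarrow> \<infinity>" using unif unfolding uniformly_CBV_coercive_def by blast
    then have "(\<lambda>n. Tn (k n) (v (k n))) \<longlonglongrightarrow> \<infinity>" using LIMSEQ_subseq_LIMSEQ[OF _ mono] by (force simp: o_def)
    then have "\<forall>\<^sub>F n in sequentially. ereal c < Tn (k n) (v (k n))" unfolding tendsto_PInfty by blast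
    moreover have "\<forall>\<^sub>F n in sequentially. Tn (k n) (u (k n)) \<le> ereal c"
      using eventually_subseq[OF mono up] .
    ultimately have "\<forall>\<^sub>F n in sequentially. False" by eventually_elim (simp add: v_def)
    then show False by simp
  qed
  then obtain B N where BN: "\<And>n. n \<ge> N \<Longrightarrow> J (u n) \<le> ereal (real B)" by blast
  define A where "A = 1 + real B + (\<Sum>n<N. real_of_ereal (J (u n)))"
  have Jr: "J (u n) = ereal (real_of_ereal (J (u n)))" "0 \<le> real_of_ereal (J (u n))" for n
    using fin[of n] J0[OF u[of n]] by (auto simp: ereal_real' real_of_ereal_pos)
  have s0: "0 \<le> (\<Sum>n<N. real_of_ereal (J (u n)))" using Jr(2) by (intro sum_nonneg) auto
  have "J (u n) \<le> ereal A" for n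
  proof (cases "N \<le> n")
    case True
    have "ereal (real B) \<le> ereal A" using s0 by (simp add: A_def)
    then show ?thesis using BN[OF True] by (rule order_trans[rotated])
  next
    case False
    have "real_of_ereal (J (u n)) \<le> (\<Sum>n<N. real_of_ereal (J (u n)))"
      using False Jr(2) by (intro member_le_sum) auto
    then have "ereal (real_of_ereal (J (u n))) \<le> ereal A" by (simp add: A_def)
    then show ?thesis using Jr(1)[of n] by simp
  qed
  moreover have "0 < A" using s0 by (simp add: A_def add_pos_nonneg)
  ultimately show ?thesis by blast
qed

lemma ereal_close_bounds:
  fixes a b :: ereal
  assumes "\<bar>a - b\<bar> < ereal \<epsilon> \<or> a = \<infinity> \<and> b = \<infinity>"
  shows "a \<le> b + ereal \<epsilon>" "b \<le> a + ereal \<epsilon>"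
  using assms by (cases a; cases b; auto)+

text \<open>In \<open>T (u\<^sub>n) \<le> T\<^sub>n (u\<^sub>n) \<le> T\<^sub>n (ub) \<le> T (ub)\<close> the two outer inequalities hold up to \<open>\<epsilon> / 2\<close> each, by consistency.\<close>

lemma perturbed_minimizers_minimize:
  fixes J T :: "('a::euclidean_space \<Rightarrow> real) \<Rightarrow> ereal"
  assumes cons: "uniformly_consistent \<Omega> q J Tn T" and B: "0 < B"
    and ub: "ub \<in> Lp_space \<Omega> q" "J ub \<le> ereal B"
    and u: "\<And>n. Lp_minimizer \<Omega> q (Tn n) (u n)" and uB: "\<And>n. J (u n) \<le> ereal B" and \<epsilon>: "0 < \<epsilon>"
  shows "\<forall>\<^sub>F n in sequentially. T (u n) \<le> T ub + ereal \<epsilon>"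
proof -
  obtain N where N: "\<And>n w. n \<ge> N \<Longrightarrow> w \<in> Lp_space \<Omega> q \<Longrightarrow> J w \<le> ereal B \<Longrightarrow>
      \<bar>Tn n w - T w\<bar> < ereal (\<epsilon> / 2) \<or> Tn n w = \<infinity> \<and> T w = \<infinity>"
    using cons B \<epsilon> unfolding uniformly_consistent_def by (meson half_gt_zero)
  show ?thesis
  proof (rule eventually_sequentiallyI[of N])
    fix n assume n: "N \<le> n"
    have "T (u n) \<le> Tn n (u n) + ereal (\<epsilon> / 2)"
      by (rule ereal_close_bounds(2)[OF N[OF n Lp_minimizerD(1)[OF u] uB]])
    also have "\<dots> \<le> Tn n ub + ereal (\<epsilon> / 2)" by (intro add_right_mono Lp_minimizerD(2)[OF u ub(1)])
    also have "\<dots> \<le> (T ub + ereal (\<epsilon> / 2)) + ereal (\<epsilon> / 2)"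
      by (intro add_right_mono ereal_close_bounds(1)[OF N[OF n ub]])
    also have "\<dots> = T ub + ereal \<epsilon>" by (simp add: add.assoc)
    finally show "T (u n) \<le> T ub + ereal \<epsilon>" .
  qed
qed

text \<open>The common core of both parts of the theorem. The mode of convergence enters only through \<open>lsc\<close>: lower
  semicontinuity along subsequences that converge in \<open>L\<^sup>1\<close> with bounded \<open>L\<^sup>r\<close> mass.\<close>

lemma L1_convergence_to_unique_minimizer:
  fixes \<Omega> :: "'a::euclidean_space set"
  assumes \<Omega>: "open \<Omega>" "bounded \<Omega>" "lipschitz_boundary \<Omega>" and q: "1 \<le> q" "q \<le> r" and M: "0 \<le> M"
    and v: "\<And>n. v n \<in> Lp_space \<Omega> q" "\<And>n. BV_norm \<Omega> (v n) \<le> ereal M"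
    and B: "\<And>n. v n \<in> Lp_space \<Omega> r" "\<And>n. Lp_mass \<Omega> r (v n) \<le> B"
    and uniq: "Lp_unique_minimizer \<Omega> q T" and ub: "Lp_minimizer \<Omega> q T ub"
    and min: "\<And>\<epsilon>. 0 < \<epsilon> \<Longrightarrow> \<forall>\<^sub>F n in sequentially. T (v n) \<le> T ub + ereal \<epsilon>"
    and lsc: "\<And>k g. strict_mono (k::nat \<Rightarrow> nat) \<Longrightarrow> g \<in> Lp_space \<Omega> r \<Longrightarrow> Lp_mass \<Omega> r g \<le> B \<Longrightarrow>
        integrable (lebesgue_on \<Omega>) g \<Longrightarrow> (\<lambda>n. LINT x|lebesgue_on \<Omega>. \<bar>v (k n) x - g x\<bar>) \<longlonglongrightarrow> 0 \<Longrightarrow>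
        T g \<le> liminf (\<lambda>n. T (v (k n)))"
  shows "(\<lambda>n. LINT x|lebesgue_on \<Omega>. \<bar>v n x - ub x\<bar>) \<longlonglongrightarrow> 0"
proof (rule LIMSEQ_if_subsubseq)
  fix k :: "nat \<Rightarrow> nat" assume k: "strict_mono k"
  obtain l :: "nat \<Rightarrow> nat" and g where l: "strict_mono l" and g: "integrable (lebesgue_on \<Omega>) g" "g \<in> Lp_space \<Omega> r" "Lp_mass \<Omega> r g \<le> B"
     and lim: "(\<lambda>n. LINT x|lebesgue_on \<Omega>. \<bar>v (k (l n)) x - g x\<bar>) \<longlonglongrightarrow> 0"
    using BV_bounded_L1_subsequence[OF \<Omega> q(1) M, of "\<lambda>n. v (k n)" r B] v B by blast
  have kl: "strict_mono (\<lambda>n. k (l n))" using strict_mono_o[OF k l] by (simp add: o_def)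
  have "T g \<le> T ub + ereal \<epsilon>" if \<epsilon>: "0 < \<epsilon>" for \<epsilon>
  proof -
    have "T g \<le> liminf (\<lambda>n. T (v (k (l n))))" by (rule lsc[OF kl g(2,3,1) lim])
    also have "\<dots> \<le> T ub + ereal \<epsilon>"
      by (rule Liminf_le[OF sequentially_bot eventually_subseq[OF kl min[OF \<epsilon>]]])
    finally show ?thesis .
  qed
  then have "T g \<le> T ub" by (rule ereal_le_epsilon2)
  moreover have gq: "g \<in> Lp_space \<Omega> q" using Lp_space_antimono[OF \<Omega>(1,2) g(2)] q by simp
  ultimately have gmin: "Lp_minimizer \<Omega> q T g"
    by - (rule Lp_minimizerI, assumption, rule order_trans[OF _ Lp_minimizerD(2)[OF ub]])
  obtain w where w: "\<And>v. Lp_minimizer \<Omega> q T v \<Longrightarrow> Lp_eq \<Omega> v w" using uniq unfolding Lp_unique_minimizer_def by blast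
  have "AE x in lebesgue_on \<Omega>. g x = w x" "AE x in lebesgue_on \<Omega>. ub x = w x"
    using w[OF gmin] w[OF ub] unfolding Lp_eq_def .
  then have "AE x in lebesgue_on \<Omega>. g x = ub x" by eventually_elim simp
  have ubm: "ub \<in> borel_measurable (lebesgue_on \<Omega>)" "\<And>n. v n \<in> borel_measurable (lebesgue_on \<Omega>)"
    using Lp_space_borel Lp_minimizerD(1)[OF ub] v(1) by blast+
  have "(LINT x|lebesgue_on \<Omega>. \<bar>v (k (l n)) x - g x\<bar>) = (LINT x|lebesgue_on \<Omega>. \<bar>v (k (l n)) x - ub x\<bar>)" for n
  proof (rule integral_cong_AE)
    show "AE x in lebesgue_on \<Omega>. \<bar>v (k (l n)) x - g x\<bar> = \<bar>v (k (l n)) x - ub x\<bar>"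
      using \<open>AE x in lebesgue_on \<Omega>. g x = ub x\<close> by eventually_elim simp
  qed (use ubm g(1) in auto)
  then have "(\<lambda>n. LINT x|lebesgue_on \<Omega>. \<bar>v (k (l n)) x - ub x\<bar>) \<longlonglongrightarrow> 0" using lim by simp
  then show "\<exists>l. strict_mono (l::nat \<Rightarrow> nat) \<and> (\<lambda>n. LINT x|lebesgue_on \<Omega>. \<bar>v (k (l n)) x - ub x\<bar>) \<longlonglongrightarrow> 0"
    using l by blast
qed

theorem theorem2p2:
  fixes \<Omega> :: "'a::euclidean_space set"
    and q C :: real
    and J T :: "('a \<Rightarrow> real) \<Rightarrow> ereal"
    and Tn :: "nat \<Rightarrow> ('a \<Rightarrow> real) \<Rightarrow> ereal"
    and ubar :: "'a \<Rightarrow> real"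
    and u :: "nat \<Rightarrow> 'a \<Rightarrow> real"
  assumes "open \<Omega>" "connected \<Omega>" "\<Omega> \<noteq> {}" "bounded \<Omega>" "lipschitz_boundary \<Omega>"
    and "1 \<le> q"
    and "Lp_functional \<Omega> q J" "Lp_functional \<Omega> q T" "\<And>n. Lp_functional \<Omega> q (Tn n)"
    and "0 < C" "\<And>v. v \<in> Lp_space \<Omega> q \<Longrightarrow> BV_norm \<Omega> v \<le> ereal C * J v"
    and "CBV_coercive \<Omega> q J T" "\<And>n. CBV_coercive \<Omega> q J (Tn n)"
    and "Lp_unique_minimizer \<Omega> q T" "\<And>n. Lp_unique_minimizer \<Omega> q (Tn n)"
    and "uniformly_CBV_coercive \<Omega> q J Tn"
    and "uniformly_consistent \<Omega> q J Tn T"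
    and "Lp_minimizer \<Omega> q T ubar" "\<And>n. Lp_minimizer \<Omega> q (Tn n) (u n)"
  shows "((DIM('a) \<ge> 2 \<longrightarrow> q < real DIM('a) / (real DIM('a) - 1)) \<and>
           Lp_lsc \<Omega> q T \<and> (\<forall>n. Lp_lsc \<Omega> q (Tn n))
           \<longrightarrow> (\<lambda>n. Lp_norm \<Omega> q (\<lambda>x. u n x - ubar x)) \<longlonglongrightarrow> 0) \<and>
         (DIM('a) \<ge> 2 \<and> q = real DIM('a) / (real DIM('a) - 1) \<and>
           Lp_weakly_lsc \<Omega> q T \<and> (\<forall>n. Lp_weakly_lsc \<Omega> q (Tn n))
           \<longrightarrow> Lp_weakly_tendsto \<Omega> q (\<lambda>n x. u n x - ubar x) (\<lambda>_. 0))"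
proof -
  note \<Omega> = \<open>open \<Omega>\<close> \<open>bounded \<Omega>\<close> \<open>lipschitz_boundary \<Omega>\<close>
  note q = \<open>1 \<le> q\<close> and C = \<open>0 < C\<close>
  note BVJ = assms(11) and ub = \<open>Lp_minimizer \<Omega> q T ubar\<close> and um = assms(19)
  have ubL: "ubar \<in> Lp_space \<Omega> q" by (rule Lp_minimizerD(1)[OF ub])
  have uL: "u n \<in> Lp_space \<Omega> q" for n by (rule Lp_minimizerD(1)[OF um])
  have BV0: "0 \<le> BV_norm \<Omega> w" for w
    unfolding BV_norm_def using Lp_norm_nonneg[of \<Omega> 1 w] BV_seminorm_nonneg[of \<Omega> w] by simp
  have J0: "0 \<le> J w" if "w \<in> Lp_space \<Omega> q" for w
  proof -
    have "0 \<le> ereal C * J w" using BV0 BVJ[OF that] by (rule order_trans)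
    then show ?thesis using C by (cases "J w") (auto simp: zero_le_mult_iff)
  qed
  have Tfin: "T ubar \<noteq> \<infinity>"
    by (rule unique_minimizer_finite[OF \<Omega>(1,2) \<open>\<Omega> \<noteq> {}\<close> _ \<open>Lp_unique_minimizer \<Omega> q T\<close> ub]) (use q in simp)
  have Tnfin: "Tn n (u n) \<noteq> \<infinity>" for n
    by (rule unique_minimizer_finite[OF \<Omega>(1,2) \<open>\<Omega> \<noteq> {}\<close> _ assms(15) um]) (use q in simp)
  have Jub: "J ubar \<noteq> \<infinity>" by (rule finite_J_if_coercive[OF assms(12) ubL Tfin])
  have Ju: "J (u n) \<noteq> \<infinity>" for n by (rule finite_J_if_coercive[OF assms(13) uL Tnfin])
  have "T ubar \<noteq> -\<infinity>" using \<open>Lp_functional \<Omega> q T\<close> ubL unfolding Lp_functional_def by blast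
  then obtain t where t: "T ubar = ereal t" using Tfin by (cases "T ubar") auto
  obtain j where j: "J ubar = ereal j" "0 \<le> j" using Jub J0[OF ubL] by (cases "J ubar") auto
  have up: "\<forall>\<^sub>F n in sequentially. Tn n (u n) \<le> ereal (t + 1)"
  proof -
    have "0 < j + 1" using j by simp
    then obtain N where N: "\<And>n w. n \<ge> N \<Longrightarrow> w \<in> Lp_space \<Omega> q \<Longrightarrow> J w \<le> ereal (j + 1) \<Longrightarrow>
        \<bar>Tn n w - T w\<bar> < ereal 1 \<or> Tn n w = \<infinity> \<and> T w = \<infinity>"
      using \<open>uniformly_consistent \<Omega> q J Tn T\<close> unfolding uniformly_consistent_def by (meson zero_less_one)
    show ?thesis
    proof (rule eventually_sequentiallyI[of N])
      fix n assume n: "N \<le> n"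
      have "Tn n (u n) \<le> Tn n ubar" by (rule Lp_minimizerD(2)[OF um ubL])
      also have "\<dots> \<le> T ubar + ereal 1" by (rule ereal_close_bounds(1)[OF N[OF n ubL]]) (use j in simp)
      finally show "Tn n (u n) \<le> ereal (t + 1)" by (simp add: t)
    qed
  qed
  obtain B0 where B0: "0 < B0" "\<And>n. J (u n) \<le> ereal B0"
    using bounded_along_minimizers[OF J0 \<open>uniformly_CBV_coercive \<Omega> q J Tn\<close> uL Ju up] by blast
  define B where "B = max B0 j"
  have B: "0 < B" "J ubar \<le> ereal B" "J (u n) \<le> ereal B" for n
    using B0(1) B0(2)[of n] j by (auto simp: B_def le_max_iff_disj intro: order_trans)
  define M where "M = C * B"
  have M0: "0 \<le> M" using C B by (simp add: M_def)
  have BV_le: "BV_norm \<Omega> w \<le> ereal M" if w: "w \<in> Lp_space \<Omega> q" "J w \<le> ereal B" for w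
  proof -
    have "ereal C * J w \<le> ereal C * ereal B" using w(2) C by (intro ereal_mult_left_mono) auto
    then show ?thesis using BVJ[OF w(1)] by (simp add: M_def)
  qed
  have min: "\<forall>\<^sub>F n in sequentially. T (u n) \<le> T ubar + ereal \<epsilon>" if "0 < \<epsilon>" for \<epsilon>
    by (rule perturbed_minimizers_minimize[OF \<open>uniformly_consistent \<Omega> q J Tn T\<close> B(1) ubL B(2) um B(3) that])
  have L1: "integrable (lebesgue_on \<Omega>) w" if "w \<in> Lp_space \<Omega> q" for w by (rule Lp_space_L1[OF \<Omega>(1,2) that q])
  have q0: "0 \<le> q" using q by simp
  show ?thesis
  proof (intro conjI impI; elim conjE)
    assume sub: "2 \<le> DIM('a) \<longrightarrow> q < real DIM('a) / (real DIM('a) - 1)" and lsc: "Lp_lsc \<Omega> q T"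
    \<comment> \<open>In dimension one \<open>p = 1 + 1 / q\<close> corresponds to the exponent \<open>q + 1\<close>.\<close>
    obtain p where p: "1 < p" "real DIM('a) \<le> p" "q < p / (p - 1)"
    proof (cases "2 \<le> DIM('a)")
      case True
      then show ?thesis using sub that[of "real DIM('a)"] by simp
    next
      case False
      then have "DIM('a) = 1" using DIM_positive[where 'a='a] by linarith
      moreover have "(1 + 1 / q) / ((1 + 1 / q) - 1) = q + 1" using q by (simp add: field_simps)
      ultimately show ?thesis using q by (intro that[of "1 + 1 / q"]) auto
    qed
    define r where "r = p / (p - 1)"
    have r: "q < r" "0 \<le> r" using p q by (auto simp: r_def)
    obtain K where K: "\<forall>w\<in>Lp_space \<Omega> q. BV_norm \<Omega> w \<le> ereal M \<longrightarrow> w \<in> Lp_space \<Omega> r \<and> Lp_mass \<Omega> r w \<le> K"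
      using BV_Lr_mass_bound[OF \<Omega> q p(1,2) M0] unfolding r_def by blast
    have uK: "u n \<in> Lp_space \<Omega> r" "Lp_mass \<Omega> r (u n) \<le> K" for n using K uL BV_le B(3) by blast+
    have ubK: "ubar \<in> Lp_space \<Omega> r" "Lp_mass \<Omega> r ubar \<le> K" using K ubL BV_le B(2) by blast+
    have strong: "(\<lambda>n. Lp_norm \<Omega> q (\<lambda>x. v n x - g x)) \<longlonglongrightarrow> 0"
      if v: "\<And>n. v n \<in> Lp_space \<Omega> r" "\<And>n. Lp_mass \<Omega> r (v n) \<le> K" and g: "g \<in> Lp_space \<Omega> r" "Lp_mass \<Omega> r g \<le> K"
        and lim: "(\<lambda>n. LINT x|lebesgue_on \<Omega>. \<bar>v n x - g x\<bar>) \<longlonglongrightarrow> 0" for v g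
    proof (rule Lq_convergence_by_interpolation[OF q r(1) _ _ _ _ lim])
      have vq: "v n \<in> Lp_space \<Omega> q" and gq: "g \<in> Lp_space \<Omega> q" for n
        using Lp_space_antimono[OF \<Omega>(1,2)] v g q0 r by (meson less_imp_le)+
      show "(\<lambda>x. v n x - g x) \<in> Lp_space \<Omega> q" for n by (rule Lp_space_diff[OF vq gq q0])
      then show "integrable (lebesgue_on \<Omega>) (\<lambda>x. v n x - g x)" for n by (rule L1)
      show "(\<lambda>x. v n x - g x) \<in> Lp_space \<Omega> r" for n by (rule Lp_space_diff[OF v(1) g(1) r(2)])
      show "Lp_mass \<Omega> r (\<lambda>x. v n x - g x) \<le> 2 powr r * (2 * K)" for n
        by (rule Lp_mass_diff_le[OF v(1) g(1) r(2) v(2) g(2)])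
    qed
    have "(\<lambda>n. LINT x|lebesgue_on \<Omega>. \<bar>u n x - ubar x\<bar>) \<longlonglongrightarrow> 0"
    proof (rule L1_convergence_to_unique_minimizer[OF \<Omega> q less_imp_le[OF r(1)] M0 uL _ uK \<open>Lp_unique_minimizer \<Omega> q T\<close> ub min])
      show "BV_norm \<Omega> (u n) \<le> ereal M" for n by (rule BV_le[OF uL B(3)])
      fix k :: "nat \<Rightarrow> nat" and g
      assume g: "g \<in> Lp_space \<Omega> r" "Lp_mass \<Omega> r g \<le> K"
        and lim: "(\<lambda>n. LINT x|lebesgue_on \<Omega>. \<bar>u (k n) x - g x\<bar>) \<longlonglongrightarrow> 0"
      have "g \<in> Lp_space \<Omega> q" using Lp_space_antimono[OF \<Omega>(1,2) g(1) q0] r by simp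
      then have "Lp_tendsto \<Omega> q (\<lambda>n. u (k n)) g"
        unfolding Lp_tendsto_def using uL strong[of "\<lambda>n. u (k n)", OF uK g lim] by blast
      then show "T g \<le> liminf (\<lambda>n. T (u (k n)))" using lsc unfolding Lp_lsc_def by blast
    qed
    then show "(\<lambda>n. Lp_norm \<Omega> q (\<lambda>x. u n x - ubar x)) \<longlonglongrightarrow> 0" by (rule strong[OF uK ubK])
  next
    assume d: "2 \<le> DIM('a)" and qd: "q = real DIM('a) / (real DIM('a) - 1)" and lsc: "Lp_weakly_lsc \<Omega> q T"
    have p: "1 < real DIM('a)" "real DIM('a) \<le> real DIM('a)" using d by auto
    have q1: "1 < q" using p unfolding qd by (simp add: divide_simps)
    obtain K where K: "\<forall>w\<in>Lp_space \<Omega> q. BV_norm \<Omega> w \<le> ereal M \<longrightarrow> w \<in> Lp_space \<Omega> q \<and> Lp_mass \<Omega> q w \<le> K"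
      using BV_Lr_mass_bound[OF \<Omega> q p M0] unfolding qd[symmetric] by blast
    have uK: "Lp_mass \<Omega> q (u n) \<le> K" for n using K uL BV_le B(3) by blast
    have ubK: "Lp_mass \<Omega> q ubar \<le> K" using K ubL BV_le B(2) by blast
    have weak: "(\<lambda>n. \<phi> (\<lambda>x. v n x - g x)) \<longlonglongrightarrow> 0"
      if v: "\<And>n. v n \<in> Lp_space \<Omega> q" "\<And>n. Lp_mass \<Omega> q (v n) \<le> K" and g: "g \<in> Lp_space \<Omega> q" "Lp_mass \<Omega> q g \<le> K"
        and lim: "(\<lambda>n. LINT x|lebesgue_on \<Omega>. \<bar>v n x - g x\<bar>) \<longlonglongrightarrow> 0" and \<phi>: "\<phi> \<in> Lp_dual \<Omega> q" for v g \<phi>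
    proof (rule weakly_null_if_bounded_and_L1_null[OF q1 _ _ _ lim \<phi>])
      show "(\<lambda>x. v n x - g x) \<in> Lp_space \<Omega> q" for n by (rule Lp_space_diff[OF v(1) g(1) q0])
      then show "integrable (lebesgue_on \<Omega>) (\<lambda>x. v n x - g x)" for n by (rule L1)
      show "Lp_mass \<Omega> q (\<lambda>x. v n x - g x) \<le> 2 powr q * (2 * K)" for n
        by (rule Lp_mass_diff_le[OF v(1) g(1) q0 v(2) g(2)])
    qed
    have "(\<lambda>n. LINT x|lebesgue_on \<Omega>. \<bar>u n x - ubar x\<bar>) \<longlonglongrightarrow> 0"
    proof (rule L1_convergence_to_unique_minimizer[OF \<Omega> q order_refl M0 uL _ uL uK \<open>Lp_unique_minimizer \<Omega> q T\<close> ub min])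
      show "BV_norm \<Omega> (u n) \<le> ereal M" for n by (rule BV_le[OF uL B(3)])
      fix k :: "nat \<Rightarrow> nat" and g
      assume g: "g \<in> Lp_space \<Omega> q" "Lp_mass \<Omega> q g \<le> K"
        and lim: "(\<lambda>n. LINT x|lebesgue_on \<Omega>. \<bar>u (k n) x - g x\<bar>) \<longlonglongrightarrow> 0"
      have "(\<lambda>n. \<phi> (u (k n))) \<longlonglongrightarrow> \<phi> g" if \<phi>: "\<phi> \<in> Lp_dual \<Omega> q" for \<phi>
      proof -
        have "(\<lambda>n. \<phi> (\<lambda>x. u (k n) x - g x) + \<phi> g) \<longlonglongrightarrow> 0 + \<phi> g"
          by (intro tendsto_add tendsto_const weak[of "\<lambda>n. u (k n)", OF uL uK g lim \<phi>])
        moreover have "\<phi> (\<lambda>x. u (k n) x - g x) + \<phi> g = \<phi> (u (k n))" for n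
          using Lp_dualD(1)[OF \<phi> Lp_space_diff[OF uL[of "k n"] g(1) q0] g(1)] by simp
        ultimately show ?thesis by simp
      qed
      then have "Lp_weakly_tendsto \<Omega> q (\<lambda>n. u (k n)) g"
        unfolding Lp_weakly_tendsto_def using uL g by blast
      then show "T g \<le> liminf (\<lambda>n. T (u (k n)))" using lsc unfolding Lp_weakly_lsc_def by blast
    qed
    note L1_lim = this
    show "Lp_weakly_tendsto \<Omega> q (\<lambda>n x. u n x - ubar x) (\<lambda>_. 0)"
      unfolding Lp_weakly_tendsto_def
    proof (intro conjI allI ballI)
      show "(\<lambda>_. 0) \<in> Lp_space \<Omega> q" by (simp add: Lp_space_def)
      show "(\<lambda>x. u n x - ubar x) \<in> Lp_space \<Omega> q" for n by (rule Lp_space_diff[OF uL ubL q0])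
      fix \<phi> assume \<phi>: "\<phi> \<in> Lp_dual \<Omega> q"
      have "\<phi> (\<lambda>_. 0) = 0" using Lp_dualD(2)[OF \<phi> ubL, of 0] by simp
      then show "(\<lambda>n. \<phi> (\<lambda>x. u n x - ubar x)) \<longlonglongrightarrow> \<phi> (\<lambda>_. 0)"
        using weak[of u ubar \<phi>, OF uL uK ubL ubK L1_lim \<phi>] by simp
    qed
  qed
qed

end
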